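(* Let $(R,\mathfrak m)$ be a $d$-dimensional regular local ring with $d\ge 2$, and fix $d$ elements $x_1,\dots,x_d$ with $\mathfrak m=(x_1,\dots,x_d)R$. Let $R=R_0\subset R_1\subset R_2\subset\cdots$ be an infinite sequence of regular local rings $(R_i,\mathfrak m_i)$ such that $R_{i+1}$ is a monomial local quadratic transformation of $R_i$ for each $i\ge 0$ (with respect to the fixed $x_1,\dots,x_d$ and the induced variables). For $1\le k\le d$, let $\mathfrak D_k$ be the set of nonnegative integers $i$ for which the transform from $R_i$ to $R_{i+1}$ is in the $x_k$-direction. Let $S=\bigcup_{i\ge 0}R_i$ and let $V$ be a valuation domain that birationally dominates $S$. Then the following are equivalent: (1) The sets $\mathfrak D_1,\dots,\mathfrak D_d$ are all infinite. (2) The sequence $\{(R_n,\mathfrak m_n)\}_{n\ge0}$ switches strongly infinitely often. (3) $S=V$ and $V$ has rank $1$.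
   Context: Monomial sequences: put $x_{0,k}=x_k$. Given $(R_i,\mathfrak m_i)$ with $\mathfrak m_i=(x_{i,1},\dots,x_{i,d})R_i$ and $k\in\{1,\dots,d\}$, the monomial local quadratic transformation of $R_i$ in the $x_k$-direction is $R_{i+1}=R_i[\mathfrak m_i/x_{i,k}]_{(x_{i+1,1},\dots,x_{i+1,d})}$, where $x_{i+1,k}=x_{i,k}$ and $x_{i+1,l}=x_{i,l}/x_{i,k}$ for $l\ne k$; its maximal ideal is $\mathfrak m_{i+1}=(x_{i+1,1},\dots,x_{i+1,d})R_{i+1}$. A monomial local quadratic transformation of $R_i$ is one of these $d$ rings. The ring $S$ is a local domain with maximal ideal $\mathfrak m_S=\bigcup_{i\ge0}\mathfrak m_i$ and the same field of fractions as $R$. A valuation domain $(V,\mathfrak m_V)$ birationally dominates a local domain $(A,\mathfrak n)$ if $A\subset V\subset \operatorname{Frac}(A)$ and $\mathfrak m_V\cap A=\mathfrak n$. The rank of $V$ is its Krull dimension. The sequence $\{(R_n,\mathfrak m_n)\}$ switches strongly infinitely often if there do not exist an integer $j\ge0$ and a height one prime ideal $\mathfrak p_j$ of $R_j$ with $\bigcup_{n\ge0}R_n\subset(R_j)_{\mathfrak p_j}$. *)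

theory Defs
  imports "HOL-Algebra.Algebra" "HOL-Library.Extended_Nat"
begin

text \<open>
  Intrinsic notions of commutative algebra are stated for an arbitrary ring record. All rings
  that share a field of fractions are subsets \<open>A\<close> of the carrier of one field \<open>K\<close>, and an
  intrinsic notion is applied to such a subring through the record \<open>K\<lparr>carrier := A\<rparr>\<close>.
\<close>

section \<open>Dimension theory and regular local rings\<close>

definition prime_chain :: "('a, 'b) ring_scheme \<Rightarrow> nat \<Rightarrow> (nat \<Rightarrow> 'a set) \<Rightarrow> bool" where
  "prime_chain R n p \<longleftrightarrow> (\<forall>i\<le>n. primeideal (p i) R) \<and> (\<forall>i<n. p i \<subset> p (Suc i))"

definition krull_dim :: "('a, 'b) ring_scheme \<Rightarrow> enat" where
  "krull_dim R = (SUP n \<in> {n. \<exists>p. prime_chain R n p}. enat n)"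

definition height :: "('a, 'b) ring_scheme \<Rightarrow> 'a set \<Rightarrow> enat" where
  "height R P = (SUP n \<in> {n. \<exists>p. prime_chain R n p \<and> p n = P}. enat n)"

locale local_ring = cring R for R (structure) +
  assumes ex1_maximalideal: "\<exists>!M. maximalideal M R"

definition max_ideal :: "('a, 'b) ring_scheme \<Rightarrow> 'a set" where
  "max_ideal R = (THE M. maximalideal M R)"

text \<open>The minimal number of generators is only meaningful for finitely generated ideals.\<close>

definition min_generators :: "('a, 'b) ring_scheme \<Rightarrow> 'a set \<Rightarrow> nat" where
  "min_generators R I = (LEAST n. \<exists>G \<subseteq> carrier R. finite G \<and> card G = n \<and> Idl\<^bsub>R\<^esub> G = I)"

locale regular_local_ring = noetherian_ring R + local_ring R for R (structure) +
  assumes regular: "krull_dim R = enat (min_generators R (max_ideal R))"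


section \<open>Subrings of a field\<close>

text \<open>
  The localization of the subring \<open>A\<close> of \<open>K\<close> at its prime ideal \<open>P\<close>, as a subset of \<open>K\<close>.
  Since \<open>P\<close> contains zero, the denominators are units of \<open>K\<close>.
\<close>

definition localization :: "('a, 'b) ring_scheme \<Rightarrow> 'a set \<Rightarrow> 'a set \<Rightarrow> 'a set" where
  "localization K A P = {a \<otimes>\<^bsub>K\<^esub> inv\<^bsub>K\<^esub> s | a s. a \<in> A \<and> s \<in> A - P}"

definition fraction_field :: "('a, 'b) ring_scheme \<Rightarrow> 'a set \<Rightarrow> 'a set" where
  "fraction_field K A = localization K A {\<zero>\<^bsub>K\<^esub>}"

definition valuation_domain :: "('a, 'b) ring_scheme \<Rightarrow> 'a set \<Rightarrow> bool" where
  "valuation_domain K V \<longleftrightarrow> subring V K \<and>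
     (\<forall>z \<in> fraction_field K V - {\<zero>\<^bsub>K\<^esub>}. z \<in> V \<or> inv\<^bsub>K\<^esub> z \<in> V)"

definition birationally_dominates :: "('a, 'b) ring_scheme \<Rightarrow> 'a set \<Rightarrow> 'a set \<Rightarrow> bool" where
  "birationally_dominates K V A \<longleftrightarrow> A \<subseteq> V \<and> V \<subseteq> fraction_field K A \<and>
     max_ideal (K\<lparr>carrier := V\<rparr>) \<inter> A = max_ideal (K\<lparr>carrier := A\<rparr>)"


section \<open>Monomial local quadratic transformations\<close>

text \<open>
  \<open>monomial_lqt K d k A x A' x'\<close>: the local ring \<open>A'\<close> with variables \<open>x' 1, \<dots>, x' d\<close> is the
  monomial local quadratic transformation of \<open>A\<close>, with variables \<open>x 1, \<dots>, x d\<close>, in the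
  \<open>x k\<close>-direction. Below, \<open>B\<close> is the ring obtained from \<open>A\<close> by adjoining all \<open>y / x k\<close> with \<open>y\<close>
  in the maximal ideal of \<open>A\<close>. The values of \<open>x\<close> and \<open>x'\<close> outside \<open>{1..d}\<close> play no role.
\<close>

definition monomial_lqt ::
    "('a, 'b) ring_scheme \<Rightarrow> nat \<Rightarrow> nat \<Rightarrow> 'a set \<Rightarrow> (nat \<Rightarrow> 'a) \<Rightarrow> 'a set \<Rightarrow> (nat \<Rightarrow> 'a) \<Rightarrow> bool" where
  "monomial_lqt K d k A x A' x' \<longleftrightarrow>
     k \<in> {1..d} \<and>
     x' k = x k \<and>
     (\<forall>l \<in> {1..d} - {k}. x' l = x l \<otimes>\<^bsub>K\<^esub> inv\<^bsub>K\<^esub> (x k)) \<and>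
     (let B = generate_ring K
                (A \<union> {y \<otimes>\<^bsub>K\<^esub> inv\<^bsub>K\<^esub> (x k) | y. y \<in> max_ideal (K\<lparr>carrier := A\<rparr>)})
      in A' = localization K B (Idl\<^bsub>K\<lparr>carrier := B\<rparr>\<^esub> (x' ` {1..d})))"

definition direction_set ::
    "('a, 'b) ring_scheme \<Rightarrow> nat \<Rightarrow> (nat \<Rightarrow> 'a set) \<Rightarrow> (nat \<Rightarrow> nat \<Rightarrow> 'a) \<Rightarrow> nat \<Rightarrow> nat set" where
  "direction_set K d R x k = {i. monomial_lqt K d k (R i) (x i) (R (Suc i)) (x (Suc i))}"

definition switches_strongly_infinitely_often ::
    "('a, 'b) ring_scheme \<Rightarrow> (nat \<Rightarrow> 'a set) \<Rightarrow> bool" where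
  "switches_strongly_infinitely_often K R \<longleftrightarrow>
     \<not> (\<exists>j p. primeideal p (K\<lparr>carrier := R j\<rparr>) \<and> height (K\<lparr>carrier := R j\<rparr>) p = 1 \<and>
              (\<Union>n. R n) \<subseteq> localization K (R j) p)"

end

theory Submission
  imports Defs
begin

text \<open>
  Write \<open>\<mm>\<^sub>i\<close> for the maximal ideal of \<open>R\<^sub>i\<close>. The proof runs in a cycle: if every
  direction recurs, then \<open>S = V\<close> has rank one; if \<open>S\<close> has rank one, the sequence switches
  strongly infinitely often; and if some direction does not recur, it does not.

  Suppose that every direction recurs. A Laurent monomial in the variables of \<open>R\<^sub>i\<close> is a
  Laurent monomial in those of \<open>R\<^sub>i\<^sub>+\<^sub>1\<close>; its exponent vector changes in the coordinate
  \<open>k\<close> of the direction only, where the new entry is the sum of all old entries. Each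
  integer vector acquires entries of one sign after finitely many such steps
  (\<open>sum_steps_eventually_signed\<close>), so that of any two monomials one eventually divides the
  other. This orders the monomials of \<open>R\<^sub>i\<close> totally, with finitely many monomials below a
  given one. A nonzero \<open>f\<close> of \<open>R\<^sub>i\<close> cannot lie in the ideal generated by the monomials
  above \<open>u\<close> for all \<open>u\<close>, by Krull's intersection theorem; at the last \<open>u\<close> for which it
  does, its coefficient is a unit, and \<open>f\<close> becomes a unit times \<open>u\<close>
  (\<open>unit_times_monomial\<close>). Hence \<open>S\<close> is a valuation ring, which no other valuation ring
  dominates birationally, and it has rank one since a nonnegative nonzero exponent vector
  becomes strictly positive.

  Suppose that \<open>S\<close> has rank one. If it were contained in the localization of \<open>R\<^sub>j\<close> at a
  height one prime \<open>p\<close>, then \<open>p\<close> would be the contraction of a nonzero prime of \<open>S\<close>, hence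
  \<open>p = \<mm>\<^sub>j\<close>, and all \<open>R\<^sub>n\<close> with \<open>n \<ge> j\<close> would equal \<open>R\<^sub>j\<close>. The products of the \<open>d\<close>
  variables of the rings \<open>R\<^sub>n\<close> would then generate a strictly ascending chain of ideals of
  \<open>R\<^sub>j\<close> (\<open>R_not_eventually_constant\<close>).

  Suppose that some direction does not recur. By Krull's principal ideal theorem a chain
  of primes that ends at \<open>\<mm>\<^sub>i\<close> can be moved, with its ends fixed, so that given elements
  of \<open>\<mm>\<^sub>i\<close> enter one at a time (\<open>prime_chain_contains\<close>). If all variables except that of
  the direction lie in the last prime before \<open>\<mm>\<^sub>i\<close>, then \<open>R\<^sub>i\<^sub>+\<^sub>1\<close> is contained in the
  localization of \<open>R\<^sub>i\<close> at that prime, and the chain extends to a chain of the same length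
  in \<open>R\<^sub>i\<^sub>+\<^sub>1\<close> (\<open>prime_chain_transform\<close>). So every \<open>R\<^sub>i\<close> has a chain of length \<open>d\<close>. If the
  direction \<open>k\<^sub>0\<close> is not used from \<open>j\<close> on, choose the chain in \<open>R\<^sub>j\<close> such that its second
  prime \<open>p\<close> contains the variable of index \<open>k\<^sub>0\<close>. Then \<open>p\<close> has height one, the part of the
  chain above \<open>p\<close> survives all later transforms, and therefore \<open>S\<close> is contained in the
  localization of \<open>R\<^sub>j\<close> at \<open>p\<close>.
\<close>

section \<open>Saturation and descending chains of ideals\<close>

(* The symbol <+> is reserved for the sum of ideals. *)
no_notation Sum_Type.Plus (infixr \<open><+>\<close> 65)

locale noetherian_cring = noetherian_ring + cring

definition colon :: "('a, 'b) ring_scheme \<Rightarrow> 'a set \<Rightarrow> 'a \<Rightarrow> 'a set" where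
  "colon R I b = {r \<in> carrier R. r \<otimes>\<^bsub>R\<^esub> b \<in> I}"

text \<open>
  The contraction to \<open>R\<close> of the extension of \<open>I\<close> to the localization of \<open>R\<close> at the prime \<open>q\<close>. Working with
  saturated ideals replaces working in the localized ring.
\<close>

definition sat :: "('a, 'b) ring_scheme \<Rightarrow> 'a set \<Rightarrow> 'a set \<Rightarrow> 'a set" where
  "sat R q I = {a \<in> carrier R. \<exists>s \<in> carrier R - q. s \<otimes>\<^bsub>R\<^esub> a \<in> I}"

context cring
begin

lemma ideal_of_closed:
  assumes "I \<subseteq> carrier R" "\<zero> \<in> I" "\<And>a b. a \<in> I \<Longrightarrow> b \<in> I \<Longrightarrow> a \<oplus> b \<in> I"
    and "\<And>r a. r \<in> carrier R \<Longrightarrow> a \<in> I \<Longrightarrow> r \<otimes> a \<in> I"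
  shows "ideal I R"
proof (rule idealI)
  show "ring R" by (rule ring_axioms)
  show "subgroup I (add_monoid R)"
  proof (rule add.subgroupI)
    fix a assume a: "a \<in> I"
    have "\<ominus> a = \<ominus> \<one> \<otimes> a" using a assms(1) by (auto simp: l_minus)
    then show "\<ominus> a \<in> I" using assms(4)[of "\<ominus> \<one>" a] a by simp
  qed (use assms in auto)
  show "x \<otimes> a \<in> I" if "a \<in> I" "x \<in> carrier R" for a x using that assms by blast
  show "a \<otimes> x \<in> I" if "a \<in> I" "x \<in> carrier R" for a x
    using that assms m_comm[of a x] by auto
qed

lemma ideal_closed:
  assumes "ideal I R"
  shows "I \<subseteq> carrier R" "\<zero> \<in> I" "\<And>a b. a \<in> I \<Longrightarrow> b \<in> I \<Longrightarrow> a \<oplus> b \<in> I"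
    "\<And>r a. r \<in> carrier R \<Longrightarrow> a \<in> I \<Longrightarrow> r \<otimes> a \<in> I" "\<And>a. a \<in> I \<Longrightarrow> \<ominus> a \<in> I"
    "\<And>a b. a \<in> I \<Longrightarrow> b \<in> I \<Longrightarrow> a \<ominus> b \<in> I"
proof -
  interpret ideal I R by fact
  show "I \<subseteq> carrier R" "\<zero> \<in> I" "\<And>a b. a \<in> I \<Longrightarrow> b \<in> I \<Longrightarrow> a \<oplus> b \<in> I"
    "\<And>r a. r \<in> carrier R \<Longrightarrow> a \<in> I \<Longrightarrow> r \<otimes> a \<in> I" "\<And>a. a \<in> I \<Longrightarrow> \<ominus> a \<in> I"
    "\<And>a b. a \<in> I \<Longrightarrow> b \<in> I \<Longrightarrow> a \<ominus> b \<in> I"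
    by (auto simp: I_l_closed a_minus_def)
qed

lemma prime_one: "primeideal q R \<Longrightarrow> \<one> \<notin> q"
  using ideal.one_imp_carrier primeideal.I_notcarr primeideal.axioms(1) by metis

lemma prime_mult:
  "primeideal q R \<Longrightarrow> a \<in> carrier R - q \<Longrightarrow> b \<in> carrier R - q \<Longrightarrow> a \<otimes> b \<in> carrier R - q"
  using primeideal.I_prime by fastforce

lemma mem_set_add: "a \<in> I <+> J \<longleftrightarrow> (\<exists>i\<in>I. \<exists>j\<in>J. a = i \<oplus> j)"
  by (auto simp: set_add_defs)

lemma mem_PIdl: "a \<in> PIdl b \<longleftrightarrow> (\<exists>r\<in>carrier R. a = r \<otimes> b)"
  by (auto simp: cgenideal_def)

lemma set_add_upper:
  assumes "ideal I R" "ideal J R"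
  shows "I \<subseteq> I <+> J" "J \<subseteq> I <+> J"
proof
  fix a assume "a \<in> I"
  then show "a \<in> I <+> J"
    unfolding mem_set_add using ideal_closed[OF assms(1)] ideal_closed[OF assms(2)]
    by (intro bexI[of _ a] bexI[of _ \<zero>]) auto
next
  show "J \<subseteq> I <+> J"
  proof
    fix a assume "a \<in> J"
    then show "a \<in> I <+> J"
      unfolding mem_set_add using ideal_closed[OF assms(1)] ideal_closed[OF assms(2)]
      by (intro bexI[of _ \<zero>] bexI[of _ a]) auto
  qed
qed

lemma set_add_least:
  fixes I J K :: "'a set"
  assumes "ideal K R" "I \<subseteq> K" "J \<subseteq> K"
  shows "I <+> J \<subseteq> K"
proof
  fix a assume "a \<in> I <+> J"
  then obtain i j where "i \<in> I" "j \<in> J" "a = i \<oplus> j" by (auto simp: mem_set_add)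
  then show "a \<in> K" using assms ideal_closed(3)[OF assms(1)] by blast
qed

lemma ideal_colon:
  assumes "ideal I R" "b \<in> carrier R"
  shows "ideal (colon R I b) R"
  using ideal_closed[OF assms(1)] assms(2)
  by (intro ideal_of_closed) (auto simp: colon_def l_distr m_assoc)

lemma ideal_sat:
  assumes q: "primeideal q R" and I: "ideal I R"
  shows "ideal (sat R q I) R"
proof (rule ideal_of_closed)
  note Ic = ideal_closed[OF I]
  show "sat R q I \<subseteq> carrier R" by (auto simp: sat_def)
  show "\<zero> \<in> sat R q I" using prime_one[OF q] Ic by (auto simp: sat_def intro!: bexI[of _ \<one>])
  show "a \<oplus> b \<in> sat R q I" if ab: "a \<in> sat R q I" "b \<in> sat R q I" for a b
  proof -
    from ab obtain s t where st: "s \<in> carrier R - q" "t \<in> carrier R - q"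
      "s \<otimes> a \<in> I" "t \<otimes> b \<in> I" "a \<in> carrier R" "b \<in> carrier R" by (auto simp: sat_def)
    have "(s \<otimes> t) \<otimes> (a \<oplus> b) = t \<otimes> (s \<otimes> a) \<oplus> s \<otimes> (t \<otimes> b)" using st by auto algebra
    then have "(s \<otimes> t) \<otimes> (a \<oplus> b) \<in> I" using st Ic by auto
    then show ?thesis using st prime_mult[OF q st(1,2)] by (auto simp: sat_def)
  qed
  show "r \<otimes> a \<in> sat R q I" if ra: "r \<in> carrier R" "a \<in> sat R q I" for r a
  proof -
    from ra obtain s where s: "s \<in> carrier R - q" "s \<otimes> a \<in> I" "a \<in> carrier R" by (auto simp: sat_def)
    have "s \<otimes> (r \<otimes> a) = r \<otimes> (s \<otimes> a)" using s ra(1) by (simp add: m_lcomm)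
    then have "s \<otimes> (r \<otimes> a) \<in> I" using Ic s ra by auto
    then show ?thesis using s ra by (auto simp: sat_def)
  qed
qed

lemma sat_upper: "primeideal q R \<Longrightarrow> ideal I R \<Longrightarrow> I \<subseteq> sat R q I"
  using prime_one[of q] ideal_closed(1)[of I] by (auto simp: sat_def intro!: bexI[of _ \<one>])

lemma sat_mono: "I \<subseteq> J \<Longrightarrow> sat R q I \<subseteq> sat R q J"
  by (auto simp: sat_def)

lemma sat_sat: 
  assumes "primeideal q R" "ideal I R"
  shows "sat R q (sat R q I) = sat R q I"
proof
  show "sat R q (sat R q I) \<subseteq> sat R q I"
  proof
    fix a assume "a \<in> sat R q (sat R q I)"
    then obtain s t where st: "s \<in> carrier R - q" "t \<in> carrier R - q" "t \<otimes> (s \<otimes> a) \<in> I"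
      "a \<in> carrier R" by (auto simp: sat_def)
    then have "(t \<otimes> s) \<otimes> a \<in> I" by (auto simp: m_assoc)
    then show "a \<in> sat R q I" using prime_mult[OF assms(1) st(2,1)] st(4) by (auto simp: sat_def)
  qed
  show "sat R q I \<subseteq> sat R q (sat R q I)"
    by (rule sat_upper[OF assms(1) ideal_sat[OF assms]])
qed

lemma sat_least:
  assumes "primeideal q R" "ideal J R" "I \<subseteq> sat R q J"
  shows "sat R q I \<subseteq> sat R q J"
  using sat_mono[OF assms(3), of q] sat_sat[OF assms(1,2)] by simp

end

context noetherian_ring
begin

lemma ascending_ideals_stabilize:
  assumes "\<And>n. ideal (I n) R" "\<And>n. I n \<subseteq> I (Suc n)"
  shows "\<exists>n. \<forall>m\<ge>n. I m = I n"
proof -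
  have mono: "m \<le> n \<Longrightarrow> I m \<subseteq> I n" for m n by (rule lift_Suc_mono_le[of I]) (use assms in auto)
  have chain: "I m \<subseteq> I n \<or> I n \<subseteq> I m" for m n using mono nle_le[of m n] by blast
  have "\<Union>(range I) \<in> range I"
    by (rule ideal_chain_is_trivial)
      (use assms(1) chain in \<open>auto simp: pred_on.chain_def\<close>)
  then obtain n where "\<Union>(range I) = I n" by auto
  then show ?thesis using mono by (metis UN_upper UNIV_I subset_antisym)
qed

lemma ex_maximal_ideal_in_family:
  assumes "F \<noteq> {}" "\<And>I. I \<in> F \<Longrightarrow> ideal I R"
  shows "\<exists>M\<in>F. \<forall>I\<in>F. M \<subseteq> I \<longrightarrow> I = M"
proof (rule subset_Zorn_nonempty[OF assms(1)])
  fix C assume C: "C \<noteq> {}" "subset.chain F C"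
  then have "subset.chain {I. ideal I R} C" using assms(2) by (auto simp: pred_on.chain_def)
  then have "\<Union>C \<in> C" by (rule ideal_chain_is_trivial[OF C(1)])
  then show "\<Union>C \<in> F" using C(2) by (auto simp: pred_on.chain_def)
qed

end

context noetherian_cring
begin

text \<open>
  Associated primes exist: a colon ideal that is maximal among the proper ones is prime, because
  \<open>s \<notin> (D : b)\<close> gives \<open>(D : b) \<subseteq> (D : s b)\<close>, with equality by maximality.
\<close>

lemma ex_prime_colon:
  assumes D: "ideal D R" "D \<noteq> carrier R"
  shows "\<exists>b\<in>carrier R - D. primeideal (colon R D b) R"
proof -
  note Dc = ideal_closed[OF D(1)]
  have "\<exists>P\<in>colon R D ` (carrier R - D). \<forall>I\<in>colon R D ` (carrier R - D). P \<subseteq> I \<longrightarrow> I = P"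
    by (rule ex_maximal_ideal_in_family) (use D Dc(1) ideal_colon in auto)
  then obtain b where b: "b \<in> carrier R - D"
    and max: "\<And>c. c \<in> carrier R - D \<Longrightarrow> colon R D b \<subseteq> colon R D c \<Longrightarrow> colon R D c = colon R D b"
    by auto
  have "primeideal (colon R D b) R"
  proof (rule primeidealI)
    show "ideal (colon R D b) R" using ideal_colon D b by auto
    show "cring R" by (rule is_cring)
    have "\<one> \<notin> colon R D b" using b by (auto simp: colon_def)
    then show "carrier R \<noteq> colon R D b" by auto
    fix r s assume rs: "r \<in> carrier R" "s \<in> carrier R" "r \<otimes> s \<in> colon R D b"
    show "r \<in> colon R D b \<or> s \<in> colon R D b"
    proof (rule disjCI)
      assume "s \<notin> colon R D b"
      then have sb: "s \<otimes> b \<in> carrier R - D" using rs b by (auto simp: colon_def)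
      have "t \<otimes> (s \<otimes> b) \<in> D" if t: "t \<in> carrier R" "t \<otimes> b \<in> D" for t
      proof -
        have "t \<otimes> (s \<otimes> b) = s \<otimes> (t \<otimes> b)" using t rs b by (simp add: m_lcomm)
        then show ?thesis using Dc(4) t rs by auto
      qed
      then have "colon R D b \<subseteq> colon R D (s \<otimes> b)" by (auto simp: colon_def)
      from max[OF sb this] have "colon R D (s \<otimes> b) = colon R D b" .
      moreover have "r \<in> colon R D (s \<otimes> b)" using rs b by (auto simp: colon_def m_assoc)
      ultimately show "r \<in> colon R D b" by simp
    qed
  qed
  with b show ?thesis by blast
qed

text \<open>
  This is the descending chain condition in the Artinian local ring \<open>R\<^sub>q / C R\<^sub>q\<close>, where \<open>q\<close> is minimal
  over \<open>C\<close>. Let \<open>D \<supseteq> C\<close> be maximal among the counterexamples. It is saturated, so an associated prime of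
  \<open>D\<close> lies between \<open>C\<close> and \<open>q\<close> and equals \<open>q = (D : b)\<close>. Modulo \<open>D\<close>, the element \<open>b\<close> spans a simple module
  after localization: either all \<open>J n + D\<close> contain \<open>b\<close> up to saturation, and stability modulo \<open>D + (b)\<close>
  is stability modulo \<open>D\<close>, or almost none does, and multiples of \<open>b\<close> that occur have coefficients in \<open>q\<close>
  and hence lie in \<open>D\<close>.
\<close>

lemma descending_ideals_stabilize:
  fixes J :: "nat \<Rightarrow> 'a set"
  assumes q: "primeideal q R" and C: "ideal C R"
    and minq: "\<And>P. primeideal P R \<Longrightarrow> C \<subseteq> P \<Longrightarrow> P \<subseteq> q \<Longrightarrow> P = q"
    and J: "\<And>n. ideal (J n) R" and dec: "\<And>m n. m \<le> n \<Longrightarrow> J n \<subseteq> J m"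
  shows "\<exists>m. \<forall>n\<ge>m. J m \<subseteq> sat R q (J n <+> C)"
proof (rule ccontr)
  define stab where "stab D \<longleftrightarrow> (\<exists>m. \<forall>n\<ge>m. J m \<subseteq> sat R q (J n <+> D))" for D
  define F where "F = {D. ideal D R \<and> C \<subseteq> D \<and> \<not> stab D}"
  assume "\<not> ?thesis"
  then have "C \<in> F" using C by (auto simp: F_def stab_def)
  then have "F \<noteq> {}" by blast
  moreover have "\<And>I. I \<in> F \<Longrightarrow> ideal I R" by (simp add: F_def)
  ultimately obtain D where D: "D \<in> F" and Dmax: "\<And>E. E \<in> F \<Longrightarrow> D \<subseteq> E \<Longrightarrow> E = D"
    using ex_maximal_ideal_in_family by metis
  have Did: "ideal D R" and CD: "C \<subseteq> D" and nD: "\<not> stab D" using D by (auto simp: F_def)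
  note Dc = ideal_closed[OF Did]
  have JD: "ideal (J n <+> D) R" for n using add_ideals[OF J Did] .
  have stabI: "stab E" if "ideal E R" "D \<subset> E" for E
  proof (rule ccontr)
    assume "\<not> stab E"
    then have "E \<in> F" using that CD by (auto simp: F_def)
    then show False using Dmax that(2) by blast
  qed
  have satD: "sat R q D = D"
  proof (rule ccontr)
    assume "sat R q D \<noteq> D"
    then have "stab (sat R q D)"
      using stabI[OF ideal_sat[OF q Did]] sat_upper[OF q Did] by blast
    then obtain m where m: "\<And>n. n \<ge> m \<Longrightarrow> J m \<subseteq> sat R q (J n <+> sat R q D)" by (auto simp: stab_def)
    have "sat R q (J n <+> sat R q D) \<subseteq> sat R q (J n <+> D)" for n
    proof (rule sat_least[OF q JD], rule set_add_least[OF ideal_sat[OF q JD]])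
      show "J n \<subseteq> sat R q (J n <+> D)" using set_add_upper(1)[OF J Did] sat_upper[OF q JD] by blast
      show "sat R q D \<subseteq> sat R q (J n <+> D)" by (rule sat_mono[OF set_add_upper(2)[OF J Did]])
    qed
    then have "stab D" using m unfolding stab_def by blast
    then show False using nD by simp
  qed
  have "D \<noteq> carrier R"
  proof
    assume "D = carrier R"
    then have "J 0 \<subseteq> sat R q (J n <+> D)" for n
      using ideal_closed(1)[OF J] set_add_upper[OF J Did] sat_upper[OF q JD] by blast
    then have "stab D" unfolding stab_def by blast
    then show False using nD by simp
  qed
  then obtain b where b: "b \<in> carrier R - D" and pb: "primeideal (colon R D b) R"
    using ex_prime_colon[OF Did] by auto
  have "colon R D b \<subseteq> q"
    using satD b by (auto simp: colon_def sat_def)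
  moreover have "C \<subseteq> colon R D b"
    using CD Dc b m_comm by (auto simp: colon_def, metis subsetD)
  ultimately have cq: "colon R D b = q" using minq pb by auto
  have PIb: "ideal (PIdl b) R" using b cgenideal_ideal by auto
  have "stab (D <+> PIdl b)"
    using stabI[OF add_ideals[OF Did PIb]] set_add_upper[OF Did PIb] b cgenideal_self[of b] by blast
  then obtain m where m: "\<And>n. n \<ge> m \<Longrightarrow> J m \<subseteq> sat R q (J n <+> (D <+> PIdl b))" by (auto simp: stab_def)
  show False
  proof (cases "\<forall>n. b \<in> sat R q (J n <+> D)")
    case True
    have "J m \<subseteq> sat R q (J n <+> D)" if "n \<ge> m" for n
    proof -
      have "J n <+> (D <+> PIdl b) \<subseteq> sat R q (J n <+> D)"
      proof (intro set_add_least[OF ideal_sat[OF q JD]])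
        show "J n \<subseteq> sat R q (J n <+> D)" "D \<subseteq> sat R q (J n <+> D)"
          using set_add_upper[OF J Did] sat_upper[OF q JD] by blast+
        show "PIdl b \<subseteq> sat R q (J n <+> D)" using True cgenideal_minimal[OF ideal_sat[OF q JD]] by blast
      qed
      then show ?thesis using m[OF that] sat_least[OF q JD] by blast
    qed
    then have "stab D" unfolding stab_def by blast
    then show False using nD by simp
  next
    case False
    then obtain k where k: "b \<notin> sat R q (J k <+> D)" by auto
    define l where "l = max m k"
    have bl: "b \<notin> sat R q (J l <+> D)"
    proof -
      have "J l <+> D \<subseteq> J k <+> D" using dec[of k l] by (auto simp: l_def set_add_defs)
      then show ?thesis using sat_mono k by blast
    qed
    have "a \<in> sat R q (J n <+> D)" if a: "a \<in> J l" and n: "n \<ge> l" for a n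
    proof -
      have "a \<in> J m" using a dec[of m l] by (auto simp: l_def)
      then have "a \<in> sat R q (J n <+> (D <+> PIdl b))" using m[of n] n by (auto simp: l_def)
      then obtain s j e r where s: "s \<in> carrier R - q" "j \<in> J n" "e \<in> D" "r \<in> carrier R"
        and eq: "s \<otimes> a = j \<oplus> (e \<oplus> r \<otimes> b)" and ac: "a \<in> carrier R"
        by (auto simp: sat_def mem_set_add mem_PIdl)
      have jc: "j \<in> carrier R" "e \<in> carrier R" using s ideal_closed(1)[OF J] Dc(1) by auto
      have "r \<in> q"
      proof (rule ccontr)
        assume r: "r \<notin> q"
        have "s \<otimes> a \<ominus> j \<in> J l" using s a dec[OF n] ideal_closed[OF J] by auto
        moreover have "r \<otimes> b = (s \<otimes> a \<ominus> j) \<oplus> \<ominus> e"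
          unfolding eq using s jc b by auto algebra
        moreover have "\<ominus> e \<in> D" using s Dc by blast
        ultimately have "r \<otimes> b \<in> J l <+> D" unfolding mem_set_add by blast
        then show False using r s(4) bl b by (auto simp: sat_def)
      qed
      then have "r \<otimes> b \<in> D" using cq by (auto simp: colon_def)
      then have "s \<otimes> a \<in> J n <+> D" using eq s Dc(3) by (auto simp: mem_set_add)
      then show ?thesis using s ac by (auto simp: sat_def)
    qed
    then have "stab D" unfolding stab_def by blast
    then show False using nD by simp
  qed
qed

end

section \<open>Krull's principal ideal theorem\<close>

context noetherian_cring
begin

lemma mem_add_PIdlI: "i \<in> I \<Longrightarrow> r \<in> carrier R \<Longrightarrow> a = i \<oplus> r \<otimes> b \<Longrightarrow> a \<in> I <+> PIdl b"
  using mem_PIdl[of "r \<otimes> b" b] mem_set_add[of a I "PIdl b"] by blast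

text \<open>
  Krull's intersection theorem for the powers of one element \<open>x\<close> of \<open>R\<^sub>q\<close>. If \<open>s z = j + x\<^sup>k c\<close>, then \<open>c\<close> lies
  in the colon ideal of \<open>x\<^sup>k\<close> into \<open>J + (z)\<close>. These ideals ascend; where they are stable, \<open>x\<^sup>k\<close> multiplies
  the coefficient of \<open>x\<^sup>k\<^sup>+\<^sup>1\<close> into \<open>J + (z)\<close> already, so that \<open>s z \<in> J + x (z)\<close>, and \<open>s - x r\<close> is a unit of \<open>R\<^sub>q\<close>.
\<close>

lemma sat_powers_intersection:
  assumes q: "primeideal q R" and J: "ideal J R" and x: "x \<in> q" and z: "z \<in> carrier R"
    and zx: "\<And>k::nat. \<exists>s\<in>carrier R - q. \<exists>j\<in>J. \<exists>c\<in>carrier R. s \<otimes> z = j \<oplus> x [^] k \<otimes> c"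
  shows "z \<in> sat R q J"
proof -
  have qid: "ideal q R" using q by (rule primeideal.axioms)
  note Jc = ideal_closed[OF J] and qc = ideal_closed[OF qid]
  have xc: "x \<in> carrier R" using x qc by auto
  have Iz: "ideal (J <+> PIdl z) R" by (rule add_ideals[OF J cgenideal_ideal[OF z]])
  define E where "E k = colon R (J <+> PIdl z) (x [^] k)" for k :: nat
  have "\<exists>n. \<forall>m\<ge>n. E m = E n"
  proof (rule ascending_ideals_stabilize)
    show "ideal (E n) R" for n using ideal_colon[OF Iz] xc by (auto simp: E_def)
    show "E n \<subseteq> E (Suc n)" for n
    proof
      fix c assume "c \<in> E n"
      then have c: "c \<in> carrier R" "c \<otimes> x [^] n \<in> J <+> PIdl z" by (auto simp: E_def colon_def)
      have "c \<otimes> x [^] Suc n = x \<otimes> (c \<otimes> x [^] n)" using c xc by (simp add: m_ac)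
      then show "c \<in> E (Suc n)" using c ideal_closed(4)[OF Iz xc c(2)] by (simp add: E_def colon_def)
    qed
  qed
  then obtain k where k: "E (Suc k) = E k" by (metis le_Suc_eq le_refl)
  obtain s j c where s: "s \<in> carrier R - q" "j \<in> J" "c \<in> carrier R"
    and eq: "s \<otimes> z = j \<oplus> x [^] Suc k \<otimes> c" using zx by blast
  have jc: "j \<in> carrier R" and sc: "s \<in> carrier R" using s Jc by auto
  have "c \<otimes> x [^] Suc k = \<ominus> j \<oplus> s \<otimes> z" unfolding eq using jc s xc by (simp add: r_neg1 m_comm)
  then have "c \<otimes> x [^] Suc k \<in> J <+> PIdl z" using mem_add_PIdlI[of "\<ominus> j" J s] s Jc by blast
  then have "c \<in> E (Suc k)" using s(3) by (simp add: E_def colon_def)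
  then have "c \<in> E k" using k by simp
  then obtain i r where i: "i \<in> J" "r \<in> carrier R" and eq2: "c \<otimes> x [^] k = i \<oplus> r \<otimes> z"
    by (auto simp: E_def colon_def mem_set_add mem_PIdl)
  have ic: "i \<in> carrier R" using i Jc by auto
  have "x [^] Suc k \<otimes> c = x \<otimes> (c \<otimes> x [^] k)" using s xc by (simp add: m_ac)
  then have sz: "s \<otimes> z = j \<oplus> x \<otimes> (i \<oplus> r \<otimes> z)" using eq eq2 by simp
  have "(s \<ominus> x \<otimes> r) \<otimes> z = s \<otimes> z \<ominus> x \<otimes> r \<otimes> z" using s(1,2,3) sc xc i z by algebra
  also have "\<dots> = j \<oplus> x \<otimes> i" unfolding sz using jc ic xc i z by algebra
  finally have "(s \<ominus> x \<otimes> r) \<otimes> z \<in> J" using s i xc Jc by auto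
  moreover have "s \<ominus> x \<otimes> r \<in> carrier R - q"
  proof -
    have "s \<ominus> x \<otimes> r \<notin> q"
    proof
      assume a: "s \<ominus> x \<otimes> r \<in> q"
      have "r \<otimes> x \<in> q" using x i qc by auto
      then have "(s \<ominus> x \<otimes> r) \<oplus> r \<otimes> x \<in> q" using a qc by auto
      moreover have "(s \<ominus> x \<otimes> r) \<oplus> r \<otimes> x = s" using sc xc i by algebra
      ultimately show False using s by auto
    qed
    then show ?thesis using s xc i by auto
  qed
  ultimately show ?thesis using z by (auto simp: sat_def)
qed

text \<open>
  Krull's principal ideal theorem in relative form. If \<open>q\<close> were minimal over \<open>p + (x)\<close>, choose \<open>y\<close> in \<open>p'\<close>
  and not in \<open>p\<close>, and let \<open>J n\<close> be the saturation of \<open>p + (y\<^sup>n)\<close> at \<open>p'\<close>, which plays the role of a symbolic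
  power. The chain \<open>J n\<close> is stable modulo \<open>x\<close>; since \<open>x \<notin> p'\<close>, this improves to \<open>J n \<subseteq> J (n + 1) + x\<^sup>k J n\<close>
  for all \<open>k\<close>, locally at \<open>q\<close>. By Krull's intersection theorem \<open>y\<^sup>n \<in> J (n + 1)\<close>, and cancelling \<open>y\<^sup>n\<close>
  modulo \<open>p\<close> makes an element outside \<open>p'\<close> a multiple of \<open>y\<close> modulo \<open>p\<close>.
\<close>

lemma ex_prime_between:
  assumes p: "primeideal p R" and p': "primeideal p' R" and q: "primeideal q R"
    and pp': "p \<subset> p'" and p'q: "p' \<subset> q" and x: "x \<in> q"
  shows "\<exists>Q. primeideal Q R \<and> p \<subset> Q \<and> Q \<subset> q \<and> x \<in> Q"
proof (rule ccontr)
  assume no: "\<not> ?thesis"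
  have pid: "ideal p R" "ideal p' R" "ideal q R" using p p' q by (auto dest: primeideal.axioms)
  note pc = ideal_closed[OF pid(1)] and p'c = ideal_closed[OF pid(2)] and qc = ideal_closed[OF pid(3)]
  \<comment> \<open>If \<open>x \<in> p'\<close>, then \<open>p'\<close> itself is a prime as required.\<close>
  have xp': "x \<notin> p'" using no p' pp' p'q by blast
  then have xp: "x \<notin> p" using pp' by blast
  have xc: "x \<in> carrier R" using x qc by auto
  obtain y where y: "y \<in> p'" "y \<notin> p" using pp' by blast
  have yc: "y \<in> carrier R" using y p'c by auto
  have PIy: "ideal (PIdl (y [^] n)) R" for n :: nat using cgenideal_ideal yc by auto
  have pyn: "ideal (p <+> PIdl (y [^] n)) R" for n :: nat by (rule add_ideals[OF pid(1) PIy])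
  \<comment> \<open>The saturations of \<open>p + (y\<^sup>n)\<close> at \<open>p'\<close> descend, and \<open>x\<close> is no zero divisor modulo any of them.\<close>
  define J where "J n = sat R p' (p <+> PIdl (y [^] n))" for n :: nat
  have J: "ideal (J n) R" for n unfolding J_def by (rule ideal_sat[OF p' pyn])
  note Jc = ideal_closed[OF J]
  have pJ: "p \<subseteq> J n" for n
    unfolding J_def using set_add_upper(1)[OF pid(1) PIy] sat_upper[OF p' pyn] by blast
  have yJ: "y [^] n \<in> J n" for n
    unfolding J_def using set_add_upper(2)[OF pid(1) PIy] sat_upper[OF p' pyn] cgenideal_self yc by blast
  have dec: "J n \<subseteq> J m" if "m \<le> n" for m n
  proof -
    have "y [^] n = y [^] (n - m) \<otimes> y [^] m" using that yc by (simp add: nat_pow_mult)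
    then have "y [^] n \<in> PIdl (y [^] m)" using yc by (auto simp: mem_PIdl)
    then have "p <+> PIdl (y [^] n) \<subseteq> p <+> PIdl (y [^] m)"
      using set_add_upper[OF pid(1) PIy[of m]]
      by (intro set_add_least[OF pyn] cgenideal_minimal[OF pyn]) blast+
    then show ?thesis unfolding J_def by (rule sat_mono)
  qed
  have satJ: "a \<in> J n" if "s \<in> carrier R - p'" "s \<otimes> a \<in> J n" "a \<in> carrier R" for s a n
    using that sat_sat[OF p' pyn, of n] by (auto simp: J_def sat_def[of R p' "sat R p' _"])
  define C where "C = p <+> PIdl x"
  have PIx: "ideal (PIdl x) R" using cgenideal_ideal xc by auto
  have Cid: "ideal C R" unfolding C_def by (rule add_ideals[OF pid(1) PIx])
  have "\<exists>m. \<forall>n\<ge>m. J m \<subseteq> sat R q (J n <+> C)"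
  proof (rule descending_ideals_stabilize[OF q Cid _ J dec])
    fix P assume P: "primeideal P R" "C \<subseteq> P" "P \<subseteq> q"
    have "p \<subseteq> P" "x \<in> P" using P(2) set_add_upper[OF pid(1) PIx] cgenideal_self[OF xc] by (auto simp: C_def)
    then show "P = q" using no P xp by blast
  qed
  then obtain n where n: "J n \<subseteq> sat R q (J (Suc n) <+> C)" by (meson Suc_n_not_le_n nle_le)
  have step: "\<exists>s\<in>carrier R - q. \<exists>j\<in>J (Suc n). \<exists>c\<in>J n. s \<otimes> a = j \<oplus> x \<otimes> c" if a: "a \<in> J n" for a
  proof -
    obtain s j e r where s: "s \<in> carrier R - q" "j \<in> J (Suc n)" "e \<in> p" "r \<in> carrier R"
      and eq: "s \<otimes> a = j \<oplus> (e \<oplus> r \<otimes> x)" and ac: "a \<in> carrier R"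
    proof -
      have "a \<in> sat R q (J (Suc n) <+> C)" using n a by blast
      then show ?thesis using that by (auto simp: C_def sat_def mem_set_add mem_PIdl)
    qed
    have jc: "j \<in> carrier R" "e \<in> carrier R" and sc: "s \<in> carrier R" using s Jc pc by auto
    have je: "j \<oplus> e \<in> J (Suc n)" using s pJ Jc(3) by blast
    have "s \<otimes> a \<ominus> (j \<oplus> e) \<in> J n" using Jc(6)[OF Jc(4)[OF _ a, of s]] je dec[of n "Suc n"] s by auto
    moreover have "s \<otimes> a \<ominus> (j \<oplus> e) = x \<otimes> r" unfolding eq using jc sc xc s(4) by algebra
    ultimately have "r \<in> J n" using satJ[of x r n] xp' xc s by auto
    moreover have "s \<otimes> a = (j \<oplus> e) \<oplus> x \<otimes> r" unfolding eq using jc sc xc s(4) by algebra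
    ultimately show ?thesis using je s by blast
  qed
  have "\<exists>s\<in>carrier R - q. \<exists>j\<in>J (Suc n). \<exists>c\<in>J n. s \<otimes> a = j \<oplus> x [^] k \<otimes> c" if "a \<in> J n" for k :: nat and a
    using that
  proof (induction k arbitrary: a)
    case 0
    have "\<one> \<otimes> a = \<zero> \<oplus> x [^] (0::nat) \<otimes> a" using 0 Jc(1)[of n] by auto
    then show ?case using 0 Jc(2)[of "Suc n"] prime_one[OF q] by (intro bexI[of _ \<one>] bexI[of _ \<zero>] bexI[of _ a]) auto
  next
    case (Suc k)
    then obtain s j c where s: "s \<in> carrier R - q" "j \<in> J (Suc n)" "c \<in> J n" "s \<otimes> a = j \<oplus> x [^] k \<otimes> c"
      by blast
    obtain t i b where t: "t \<in> carrier R - q" "i \<in> J (Suc n)" "b \<in> J n" "t \<otimes> c = i \<oplus> x \<otimes> b"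
      using step[OF s(3)] by blast
    have cc: "j \<in> carrier R" "i \<in> carrier R" "c \<in> carrier R" "b \<in> carrier R" "a \<in> carrier R" "x [^] k \<in> carrier R"
      using s t Suc.prems Jc xc by auto
    have ts: "t \<in> carrier R" "s \<in> carrier R" using s t by auto
    have xk: "x [^] Suc k \<otimes> b = x [^] k \<otimes> (x \<otimes> b)" using cc xc by (simp add: m_assoc)
    have "(t \<otimes> s) \<otimes> a = t \<otimes> (s \<otimes> a)" using ts cc by (simp add: m_assoc)
    also have "\<dots> = t \<otimes> j \<oplus> x [^] k \<otimes> (t \<otimes> c)"
      unfolding s(4) using ts cc by (simp add: r_distr m_lcomm)
    also have "\<dots> = (t \<otimes> j \<oplus> x [^] k \<otimes> i) \<oplus> x [^] Suc k \<otimes> b"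
      unfolding t(4) xk using ts cc xc by (simp add: r_distr a_assoc)
    finally show ?case
      using prime_mult[OF q t(1) s(1)] t(3) Jc(3)[OF Jc(4)[OF _ s(2), of t] Jc(4)[OF _ t(2), of "x [^] k"]] t(1) xc
      by blast
  qed
  then have "y [^] n \<in> sat R q (J (Suc n))"
    using yJ[of n] yc Jc(1)[of n] by (intro sat_powers_intersection[OF q J x]) blast+
  then obtain s where s: "s \<in> carrier R - q" "s \<otimes> y [^] n \<in> J (Suc n)" by (auto simp: sat_def)
  then have "y [^] n \<in> J (Suc n)" using satJ[of s "y [^] n" "Suc n"] p'q yc by auto
  then obtain t e r where t: "t \<in> carrier R - p'" "e \<in> p" "r \<in> carrier R"
    and eq: "t \<otimes> y [^] n = e \<oplus> r \<otimes> y [^] Suc n"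
    by (auto simp: J_def sat_def mem_set_add mem_PIdl)
  have ec: "e \<in> carrier R" using t pc by auto
  define w where "w = y [^] n"
  have wc: "w \<in> carrier R" "t \<in> carrier R" "r \<in> carrier R" using yc t by (auto simp: w_def)
  have "w \<otimes> (t \<ominus> r \<otimes> y) = t \<otimes> w \<ominus> r \<otimes> (w \<otimes> y)" using wc yc by algebra
  also have "\<dots> = e \<oplus> r \<otimes> (w \<otimes> y) \<ominus> r \<otimes> (w \<otimes> y)" using eq yc by (simp add: w_def)
  also have "\<dots> = e" using wc yc ec by algebra
  finally have "w \<otimes> (t \<ominus> r \<otimes> y) \<in> p" using t by simp
  moreover have "w \<in> carrier R - p"
    unfolding w_def by (induction n) (use prime_one[OF p] prime_mult[OF p] y yc in auto)
  ultimately have "t \<ominus> r \<otimes> y \<in> p" using prime_mult[OF p, of w "t \<ominus> r \<otimes> y"] t yc by auto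
  then have "t \<ominus> r \<otimes> y \<in> p'" using pp' by blast
  then have "(t \<ominus> r \<otimes> y) \<oplus> r \<otimes> y \<in> p'" using t y p'c by auto
  moreover have "(t \<ominus> r \<otimes> y) \<oplus> r \<otimes> y = t" using wc yc by algebra
  ultimately show False using t by auto
qed

end

section \<open>Chains of primes and Noetherian local rings\<close>

context noetherian_cring
begin

text \<open>
  The element is pushed down the chain from the top: the second to last prime is replaced by one that
  contains \<open>x\<close>, and then the same is done with the chain below it.
\<close>

lemma prime_chain_first_contains:
  assumes "1 \<le> n" "prime_chain R n p" "x \<in> p n"
  shows "\<exists>p'. prime_chain R n p' \<and> p' 0 = p 0 \<and> p' n = p n \<and> x \<in> p' 1"
  using assms
proof (induction n arbitrary: p rule: nat_induct_at_least)
  case base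
  then show ?case by auto
next
  case (Suc n)
  then obtain m where m: "n = Suc m" by (cases n) auto
  have pr: "\<And>i. i \<le> Suc (Suc m) \<Longrightarrow> primeideal (p i) R" and st: "\<And>i. i < Suc (Suc m) \<Longrightarrow> p i \<subset> p (Suc i)"
    using Suc.prems by (auto simp: prime_chain_def m)
  obtain Q where Q: "primeideal Q R" "p m \<subset> Q" "Q \<subset> p (Suc (Suc m))" "x \<in> Q"
    using ex_prime_between[OF pr pr pr st st, of m x] Suc.prems m by auto
  have "prime_chain R n (p(n := Q))"
    using Q pr st by (auto simp: prime_chain_def m)
  from Suc.IH[OF this] Q obtain p' where p': "prime_chain R n p'" "p' 0 = p 0" "p' n = Q" "x \<in> p' 1"
    by (auto simp: m)
  define r where "r = p'(Suc n := p (Suc n))"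
  have "prime_chain R (Suc n) r" unfolding r_def
    using p' Q pr[of "Suc n"] by (auto simp: prime_chain_def m less_Suc_eq le_Suc_eq)
  moreover have "r 0 = p 0" "r (Suc n) = p (Suc n)" "x \<in> r 1" using p' m by (simp_all add: r_def)
  ultimately show ?case by blast
qed

lemma prime_chain_contains:
  assumes "finite Y" "prime_chain R n p" "Y \<subseteq> p n" "card Y \<le> n"
  shows "\<exists>p'. prime_chain R n p' \<and> p' 0 = p 0 \<and> p' n = p n \<and> Y \<subseteq> p' (card Y)"
  using assms
proof (induction Y)
  case empty
  then show ?case by auto
next
  case (insert x Y)
  define c where "c = card Y"
  have c: "c < n" "card (insert x Y) = Suc c" using insert by (auto simp: c_def)
  obtain p' where p': "prime_chain R n p'" "p' 0 = p 0" "p' n = p n" "Y \<subseteq> p' c"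
    using insert by (auto simp: c_def)
  have "prime_chain R (n - c) (\<lambda>i. p' (c + i))" using p'(1) c unfolding prime_chain_def by auto
  moreover have "1 \<le> n - c" "x \<in> p' (c + (n - c))" using c p' insert.prems by auto
  ultimately obtain r where
    r: "prime_chain R (n - c) r" "r 0 = p' c" "r (n - c) = p n" "x \<in> r 1"
    using prime_chain_first_contains[of "n - c" "\<lambda>i. p' (c + i)" x] c p'(3) by auto
  define p'' where "p'' i = (if i < c then p' i else r (i - c))" for i
  have "prime_chain R n p''"
    unfolding prime_chain_def
  proof (intro conjI allI impI)
    fix i assume "i \<le> n"
    then show "primeideal (p'' i) R" using p'(1) r(1) by (auto simp: p''_def prime_chain_def)
  next
    fix i assume i: "i < n"
    consider "Suc i < c" | "Suc i = c" | "c \<le> i" by linarith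
    then show "p'' i \<subset> p'' (Suc i)"
    proof cases
      case 3
      then have "Suc i - c = Suc (i - c)" by simp
      then show ?thesis using 3 i r(1) by (simp add: p''_def prime_chain_def)
    qed (use p'(1) r(2) i in \<open>auto simp: p''_def prime_chain_def\<close>)
  qed
  moreover have "p'' 0 = p 0" "p'' n = p n" "p'' (card (insert x Y)) = r 1"
    using c r p' by (auto simp: p''_def)
  moreover have "r 0 \<subset> r (Suc 0)" using r(1) c unfolding prime_chain_def by simp
  then have "insert x Y \<subseteq> r 1" using r p'(4) by auto
  ultimately show ?case by metis
qed

lemma ex_maximalideal_containing:
  assumes I: "ideal I R" "I \<noteq> carrier R"
  shows "\<exists>M. maximalideal M R \<and> I \<subseteq> M"
proof -
  define F where "F = {J. ideal J R \<and> I \<subseteq> J \<and> J \<noteq> carrier R}"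
  have "F \<noteq> {}" "\<And>J. J \<in> F \<Longrightarrow> ideal J R" using I by (auto simp: F_def)
  then obtain M where M: "M \<in> F" "\<And>J. J \<in> F \<Longrightarrow> M \<subseteq> J \<Longrightarrow> J = M"
    using ex_maximal_ideal_in_family by metis
  have "maximalideal M R"
  proof (rule maximalidealI)
    show "ideal M R" "carrier R \<noteq> M" using M(1) by (auto simp: F_def)
    fix J assume "ideal J R" "M \<subseteq> J" "J \<subseteq> carrier R"
    then have "J = M" if "J \<noteq> carrier R"
      using that M(1) by (intro M(2)) (auto simp: F_def)
    then show "J = M \<or> J = carrier R" by blast
  qed
  then show ?thesis using M(1) by (auto simp: F_def)
qed

text \<open>
  A form of Krull's intersection theorem: \<open>f\<close> avoids an ideal that contains a power of every element of
  \<open>M\<close>. The ideal \<open>Q\<close> is chosen maximal with \<open>M f \<subseteq> Q\<close> and \<open>f \<notin> Q\<close>. If \<open>x\<^sup>n \<notin> Q\<close> at a place where the colon ideals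
  \<open>(Q : x\<^sup>n)\<close> are stable, then \<open>f = q + r x\<^sup>n\<close>, so \<open>r x\<^sup>n\<^sup>+\<^sup>1 \<in> Q\<close> because \<open>x f \<in> Q\<close>, hence \<open>r x\<^sup>n \<in> Q\<close> and \<open>f \<in> Q\<close>.
\<close>

lemma ex_ideal_avoiding:
  assumes dom: "domain R" and M: "ideal M R" "\<one> \<notin> M" and f: "f \<in> carrier R" "f \<noteq> \<zero>"
  shows "\<exists>Q. ideal Q R \<and> f \<notin> Q \<and> (\<forall>x\<in>M. \<exists>n::nat. x [^] n \<in> Q)"
proof -
  interpret domain R by (rule dom)
  note Mc = ideal_closed[OF M(1)]
  define F where "F = {Q. ideal Q R \<and> (\<forall>a\<in>M. a \<otimes> f \<in> Q) \<and> f \<notin> Q}"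
  have "{a \<otimes> f |a. a \<in> M} \<in> F"
    unfolding F_def
  proof (intro CollectI conjI)
    show "ideal {a \<otimes> f |a. a \<in> M} R"
    proof (rule ideal_of_closed)
      show "{a \<otimes> f |a. a \<in> M} \<subseteq> carrier R" using Mc f by auto
      show "\<zero> \<in> {a \<otimes> f |a. a \<in> M}" using Mc f by (auto intro!: exI[of _ \<zero>])
      show "x \<oplus> y \<in> {a \<otimes> f |a. a \<in> M}" if xy: "x \<in> {a \<otimes> f |a. a \<in> M}" "y \<in> {a \<otimes> f |a. a \<in> M}" for x y
      proof -
        from xy obtain a b where ab: "a \<in> M" "b \<in> M" "x = a \<otimes> f" "y = b \<otimes> f" by auto
        have "x \<oplus> y = (a \<oplus> b) \<otimes> f" using ab Mc f by (simp add: l_distr subset_iff)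
        then show ?thesis using ab Mc(3) by blast
      qed
      show "r \<otimes> x \<in> {a \<otimes> f |a. a \<in> M}" if rx: "r \<in> carrier R" "x \<in> {a \<otimes> f |a. a \<in> M}" for r x
      proof -
        from rx obtain a where a: "a \<in> M" "x = a \<otimes> f" by auto
        have "r \<otimes> x = (r \<otimes> a) \<otimes> f" using a Mc f rx(1) by (simp add: m_assoc subset_iff)
        then show ?thesis using a Mc(4) rx(1) by blast
      qed
    qed
    show "\<forall>a\<in>M. a \<otimes> f \<in> {a \<otimes> f |a. a \<in> M}" by auto
    show "f \<notin> {a \<otimes> f |a. a \<in> M}"
    proof
      assume "f \<in> {a \<otimes> f |a. a \<in> M}"
      then obtain a where a: "a \<in> M" "a \<otimes> f = \<one> \<otimes> f" using f by auto
      then have "a = \<one>" using m_rcancel[of f a \<one>] f Mc by auto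
      then show False using a M by simp
    qed
  qed
  then have "F \<noteq> {}" by blast
  moreover have "\<And>J. J \<in> F \<Longrightarrow> ideal J R" by (simp add: F_def)
  ultimately obtain Q where "Q \<in> F" and Qmax: "\<And>J. J \<in> F \<Longrightarrow> Q \<subseteq> J \<Longrightarrow> J = Q"
    using ex_maximal_ideal_in_family by metis
  then have Q: "ideal Q R" "\<And>a. a \<in> M \<Longrightarrow> a \<otimes> f \<in> Q" "f \<notin> Q" by (auto simp: F_def)
  note Qc = ideal_closed[OF Q(1)]
  have "\<exists>n::nat. x [^] n \<in> Q" if x: "x \<in> M" for x
  proof -
    have xc: "x \<in> carrier R" using x Mc by auto
    have "\<exists>n::nat. \<forall>m\<ge>n. colon R Q (x [^] m) = colon R Q (x [^] n)"
    proof (rule ascending_ideals_stabilize)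
      show "ideal (colon R Q (x [^] (n::nat))) R" for n using ideal_colon[OF Q(1)] xc by auto
      show "colon R Q (x [^] n) \<subseteq> colon R Q (x [^] Suc n)" for n :: nat
      proof
        fix c assume "c \<in> colon R Q (x [^] n)"
        then have c: "c \<in> carrier R" "c \<otimes> x [^] n \<in> Q" by (auto simp: colon_def)
        have "c \<otimes> x [^] Suc n = x \<otimes> (c \<otimes> x [^] n)" using c xc by (simp add: m_ac)
        then show "c \<in> colon R Q (x [^] Suc n)" using c Qc(4)[OF xc c(2)] by (simp add: colon_def)
      qed
    qed
    then obtain n :: nat where n: "colon R Q (x [^] Suc n) = colon R Q (x [^] n)" by (metis le_Suc_eq le_refl)
    have "x [^] n \<in> Q"
    proof (rule ccontr)
      assume no: "x [^] n \<notin> Q"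
      have PI: "ideal (PIdl (x [^] n)) R" using cgenideal_ideal xc by auto
      have up: "Q \<subseteq> Q <+> PIdl (x [^] n)" "x [^] n \<in> Q <+> PIdl (x [^] n)"
        using set_add_upper[OF Q(1) PI] cgenideal_self[of "x [^] n"] xc by auto
      then have "Q <+> PIdl (x [^] n) \<notin> F" using Qmax no by blast
      then have "f \<in> Q <+> PIdl (x [^] n)" using up Q add_ideals[OF Q(1) PI] by (auto simp: F_def)
      then obtain q r where qr: "q \<in> Q" "r \<in> carrier R" "f = q \<oplus> r \<otimes> x [^] n"
        by (auto simp: mem_set_add mem_PIdl)
      have qc: "q \<in> carrier R" "x [^] n \<in> carrier R" using qr Qc xc by auto
      have "x \<otimes> f = x \<otimes> q \<oplus> r \<otimes> x [^] Suc n"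
        using qr qc xc by (simp add: r_distr m_ac)
      then have "r \<otimes> x [^] Suc n = \<ominus> (x \<otimes> q) \<oplus> x \<otimes> f" using qr qc xc by (simp add: r_neg1)
      moreover have "\<ominus> (x \<otimes> q) \<oplus> x \<otimes> f \<in> Q"
        using Qc(3)[OF Qc(5)[OF Qc(4)[OF xc qr(1)]] Q(2)[OF x]] .
      ultimately have "r \<in> colon R Q (x [^] Suc n)" using qr by (simp add: colon_def)
      then have "r \<in> colon R Q (x [^] n)" using n by simp
      then have "r \<otimes> x [^] n \<in> Q" by (simp add: colon_def)
      then have "f \<in> Q" using qr Qc(3) by simp
      then show False using Q by simp
    qed
    then show ?thesis ..
  qed
  with Q show ?thesis by blast
qed

end

lemma (in cring) maximalideal_nonunits:
  assumes "maximalideal M R"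
  shows "M \<subseteq> carrier R - Units R"
proof
  fix a assume a: "a \<in> M"
  interpret M: maximalideal M R by fact
  have "a \<notin> Units R"
  proof
    assume u: "a \<in> Units R"
    then have "inv a \<otimes> a \<in> M" using M.I_l_closed[OF a] by blast
    then have "\<one> \<in> M" using u by (simp only: Units_l_inv)
    then show False using M.one_imp_carrier M.I_notcarr by metis
  qed
  then show "a \<in> carrier R - Units R" using a M.Icarr by auto
qed

lemma (in cring) max_ideal_eq_nonunits:
  assumes I: "ideal (carrier R - Units R) R"
  shows "max_ideal R = carrier R - Units R" "maximalideal (carrier R - Units R) R"
proof -
  show m: "maximalideal (carrier R - Units R) R"
  proof (rule maximalidealI[OF I])
    show "carrier R \<noteq> carrier R - Units R" by auto
    fix J assume J: "ideal J R" "carrier R - Units R \<subseteq> J" "J \<subseteq> carrier R"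
    show "J = carrier R - Units R \<or> J = carrier R"
    proof (cases "J \<inter> Units R = {}")
      case False
      then obtain a where "a \<in> J" "a \<in> Units R" by auto
      then have "\<one> \<in> J" using ideal_closed(4)[OF J(1), of "inv a" a] by auto
      then show ?thesis using ideal.one_imp_carrier[OF J(1)] by simp
    next
      case True
      then have "J \<subseteq> carrier R - Units R" using J(3) by blast
      then show ?thesis using J(2) by blast
    qed
  qed
  show "max_ideal R = carrier R - Units R"
    unfolding max_ideal_def
  proof (rule the_equality)
    show "maximalideal (carrier R - Units R) R" by (rule m)
    fix M assume M: "maximalideal M R"
    have "carrier R - Units R = M \<or> carrier R - Units R = carrier R"
      by (rule maximalideal.I_maximal[OF M I maximalideal_nonunits[OF M]]) auto
    moreover have "carrier R - Units R \<noteq> carrier R" by auto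
    ultimately show "M = carrier R - Units R" by simp
  qed
qed

lemma (in noetherian_cring) local_max_ideal:
  assumes "local_ring R"
  shows "max_ideal R = carrier R - Units R" "maximalideal (max_ideal R) R"
proof -
  interpret local_ring R by fact
  show m: "maximalideal (max_ideal R) R"
    unfolding max_ideal_def by (rule theI'[OF ex1_maximalideal])
  show "max_ideal R = carrier R - Units R"
  proof
    show "max_ideal R \<subseteq> carrier R - Units R" by (rule maximalideal_nonunits[OF m])
    show "carrier R - Units R \<subseteq> max_ideal R"
    proof
      fix a assume a: "a \<in> carrier R - Units R"
      have "PIdl a \<noteq> carrier R"
      proof
        assume "PIdl a = carrier R"
        then have "\<one> \<in> PIdl a" by simp
        then obtain b where b: "b \<in> carrier R" "\<one> = b \<otimes> a" unfolding mem_PIdl by blast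
        have ac: "a \<in> carrier R" using a by blast
        have "b \<otimes> a = \<one>" "a \<otimes> b = \<one>" using b(2) m_comm[OF ac b(1)] by simp_all
        then have "a \<in> Units R" unfolding Units_def using ac b(1) by blast
        then show False using a by blast
      qed
      have "ideal (PIdl a) R" using a by (simp add: cgenideal_ideal)
      from ex_maximalideal_containing[OF this \<open>PIdl a \<noteq> carrier R\<close>]
      obtain M where M: "maximalideal M R" "PIdl a \<subseteq> M" by (elim exE conjE)
      have "max_ideal R = M" unfolding max_ideal_def by (rule the1_equality[OF ex1_maximalideal M(1)])
      moreover have "a \<in> M" using M(2) cgenideal_self[of a] a by (simp add: subset_iff)
      ultimately show "a \<in> max_ideal R" by simp
    qed
  qed
qed

section \<open>Subrings of a field and their localizations\<close>

text \<open>
  The maximal ideal of \<open>localization K A P\<close>.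
\<close>

definition extended_prime :: "('a, 'b) ring_scheme \<Rightarrow> 'a set \<Rightarrow> 'a set \<Rightarrow> 'a set" where
  "extended_prime K A P = {a \<otimes>\<^bsub>K\<^esub> inv\<^bsub>K\<^esub> s | a s. a \<in> P \<and> s \<in> A - P}"

context field
begin

lemma subring_mem:
  assumes "subring A R"
  shows "A \<subseteq> carrier R" "\<zero> \<in> A" "\<one> \<in> A" "\<And>a b. a \<in> A \<Longrightarrow> b \<in> A \<Longrightarrow> a \<oplus> b \<in> A"
    "\<And>a b. a \<in> A \<Longrightarrow> b \<in> A \<Longrightarrow> a \<otimes> b \<in> A" "\<And>a. a \<in> A \<Longrightarrow> \<ominus> a \<in> A"
  using subringE[OF assms] by auto

lemma inv_mem: "a \<in> carrier R \<Longrightarrow> a \<noteq> \<zero> \<Longrightarrow> inv a \<in> carrier R"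
  "a \<in> carrier R \<Longrightarrow> a \<noteq> \<zero> \<Longrightarrow> inv a \<otimes> a = \<one>"
  "a \<in> carrier R \<Longrightarrow> a \<noteq> \<zero> \<Longrightarrow> a \<otimes> inv a = \<one>"
  "a \<in> carrier R \<Longrightarrow> a \<noteq> \<zero> \<Longrightarrow> inv a \<noteq> \<zero>"
proof -
  assume a: "a \<in> carrier R" "a \<noteq> \<zero>"
  then have u: "a \<in> Units R" by (simp add: field_Units)
  then show "inv a \<in> carrier R" "inv a \<otimes> a = \<one>" "a \<otimes> inv a = \<one>" by auto
  show "inv a \<noteq> \<zero>" using Units_inv_Units[OF u] by (simp add: field_Units)
qed

lemma ideal_sub_iff:
  assumes "subring A R"
  shows "ideal I (R\<lparr>carrier := A\<rparr>) \<longleftrightarrow> I \<subseteq> A \<and> \<zero> \<in> I \<and> (\<forall>a\<in>I. \<forall>b\<in>I. a \<oplus> b \<in> I) \<and>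
    (\<forall>r\<in>A. \<forall>a\<in>I. r \<otimes> a \<in> I)"
proof -
  interpret A: domain "R\<lparr>carrier := A\<rparr>" by (rule subring_is_domain[OF assms])
  show ?thesis
  proof
    assume "ideal I (R\<lparr>carrier := A\<rparr>)"
    from A.ideal_closed[OF this] show "I \<subseteq> A \<and> \<zero> \<in> I \<and> (\<forall>a\<in>I. \<forall>b\<in>I. a \<oplus> b \<in> I) \<and>
      (\<forall>r\<in>A. \<forall>a\<in>I. r \<otimes> a \<in> I)" by simp
  next
    assume "I \<subseteq> A \<and> \<zero> \<in> I \<and> (\<forall>a\<in>I. \<forall>b\<in>I. a \<oplus> b \<in> I) \<and> (\<forall>r\<in>A. \<forall>a\<in>I. r \<otimes> a \<in> I)"
    then show "ideal I (R\<lparr>carrier := A\<rparr>)" by (intro A.ideal_of_closed) auto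
  qed
qed

lemma prime_sub_iff:
  assumes "subring A R"
  shows "primeideal P (R\<lparr>carrier := A\<rparr>) \<longleftrightarrow> ideal P (R\<lparr>carrier := A\<rparr>) \<and> \<one> \<notin> P \<and>
    (\<forall>a\<in>A. \<forall>b\<in>A. a \<otimes> b \<in> P \<longrightarrow> a \<in> P \<or> b \<in> P)"
proof -
  interpret A: domain "R\<lparr>carrier := A\<rparr>" by (rule subring_is_domain[OF assms])
  show ?thesis
  proof
    assume P: "primeideal P (R\<lparr>carrier := A\<rparr>)"
    then show "ideal P (R\<lparr>carrier := A\<rparr>) \<and> \<one> \<notin> P \<and> (\<forall>a\<in>A. \<forall>b\<in>A. a \<otimes> b \<in> P \<longrightarrow> a \<in> P \<or> b \<in> P)"
      using A.prime_one[OF P] primeideal.I_prime[OF P] by (auto dest: primeideal.axioms)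
  next
    assume P: "ideal P (R\<lparr>carrier := A\<rparr>) \<and> \<one> \<notin> P \<and> (\<forall>a\<in>A. \<forall>b\<in>A. a \<otimes> b \<in> P \<longrightarrow> a \<in> P \<or> b \<in> P)"
    then show "primeideal P (R\<lparr>carrier := A\<rparr>)"
      using subring_mem[OF assms] by (intro primeidealI) (auto intro: A.is_cring)
  qed
qed

lemma Units_sub:
  assumes "subring A R"
  shows "Units (R\<lparr>carrier := A\<rparr>) = {a \<in> A. a \<noteq> \<zero> \<and> inv a \<in> A}"
proof (rule equalityI; rule subsetI)
  note Ac = subring_mem[OF assms]
  fix a assume "a \<in> Units (R\<lparr>carrier := A\<rparr>)"
  then obtain b where b: "a \<in> A" "b \<in> A" "b \<otimes> a = \<one>" "a \<otimes> b = \<one>" by (auto simp: Units_def)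
  then have c: "a \<in> carrier R" "b \<in> carrier R" using Ac by auto
  then have "a \<noteq> \<zero>" using b by auto
  moreover have "inv a = b" using b c comm_inv_char by blast
  ultimately show "a \<in> {a \<in> A. a \<noteq> \<zero> \<and> inv a \<in> A}" using b by auto
next
  fix a assume "a \<in> {a \<in> A. a \<noteq> \<zero> \<and> inv a \<in> A}"
  then show "a \<in> Units (R\<lparr>carrier := A\<rparr>)"
    using inv_mem(2,3)[of a] subring_mem[OF assms] by (auto simp: Units_def)
qed

text \<open>
  Description without division, which lets all computations with fractions take place in products.
\<close>

lemma mem_localization_iff:
  assumes "subring A R" "\<zero> \<in> P"
  shows "z \<in> localization R A P \<longleftrightarrow> z \<in> carrier R \<and> (\<exists>s\<in>A - P. s \<otimes> z \<in> A)"
proof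
  note Ac = subring_mem[OF assms(1)]
  assume "z \<in> localization R A P"
  then obtain a s where as: "a \<in> A" "s \<in> A - P" "z = a \<otimes> inv s" by (auto simp: localization_def)
  then have c: "a \<in> carrier R" "s \<in> carrier R" "s \<noteq> \<zero>" using Ac assms(2) by auto
  have "s \<otimes> z = (s \<otimes> inv s) \<otimes> a" using as c inv_mem(1) by (simp add: m_ac)
  then have "s \<otimes> z = a" using inv_mem(3) c by simp
  then show "z \<in> carrier R \<and> (\<exists>s\<in>A - P. s \<otimes> z \<in> A)" using as c inv_mem(1)[of s] by (metis m_closed)
next
  note Ac = subring_mem[OF assms(1)]
  assume "z \<in> carrier R \<and> (\<exists>s\<in>A - P. s \<otimes> z \<in> A)"
  then obtain s where s: "s \<in> A - P" "s \<otimes> z \<in> A" "z \<in> carrier R" by auto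
  then have c: "s \<in> carrier R" "s \<noteq> \<zero>" using Ac assms(2) by auto
  have "(s \<otimes> z) \<otimes> inv s = (s \<otimes> inv s) \<otimes> z" using s c inv_mem(1) by (simp add: m_ac)
  then have "z = (s \<otimes> z) \<otimes> inv s" using inv_mem(3) c s by simp
  then show "z \<in> localization R A P" using s by (auto simp: localization_def)
qed

lemma mem_extended_prime_iff:
  assumes "subring A R" "ideal P (R\<lparr>carrier := A\<rparr>)"
  shows "z \<in> extended_prime R A P \<longleftrightarrow> z \<in> carrier R \<and> (\<exists>s\<in>A - P. s \<otimes> z \<in> P)"
proof
  note Ac = subring_mem[OF assms(1)] and Pc = assms(2)[unfolded ideal_sub_iff[OF assms(1)]]
  assume "z \<in> extended_prime R A P"
  then obtain a s where as: "a \<in> P" "s \<in> A - P" "z = a \<otimes> inv s" by (auto simp: extended_prime_def)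
  then have c: "a \<in> carrier R" "s \<in> carrier R" "s \<noteq> \<zero>" using Ac Pc by auto
  have "s \<otimes> z = (s \<otimes> inv s) \<otimes> a" using as c inv_mem(1) by (simp add: m_ac)
  then have "s \<otimes> z = a" using inv_mem(3) c by simp
  then show "z \<in> carrier R \<and> (\<exists>s\<in>A - P. s \<otimes> z \<in> P)" using as c inv_mem(1)[of s] by (metis m_closed)
next
  note Ac = subring_mem[OF assms(1)] and Pc = assms(2)[unfolded ideal_sub_iff[OF assms(1)]]
  assume "z \<in> carrier R \<and> (\<exists>s\<in>A - P. s \<otimes> z \<in> P)"
  then obtain s where s: "s \<in> A - P" "s \<otimes> z \<in> P" "z \<in> carrier R" by auto
  then have c: "s \<in> carrier R" "s \<noteq> \<zero>" using Ac Pc by auto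
  have "(s \<otimes> z) \<otimes> inv s = (s \<otimes> inv s) \<otimes> z" using s c inv_mem(1) by (simp add: m_ac)
  then have "z = (s \<otimes> z) \<otimes> inv s" using inv_mem(3) c s by simp
  then show "z \<in> extended_prime R A P" using s by (auto simp: extended_prime_def)
qed

context
  fixes A P :: "'a set"
  assumes A: "subring A R" and P: "primeideal P (R\<lparr>carrier := A\<rparr>)"
begin

lemma prime_sub_mem:
  "ideal P (R\<lparr>carrier := A\<rparr>)" "P \<subseteq> A" "\<zero> \<in> P" "\<one> \<in> A - P"
    "\<And>a b. a \<in> P \<Longrightarrow> b \<in> P \<Longrightarrow> a \<oplus> b \<in> P" "\<And>r a. r \<in> A \<Longrightarrow> a \<in> P \<Longrightarrow> r \<otimes> a \<in> P"
    "\<And>a b. a \<in> A - P \<Longrightarrow> b \<in> A - P \<Longrightarrow> a \<otimes> b \<in> A - P"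
    "\<And>a b. a \<in> A \<Longrightarrow> b \<in> A - P \<Longrightarrow> a \<otimes> b \<in> P \<Longrightarrow> a \<in> P"
    "\<And>a b. a \<in> A \<Longrightarrow> b \<in> A - P \<Longrightarrow> b \<otimes> a \<in> P \<Longrightarrow> a \<in> P"
proof -
  show id: "ideal P (R\<lparr>carrier := A\<rparr>)" and one: "\<one> \<in> A - P"
    using P[unfolded prime_sub_iff[OF A]] subring_mem(3)[OF A] by auto
  show PA: "P \<subseteq> A" and "\<zero> \<in> P" and "\<And>a b. a \<in> P \<Longrightarrow> b \<in> P \<Longrightarrow> a \<oplus> b \<in> P"
    and "\<And>r a. r \<in> A \<Longrightarrow> a \<in> P \<Longrightarrow> r \<otimes> a \<in> P"
    using id[unfolded ideal_sub_iff[OF A]] by auto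
  have pr: "a \<in> P \<or> b \<in> P" if "a \<in> A" "b \<in> A" "a \<otimes> b \<in> P" for a b
    using P[unfolded prime_sub_iff[OF A]] that by auto
  show "a \<otimes> b \<in> A - P" if "a \<in> A - P" "b \<in> A - P" for a b
    using pr[of a b] that subring_mem(5)[OF A, of a b] by auto
  show "a \<in> P" if "a \<in> A" "b \<in> A - P" "a \<otimes> b \<in> P" for a b
    using pr[of a b] that by auto
  show "a \<in> P" if "a \<in> A" "b \<in> A - P" "b \<otimes> a \<in> P" for a b
    using pr[of b a] that by auto
qed

lemma localizationI:
  "z \<in> carrier R \<Longrightarrow> s \<in> A - P \<Longrightarrow> s \<otimes> z \<in> A \<Longrightarrow> z \<in> localization R A P"
  using mem_localization_iff[OF A prime_sub_mem(3)] by blast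

lemma localizationE:
  assumes "z \<in> localization R A P"
  obtains s where "s \<in> A - P" "s \<otimes> z \<in> A" "z \<in> carrier R" "s \<in> carrier R"
  using assms mem_localization_iff[OF A prime_sub_mem(3)] subring_mem(1)[OF A] by blast

lemma extended_primeI:
  "z \<in> carrier R \<Longrightarrow> s \<in> A - P \<Longrightarrow> s \<otimes> z \<in> P \<Longrightarrow> z \<in> extended_prime R A P"
  using mem_extended_prime_iff[OF A prime_sub_mem(1)] by blast

lemma extended_primeE:
  assumes "z \<in> extended_prime R A P"
  obtains s where "s \<in> A - P" "s \<otimes> z \<in> P" "z \<in> carrier R" "s \<in> carrier R"
  using assms mem_extended_prime_iff[OF A prime_sub_mem(1)] subring_mem(1)[OF A] by blast

lemma localization_subset_carrier: "localization R A P \<subseteq> carrier R"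
  by (blast elim: localizationE)

lemma subset_localization: "A \<subseteq> localization R A P"
proof
  fix a assume a: "a \<in> A"
  then have c: "a \<in> carrier R" using subring_mem(1)[OF A] by blast
  show "a \<in> localization R A P" by (rule localizationI[OF c prime_sub_mem(4)]) (use a c in simp)
qed

lemma localization_closed:
  assumes "z \<in> localization R A P" "w \<in> localization R A P"
  shows "z \<oplus> w \<in> localization R A P" "z \<otimes> w \<in> localization R A P"
proof -
  note Ac = subring_mem[OF A]
  obtain s where s: "s \<in> A - P" "s \<otimes> z \<in> A" "z \<in> carrier R" "s \<in> carrier R" by (rule localizationE[OF assms(1)])
  obtain t where t: "t \<in> A - P" "t \<otimes> w \<in> A" "w \<in> carrier R" "t \<in> carrier R" by (rule localizationE[OF assms(2)])
  have "(s \<otimes> t) \<otimes> (z \<oplus> w) = t \<otimes> (s \<otimes> z) \<oplus> s \<otimes> (t \<otimes> w)" using s t by (simp add: r_distr m_ac)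
  also have "\<dots> \<in> A" using s(1) t(1) Ac(4)[OF Ac(5)[OF _ s(2), of t] Ac(5)[OF _ t(2), of s]] by simp
  finally show "z \<oplus> w \<in> localization R A P"
    by (rule localizationI[OF _ prime_sub_mem(7)[OF s(1) t(1)], rotated]) (use s t in simp)
  have "(s \<otimes> t) \<otimes> (z \<otimes> w) = (s \<otimes> z) \<otimes> (t \<otimes> w)" using s t by (simp add: m_ac)
  also have "\<dots> \<in> A" by (rule Ac(5)[OF s(2) t(2)])
  finally show "z \<otimes> w \<in> localization R A P"
    by (rule localizationI[OF _ prime_sub_mem(7)[OF s(1) t(1)], rotated]) (use s t in simp)
qed

lemma subring_localization: "subring (localization R A P) R"
proof (rule subringI)
  show "localization R A P \<subseteq> carrier R" by (rule localization_subset_carrier)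
  show "\<one> \<in> localization R A P" using subset_localization subring_mem(3)[OF A] by blast
  show "\<ominus> h \<in> localization R A P" if h: "h \<in> localization R A P" for h
  proof -
    have "\<ominus> \<one> \<in> A" using subring_mem(3,6)[OF A] by simp
    then have "\<ominus> \<one> \<in> localization R A P" using subset_localization by (rule rev_subsetD)
    moreover have "h \<in> carrier R" using h localization_subset_carrier by (rule rev_subsetD)
    then have "\<ominus> h = \<ominus> \<one> \<otimes> h" by (simp add: l_minus)
    ultimately show ?thesis using localization_closed(2)[OF _ h] by simp
  qed
qed (rule localization_closed; assumption)+

lemma inv_in_localization:
  assumes "z \<in> localization R A P" "z \<notin> extended_prime R A P"
  shows "z \<noteq> \<zero>" "inv z \<in> localization R A P"
proof -
  obtain s where s: "s \<in> A - P" "s \<otimes> z \<in> A" "z \<in> carrier R" "s \<in> carrier R" by (rule localizationE[OF assms(1)])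
  have sz: "s \<otimes> z \<in> A - P" using s assms(2) extended_primeI[OF s(3,1)] by blast
  show z0: "z \<noteq> \<zero>" using sz prime_sub_mem(3) s(4) by auto
  have "(s \<otimes> z) \<otimes> inv z = s" using s inv_mem[OF s(3) z0] by (simp add: m_assoc)
  then show "inv z \<in> localization R A P"
    using s inv_mem(1)[OF s(3) z0] by (intro localizationI[OF _ sz]) auto
qed

lemma prime_contraction:
  assumes B: "subring B R" "B \<subseteq> localization R A P"
  shows "primeideal (extended_prime R A P \<inter> B) (R\<lparr>carrier := B\<rparr>)"
proof -
  note Ac = subring_mem[OF A] and Bc = subring_mem[OF B(1)]
  have BE: thesis if "z \<in> B" "\<And>s. s \<in> A - P \<Longrightarrow> s \<otimes> z \<in> A \<Longrightarrow> z \<in> carrier R \<Longrightarrow> s \<in> carrier R \<Longrightarrow> thesis" for z thesis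
    by (rule localizationE[OF subsetD[OF B(2) that(1)]]) (rule that(2))
  show ?thesis
    unfolding prime_sub_iff[OF B(1)] ideal_sub_iff[OF B(1)]
  proof (intro conjI ballI impI)
    show "extended_prime R A P \<inter> B \<subseteq> B" by simp
    have "\<zero> \<in> extended_prime R A P"
      by (rule extended_primeI[OF zero_closed prime_sub_mem(4)]) (use prime_sub_mem(3) in simp)
    then show "\<zero> \<in> extended_prime R A P \<inter> B" using Bc(2) by simp
    show "\<one> \<notin> extended_prime R A P \<inter> B"
    proof
      assume "\<one> \<in> extended_prime R A P \<inter> B"
      then obtain s where "s \<in> A - P" "s \<otimes> \<one> \<in> P" "s \<in> carrier R" by (blast elim: extended_primeE)
      then show False by simp
    qed
  next
    fix z w assume "z \<in> extended_prime R A P \<inter> B" "w \<in> extended_prime R A P \<inter> B"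
    then have zw: "z \<in> extended_prime R A P" "w \<in> extended_prime R A P" "z \<in> B" "w \<in> B" by auto
    obtain s where s: "s \<in> A - P" "s \<otimes> z \<in> P" "z \<in> carrier R" "s \<in> carrier R" by (rule extended_primeE[OF zw(1)])
    obtain t where t: "t \<in> A - P" "t \<otimes> w \<in> P" "w \<in> carrier R" "t \<in> carrier R" by (rule extended_primeE[OF zw(2)])
    have "(s \<otimes> t) \<otimes> (z \<oplus> w) = t \<otimes> (s \<otimes> z) \<oplus> s \<otimes> (t \<otimes> w)" using s t by (simp add: r_distr m_ac)
    also have "\<dots> \<in> P" using s(1) t(1) prime_sub_mem(5)[OF prime_sub_mem(6)[OF _ s(2), of t] prime_sub_mem(6)[OF _ t(2), of s]] by simp
    finally have "z \<oplus> w \<in> extended_prime R A P"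
      by (rule extended_primeI[OF _ prime_sub_mem(7)[OF s(1) t(1)], rotated]) (use s t in simp)
    then show "z \<oplus> w \<in> extended_prime R A P \<inter> B" using Bc(4) zw by simp
  next
    fix r z assume r: "r \<in> B" and "z \<in> extended_prime R A P \<inter> B"
    then have z: "z \<in> extended_prime R A P" "z \<in> B" by auto
    obtain s where s: "s \<in> A - P" "s \<otimes> z \<in> P" "z \<in> carrier R" "s \<in> carrier R" by (rule extended_primeE[OF z(1)])
    obtain t where t: "t \<in> A - P" "t \<otimes> r \<in> A" "r \<in> carrier R" "t \<in> carrier R" by (rule BE[OF r])
    have "(s \<otimes> t) \<otimes> (r \<otimes> z) = (t \<otimes> r) \<otimes> (s \<otimes> z)" using s t by (simp add: m_ac)
    also have "\<dots> \<in> P" by (rule prime_sub_mem(6)[OF t(2) s(2)])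
    finally have "r \<otimes> z \<in> extended_prime R A P"
      by (rule extended_primeI[OF _ prime_sub_mem(7)[OF s(1) t(1)], rotated]) (use s t in simp)
    then show "r \<otimes> z \<in> extended_prime R A P \<inter> B" using Bc(5) r z by simp
  next
    fix z w assume zw: "z \<in> B" "w \<in> B" "z \<otimes> w \<in> extended_prime R A P \<inter> B"
    obtain s where s: "s \<in> A - P" "s \<otimes> z \<in> A" "z \<in> carrier R" "s \<in> carrier R" by (rule BE[OF zw(1)])
    obtain t where t: "t \<in> A - P" "t \<otimes> w \<in> A" "w \<in> carrier R" "t \<in> carrier R" by (rule BE[OF zw(2)])
    obtain u where u: "u \<in> A - P" "u \<otimes> (z \<otimes> w) \<in> P" "u \<in> carrier R" using zw(3) by (blast elim: extended_primeE)
    have "u \<otimes> ((s \<otimes> z) \<otimes> (t \<otimes> w)) = (s \<otimes> t) \<otimes> (u \<otimes> (z \<otimes> w))" using s t u by (simp add: m_ac)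
    also have "\<dots> \<in> P" using s(1) t(1) prime_sub_mem(6)[OF Ac(5)[of s t] u(2)] by simp
    finally have "(s \<otimes> z) \<otimes> (t \<otimes> w) \<in> P" by (rule prime_sub_mem(9)[OF Ac(5)[OF s(2) t(2)] u(1)])
    then have "s \<otimes> z \<in> P \<or> t \<otimes> w \<in> P" using prime_sub_mem(7)[of "s \<otimes> z" "t \<otimes> w"] s t by auto
    then have "z \<in> extended_prime R A P \<or> w \<in> extended_prime R A P"
      using extended_primeI[OF s(3,1)] extended_primeI[OF t(3,1)] by auto
    then show "z \<in> extended_prime R A P \<inter> B \<or> w \<in> extended_prime R A P \<inter> B" using zw by simp
  qed
qed

lemma extended_prime_Int_subring: "extended_prime R A P \<inter> A = P"
proof (rule equalityI; rule subsetI)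
  fix z assume z: "z \<in> extended_prime R A P \<inter> A"
  then obtain s where "s \<in> A - P" "s \<otimes> z \<in> P" by (blast elim: extended_primeE)
  then show "z \<in> P" using prime_sub_mem(9)[of z s] z by simp
next
  fix z assume z: "z \<in> P"
  then have zA: "z \<in> A" "z \<in> carrier R" using prime_sub_mem(2) subring_mem(1)[OF A] by auto
  have "z \<in> extended_prime R A P" by (rule extended_primeI[OF zA(2) prime_sub_mem(4)]) (use z zA in simp)
  then show "z \<in> extended_prime R A P \<inter> A" using zA by simp
qed

lemma inv_mult_in_localization:
  assumes "s \<in> localization R A P" "s \<notin> extended_prime R A P" "s \<otimes> z \<in> localization R A P" "z \<in> carrier R"
  shows "z \<in> localization R A P"
proof -
  note si = inv_in_localization[OF assms(1,2)]
  have sc: "s \<in> carrier R" using assms(1) localization_subset_carrier by (rule rev_subsetD)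
  have "inv s \<otimes> (s \<otimes> z) = z"
    using inv_mem[OF sc si(1)] sc assms(4) by (simp add: m_assoc[symmetric])
  then show ?thesis using localization_closed(2)[OF si(2) assms(3)] by simp
qed

end

text \<open>
  A fraction with numerator in \<open>P\<close> may have its denominator in \<open>Q\<close>. If it has another denominator outside
  \<open>Q\<close>, then the numerator that goes with it is in \<open>P\<close> as well, because \<open>P\<close> is prime.
\<close>

lemma extended_prime_mono:
  assumes A: "subring A R" and P: "primeideal P (R\<lparr>carrier := A\<rparr>)" and Q: "primeideal Q (R\<lparr>carrier := A\<rparr>)"
    and PQ: "P \<subseteq> Q"
  shows "localization R A Q \<subseteq> localization R A P"
    "extended_prime R A P \<inter> localization R A Q \<subseteq> extended_prime R A Q"
proof -
  note Ac = subring_mem[OF A]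
  show "localization R A Q \<subseteq> localization R A P"
  proof
    fix z assume "z \<in> localization R A Q"
    then obtain s where s: "s \<in> A - Q" "s \<otimes> z \<in> A" "z \<in> carrier R" by (rule localizationE[OF A Q])
    then show "z \<in> localization R A P" using PQ by (intro localizationI[OF A P s(3), of s]) auto
  qed
  show "extended_prime R A P \<inter> localization R A Q \<subseteq> extended_prime R A Q"
  proof
    fix z assume z: "z \<in> extended_prime R A P \<inter> localization R A Q"
    obtain s where s: "s \<in> A - P" "s \<otimes> z \<in> P" "z \<in> carrier R" "s \<in> carrier R"
      by (rule extended_primeE[OF A P IntD1[OF z]])
    obtain t where t: "t \<in> A - Q" "t \<otimes> z \<in> A" "t \<in> carrier R" by (rule localizationE[OF A Q IntD2[OF z]])
    have "s \<otimes> (t \<otimes> z) = t \<otimes> (s \<otimes> z)" using s t by (simp add: m_lcomm)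
    also have "\<dots> \<in> P" using s t prime_sub_mem(6)[OF A P] by auto
    finally have "t \<otimes> z \<in> P" by (rule prime_sub_mem(9)[OF A P t(2) s(1)])
    then show "z \<in> extended_prime R A Q" using PQ by (intro extended_primeI[OF A Q s(3) t(1)]) auto
  qed
qed

end

section \<open>Primes under one monomial transform\<close>

lemma prime_chain_mono:
  assumes "prime_chain R n p" "i \<le> j" "j \<le> n"
  shows "p i \<subseteq> p j"
  using assms(2,3)
proof (induction j rule: dec_induct)
  case (step j)
  then have "p j \<subset> p (Suc j)" using assms(1) by (simp add: prime_chain_def)
  then show ?case using step by auto
qed simp

context field
begin

lemma noetherian_cring_sub:
  assumes "subring A R" "noetherian_ring (R\<lparr>carrier := A\<rparr>)"
  shows "noetherian_cring (R\<lparr>carrier := A\<rparr>)"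
proof -
  interpret A: domain "R\<lparr>carrier := A\<rparr>" by (rule subring_is_domain[OF assms(1)])
  show ?thesis by (intro noetherian_cring.intro assms(2) A.is_cring)
qed

lemma max_ideal_sub:
  assumes "subring A R" "noetherian_ring (R\<lparr>carrier := A\<rparr>)" "local_ring (R\<lparr>carrier := A\<rparr>)"
  shows "max_ideal (R\<lparr>carrier := A\<rparr>) = {a \<in> A. a = \<zero> \<or> inv a \<notin> A}"
    "primeideal (max_ideal (R\<lparr>carrier := A\<rparr>)) (R\<lparr>carrier := A\<rparr>)"
proof -
  interpret A: noetherian_cring "R\<lparr>carrier := A\<rparr>" by (rule noetherian_cring_sub[OF assms(1,2)])
  show "max_ideal (R\<lparr>carrier := A\<rparr>) = {a \<in> A. a = \<zero> \<or> inv a \<notin> A}"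
    using A.local_max_ideal(1)[OF assms(3)] unfolding Units_sub[OF assms(1)] by auto
  show "primeideal (max_ideal (R\<lparr>carrier := A\<rparr>)) (R\<lparr>carrier := A\<rparr>)"
    by (rule A.maximalideal_prime[OF A.local_max_ideal(2)[OF assms(3)]])
qed

lemma Idl_sub:
  assumes "subring A R" "S \<subseteq> A"
  shows "ideal (Idl\<^bsub>R\<lparr>carrier := A\<rparr>\<^esub> S) (R\<lparr>carrier := A\<rparr>)" "S \<subseteq> Idl\<^bsub>R\<lparr>carrier := A\<rparr>\<^esub> S"
    "\<And>I. ideal I (R\<lparr>carrier := A\<rparr>) \<Longrightarrow> S \<subseteq> I \<Longrightarrow> Idl\<^bsub>R\<lparr>carrier := A\<rparr>\<^esub> S \<subseteq> I"
proof -
  interpret A: domain "R\<lparr>carrier := A\<rparr>" by (rule subring_is_domain[OF assms(1)])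
  show "ideal (Idl\<^bsub>R\<lparr>carrier := A\<rparr>\<^esub> S) (R\<lparr>carrier := A\<rparr>)" "S \<subseteq> Idl\<^bsub>R\<lparr>carrier := A\<rparr>\<^esub> S"
    using A.genideal_ideal[of S] A.genideal_self[of S] assms(2) by auto
  show "\<And>I. ideal I (R\<lparr>carrier := A\<rparr>) \<Longrightarrow> S \<subseteq> I \<Longrightarrow> Idl\<^bsub>R\<lparr>carrier := A\<rparr>\<^esub> S \<subseteq> I"
    by (rule A.genideal_minimal)
qed

text \<open>
  Used to write every element of the affine chart of the blow-up as an element of the base ring plus
  an element of an ideal.
\<close>

lemma subring_add_ideal:
  assumes A: "subring A R" and B: "subring B R" and AB: "A \<subseteq> B" and I: "ideal I (R\<lparr>carrier := B\<rparr>)"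
  shows "subring {a \<oplus> t | a t. a \<in> A \<and> t \<in> I} R"
proof (rule subringI)
  note Ac = subring_mem[OF A] and Bc = subring_mem[OF B]
  have Ic: "I \<subseteq> B" "\<zero> \<in> I" "\<And>a b. a \<in> I \<Longrightarrow> b \<in> I \<Longrightarrow> a \<oplus> b \<in> I" "\<And>r a. r \<in> B \<Longrightarrow> a \<in> I \<Longrightarrow> r \<otimes> a \<in> I"
    using I[unfolded ideal_sub_iff[OF B]] by blast+
  have cA: "\<And>a. a \<in> A \<Longrightarrow> a \<in> carrier R" and cI: "\<And>a. a \<in> I \<Longrightarrow> a \<in> carrier R" using Ac(1) Bc(1) Ic(1) by blast+
  let ?H = "{a \<oplus> t | a t. a \<in> A \<and> t \<in> I}"
  show "?H \<subseteq> carrier R" using cA cI by auto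
  have "\<one> = \<one> \<oplus> \<zero>" by simp
  then show "\<one> \<in> ?H" using Ac(3) Ic(2) by blast
  show "\<ominus> h \<in> ?H" if "h \<in> ?H" for h
  proof -
    from that obtain a t where at: "a \<in> A" "t \<in> I" "h = a \<oplus> t" by auto
    have "\<ominus> h = \<ominus> a \<oplus> \<ominus> \<one> \<otimes> t" using at cA cI by (simp add: minus_add l_minus)
    moreover have "\<ominus> a \<in> A" "\<ominus> \<one> \<otimes> t \<in> I" using at Ac Ic(4) Bc by auto
    ultimately show ?thesis by blast
  qed
  show "g \<oplus> h \<in> ?H" if gh: "g \<in> ?H" "h \<in> ?H" for g h
  proof -
    from gh obtain a t b u where at: "a \<in> A" "t \<in> I" "g = a \<oplus> t" "b \<in> A" "u \<in> I" "h = b \<oplus> u" by auto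
    have "g \<oplus> h = (a \<oplus> b) \<oplus> (t \<oplus> u)" using at cA cI by (simp add: a_ac)
    moreover have "a \<oplus> b \<in> A" "t \<oplus> u \<in> I" using at Ac Ic by auto
    ultimately show ?thesis by blast
  qed
  show "g \<otimes> h \<in> ?H" if gh: "g \<in> ?H" "h \<in> ?H" for g h
  proof -
    from gh obtain a t b u where at: "a \<in> A" "t \<in> I" "g = a \<oplus> t" "b \<in> A" "u \<in> I" "h = b \<oplus> u" by auto
    have c: "a \<in> carrier R" "t \<in> carrier R" "b \<in> carrier R" "u \<in> carrier R" using at cA cI by auto
    have "g \<otimes> h = a \<otimes> b \<oplus> ((b \<oplus> u) \<otimes> t \<oplus> a \<otimes> u)"
      unfolding at using c by (simp add: l_distr r_distr m_ac a_ac)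
    moreover have "a \<otimes> b \<in> A" using at Ac by auto
    moreover have "(b \<oplus> u) \<otimes> t \<oplus> a \<otimes> u \<in> I"
    proof (rule Ic(3))
      show "(b \<oplus> u) \<otimes> t \<in> I" using at AB Ic(1) by (intro Ic(4) Bc(4)) auto
      show "a \<otimes> u \<in> I" using at AB by (intro Ic(4)) auto
    qed
    ultimately show ?thesis by blast
  qed
qed

end

locale monomial_transform = field K for K (structure) +
  fixes A A' :: "'a set" and d k :: nat and x x' :: "nat \<Rightarrow> 'a"
  assumes A: "subring A K" "noetherian_ring (K\<lparr>carrier := A\<rparr>)" "local_ring (K\<lparr>carrier := A\<rparr>)"
    and A': "subring A' K" "noetherian_ring (K\<lparr>carrier := A'\<rparr>)" "local_ring (K\<lparr>carrier := A'\<rparr>)"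
    and x: "x ` {1..d} \<subseteq> A" and x_nz: "\<And>l. l \<in> {1..d} \<Longrightarrow> x l \<noteq> \<zero>"
    and max_Idl: "max_ideal (K\<lparr>carrier := A\<rparr>) = Idl\<^bsub>K\<lparr>carrier := A\<rparr>\<^esub> (x ` {1..d})"
    and lqt: "monomial_lqt K d k A x A' x'"
begin

text \<open>
  \<open>B\<close> is the affine chart of the blow-up of \<open>M\<close> in the direction \<open>k\<close>, and \<open>P\<close> is the ideal of \<open>B\<close> at which it
  is localized.
\<close>

definition M where "M = max_ideal (K\<lparr>carrier := A\<rparr>)"
definition M' where "M' = max_ideal (K\<lparr>carrier := A'\<rparr>)"
definition B where "B = generate_ring K (A \<union> {y \<otimes> inv (x k) | y. y \<in> M})"
definition P where "P = Idl\<^bsub>K\<lparr>carrier := B\<rparr>\<^esub> (x' ` {1..d})"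

lemma lqt_unfolded:
  "k \<in> {1..d}" "x' k = x k" "\<And>l. l \<in> {1..d} - {k} \<Longrightarrow> x' l = x l \<otimes> inv (x k)"
  "A' = localization K B P"
  using lqt unfolding monomial_lqt_def Let_def B_def P_def M_def by blast+

lemmas Ac = subring_mem[OF A(1)] and A'c = subring_mem[OF A'(1)]

lemma M_eq: "M = {a \<in> A. a = \<zero> \<or> inv a \<notin> A}" and M_prime: "primeideal M (K\<lparr>carrier := A\<rparr>)"
  and M'_eq: "M' = {a \<in> A'. a = \<zero> \<or> inv a \<notin> A'}" and M'_prime: "primeideal M' (K\<lparr>carrier := A'\<rparr>)"
  unfolding M_def M'_def using max_ideal_sub[OF A] max_ideal_sub[OF A'] by auto

lemmas Mm = prime_sub_mem[OF A(1) M_prime] and M'm = prime_sub_mem[OF A'(1) M'_prime]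

lemma x_mem: assumes "l \<in> {1..d}"
  shows "x l \<in> M" "x l \<in> A" "x l \<in> carrier K" "x l \<noteq> \<zero>" "inv (x l) \<in> carrier K" "inv (x l) \<noteq> \<zero>"
    "inv (x l) \<otimes> x l = \<one>" "x l \<otimes> inv (x l) = \<one>"
proof -
  show "x l \<in> M" using Idl_sub(2)[OF A(1) x] max_Idl assms by (auto simp: M_def)
  show a: "x l \<in> A" using x assms by auto
  then show c: "x l \<in> carrier K" using Ac by auto
  show nz: "x l \<noteq> \<zero>" by (rule x_nz[OF assms])
  show "inv (x l) \<in> carrier K" "inv (x l) \<noteq> \<zero>" "inv (x l) \<otimes> x l = \<one>" "x l \<otimes> inv (x l) = \<one>"
    using inv_mem[OF c nz] by auto
qed

lemmas xk = x_mem[OF lqt_unfolded(1)]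

lemma M_least: "ideal I (K\<lparr>carrier := A\<rparr>) \<Longrightarrow> (\<And>l. l \<in> {1..d} \<Longrightarrow> x l \<in> I) \<Longrightarrow> M \<subseteq> I"
  unfolding M_def max_Idl by (rule Idl_sub(3)[OF A(1) x]) auto

lemma B_gens: "A \<union> {y \<otimes> inv (x k) | y. y \<in> M} \<subseteq> carrier K"
  using Ac(1) Mm(2) xk(5) by auto

lemma B_subring: "subring B K"
  unfolding B_def by (rule generate_ring_is_subring[OF B_gens])

lemma B_incl: "A \<subseteq> B" "\<And>y. y \<in> M \<Longrightarrow> y \<otimes> inv (x k) \<in> B"
  unfolding B_def by (auto intro: generate_ring.incl)

lemma B_least: "subring H K \<Longrightarrow> A \<subseteq> H \<Longrightarrow> (\<And>y. y \<in> M \<Longrightarrow> y \<otimes> inv (x k) \<in> H) \<Longrightarrow> B \<subseteq> H"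
  unfolding B_def by (rule generate_ring_min_subring1) (use B_gens in auto)

lemmas Bc = subring_mem[OF B_subring]

lemma x'_B: "x' ` {1..d} \<subseteq> B"
proof
  fix z assume "z \<in> x' ` {1..d}"
  then obtain l where l: "l \<in> {1..d}" "z = x' l" by auto
  show "z \<in> B"
    using lqt_unfolded(2) lqt_unfolded(3)[of l] l x_mem[OF l(1)] B_incl by (cases "l = k") auto
qed

lemma x'_nz: "l \<in> {1..d} \<Longrightarrow> x' l \<noteq> \<zero>"
  using lqt_unfolded(2) lqt_unfolded(3)[of l] x_mem[of l] xk integral[of "x l" "inv (x k)"] by (cases "l = k") auto

lemma x_eq: "l \<in> {1..d} - {k} \<Longrightarrow> x l = x' l \<otimes> x' k"
  using lqt_unfolded(2) lqt_unfolded(3)[of l] x_mem[of l] xk by (simp add: m_assoc)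

lemma P_ideal: "ideal P (K\<lparr>carrier := B\<rparr>)" and x'_P: "l \<in> {1..d} \<Longrightarrow> x' l \<in> P"
  using Idl_sub[OF B_subring x'_B] unfolding P_def by auto

lemma Pm: "P \<subseteq> B" "\<zero> \<in> P" "\<And>a b. a \<in> P \<Longrightarrow> b \<in> P \<Longrightarrow> a \<oplus> b \<in> P" "\<And>r a. r \<in> B \<Longrightarrow> a \<in> P \<Longrightarrow> r \<otimes> a \<in> P"
  using P_ideal[unfolded ideal_sub_iff[OF B_subring]] by blast+

lemma A'_iff: "z \<in> A' \<longleftrightarrow> z \<in> carrier K \<and> (\<exists>s\<in>B - P. s \<otimes> z \<in> B)"
  unfolding lqt_unfolded(4) by (rule mem_localization_iff[OF B_subring Pm(2)])

lemma A'I: "z \<in> carrier K \<Longrightarrow> s \<in> B - P \<Longrightarrow> s \<otimes> z \<in> B \<Longrightarrow> z \<in> A'"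
  unfolding A'_iff by blast

lemma A'E:
  assumes "z \<in> A'"
  obtains s where "s \<in> B - P" "s \<otimes> z \<in> B" "z \<in> carrier K" "s \<in> carrier K"
  using assms Bc(1) unfolding A'_iff by blast

text \<open>
  Otherwise \<open>P = B\<close>, there are no denominators, and \<open>A'\<close> is empty.
\<close>

lemma one_notin_P: "\<one> \<notin> P"
proof
  assume "\<one> \<in> P"
  then have "b \<in> P" if "b \<in> B" for b using Pm(4)[of b \<one>] Bc(1) that by auto
  then show False using A'c(3) by (blast elim: A'E)
qed

lemma B_sub_A': "B \<subseteq> A'"
proof
  fix b assume b: "b \<in> B"
  then have "b \<in> carrier K" using Bc(1) by blast
  then show "b \<in> A'" using one_notin_P Bc(3) b by (intro A'I[of b \<one>]) auto
qed

lemma A_sub_A': "A \<subseteq> A'" using B_incl(1) B_sub_A' by blast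

lemma inv_B: assumes "s \<in> B - P" shows "s \<noteq> \<zero>" "inv s \<in> A'"
proof -
  show nz: "s \<noteq> \<zero>" using assms Pm(2) by auto
  have c: "s \<in> carrier K" using assms Bc by auto
  have "s \<otimes> inv s \<in> B" using inv_mem(3)[OF c nz] Bc by simp
  then show "inv s \<in> A'" using A'I[OF inv_mem(1)[OF c nz] assms] by simp
qed

lemma P_sub_M': "P \<subseteq> M'"
proof
  fix p assume p: "p \<in> P"
  have pA': "p \<in> A'" and pc: "p \<in> carrier K" using p Pm(1) B_sub_A' Bc(1) by auto
  have "inv p \<notin> A'" if nz: "p \<noteq> \<zero>"
  proof
    assume "inv p \<in> A'"
    then obtain s where s: "s \<in> B - P" "s \<otimes> inv p \<in> B" by (blast elim: A'E)
    have "(s \<otimes> inv p) \<otimes> p = s" using s Bc inv_mem[OF pc nz] pc by (simp add: m_assoc subset_iff)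
    then have "s \<in> P" using Pm(4)[OF s(2) p] by simp
    then show False using s by simp
  qed
  then show "p \<in> M'" using pA' by (auto simp: M'_eq)
qed

text \<open>
  Denominators are units of \<open>A'\<close> and \<open>P\<close> consists of nonunits, so \<open>P\<close> is the contraction of \<open>M'\<close>.
\<close>

lemma M'_Int_B: "M' \<inter> B = P"
proof
  show "P \<subseteq> M' \<inter> B" using P_sub_M' Pm(1) by blast
  show "M' \<inter> B \<subseteq> P"
  proof (rule subsetI, rule ccontr)
    fix b assume b: "b \<in> M' \<inter> B" "b \<notin> P"
    then show False using inv_B[of b] by (auto simp: M'_eq)
  qed
qed

lemma x'_mem: assumes "l \<in> {1..d}" shows "x' l \<in> M'" "x' l \<in> A'" "x' l \<in> carrier K"
  using x'_P[OF assms] P_sub_M' M'm(2) A'c(1) by auto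

lemma M'_eq_Idl: "M' = Idl\<^bsub>K\<lparr>carrier := A'\<rparr>\<^esub> (x' ` {1..d})"
proof
  let ?I = "Idl\<^bsub>K\<lparr>carrier := A'\<rparr>\<^esub> (x' ` {1..d})"
  have sub: "x' ` {1..d} \<subseteq> A'" using x'_mem by auto
  note I = Idl_sub[OF A'(1) sub]
  note Ic = I(1)[unfolded ideal_sub_iff[OF A'(1)]]
  show "?I \<subseteq> M'" by (rule I(3)[OF M'm(1)]) (use x'_mem in auto)
  have "ideal (?I \<inter> B) (K\<lparr>carrier := B\<rparr>)"
    unfolding ideal_sub_iff[OF B_subring]
  proof (intro conjI ballI)
    show "?I \<inter> B \<subseteq> B" by (rule Int_lower2)
    show "\<zero> \<in> ?I \<inter> B" using Ic Bc(2) by simp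
    show "a \<oplus> b \<in> ?I \<inter> B" if "a \<in> ?I \<inter> B" "b \<in> ?I \<inter> B" for a b using that Ic Bc(4) by simp
    show "r \<otimes> a \<in> ?I \<inter> B" if "r \<in> B" "a \<in> ?I \<inter> B" for r a
      using that Ic Bc(5) B_sub_A' by (simp add: subset_iff)
  qed
  moreover have "x' ` {1..d} \<subseteq> ?I \<inter> B" using I(2) x'_B by blast
  ultimately have PI: "P \<subseteq> ?I" unfolding P_def using Idl_sub(3)[OF B_subring x'_B] by blast
  show "M' \<subseteq> ?I"
  proof
    fix z assume z: "z \<in> M'"
    then have zA: "z \<in> A'" and zc: "z \<in> carrier K" using M'm(2) A'c(1) by auto
    then obtain s where s: "s \<in> B - P" "s \<otimes> z \<in> B" by (blast elim: A'E)
    have sc: "s \<in> carrier K" using s Bc by auto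
    note si = inv_B[OF s(1)]
    have "s \<otimes> z \<in> M'" using M'm(6) z s B_sub_A' by blast
    then have "s \<otimes> z \<in> ?I" using s M'_Int_B PI by blast
    then have "inv s \<otimes> (s \<otimes> z) \<in> ?I" using Ic si by blast
    moreover have "inv s \<otimes> (s \<otimes> z) = z"
      using inv_mem[OF sc si(1)] sc zc by (simp add: m_assoc[symmetric])
    ultimately show "z \<in> ?I" by simp
  qed
qed

lemma M_sub_P: "M \<subseteq> P"
proof -
  have "ideal (P \<inter> A) (K\<lparr>carrier := A\<rparr>)"
    unfolding ideal_sub_iff[OF A(1)]
  proof (intro conjI ballI)
    show "P \<inter> A \<subseteq> A" by (rule Int_lower2)
    show "\<zero> \<in> P \<inter> A" using Pm(2) Ac(2) by simp
    show "a \<oplus> b \<in> P \<inter> A" if "a \<in> P \<inter> A" "b \<in> P \<inter> A" for a b using that Pm(3) Ac(4) by simp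
    show "r \<otimes> a \<in> P \<inter> A" if "r \<in> A" "a \<in> P \<inter> A" for r a
      using that Pm(4)[of r a] Ac(5) B_incl(1) by auto
  qed
  moreover have "x l \<in> P \<inter> A" if l: "l \<in> {1..d}" for l
  proof (cases "l = k")
    case True
    then show ?thesis using x'_P[OF l] lqt_unfolded(2) x_mem[OF l] by simp
  next
    case False
    have "x l = x' l \<otimes> x' k" using False l x_eq by auto
    moreover have "x' l \<in> B" using x'_B l by blast
    ultimately have "x l \<in> P" using Pm(4)[of "x' l" "x' k"] x'_P[OF lqt_unfolded(1)] by simp
    then show ?thesis using x_mem[OF l] by simp
  qed
  ultimately show ?thesis using M_least by blast
qed

lemma M'_Int_A: "M' \<inter> A = M"
proof
  show "M \<subseteq> M' \<inter> A" using M_sub_P P_sub_M' Mm(2) by blast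
  show "M' \<inter> A \<subseteq> M" using A_sub_A' by (auto simp: M_eq M'_eq)
qed

context
  fixes Q
  assumes Q: "primeideal Q (K\<lparr>carrier := A\<rparr>)" and QM: "Q \<subseteq> M"
    and xQ: "\<And>l. l \<in> {1..d} - {k} \<Longrightarrow> x l \<in> Q" and xkQ: "x k \<notin> Q"
begin

lemmas Qm = prime_sub_mem[OF A(1) Q]

lemma B_sub_localization: "B \<subseteq> localization K A Q"
proof (rule B_least[OF subring_localization[OF A(1) Q] subset_localization[OF A(1) Q]])
  fix y assume y: "y \<in> M"
  then have yc: "y \<in> carrier K" "y \<in> A" using Mm(2) Ac(1) by auto
  have "x k \<otimes> (y \<otimes> inv (x k)) = y \<otimes> (x k \<otimes> inv (x k))" using yc xk(3,5) by (simp add: m_lcomm)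
  also have "\<dots> = y" using xk(8) yc by simp
  finally have "x k \<otimes> (y \<otimes> inv (x k)) \<in> A" using yc by simp
  then show "y \<otimes> inv (x k) \<in> localization K A Q"
    using xk yc xkQ by (intro localizationI[OF A(1) Q, of _ "x k"]) auto
qed

text \<open>
  All \<open>x' l\<close> with \<open>l \<noteq> k\<close> lie in both ideals, so
  every element of \<open>B\<close> is the sum of some \<open>a \<in> A\<close> and an element of their intersection. If the sum lies
  in the left-hand side, so does \<open>a\<close>, whence \<open>a \<in> Q \<subseteq> M \<subseteq> P\<close>.
\<close>

lemma extended_Int_B: "extended_prime K A Q \<inter> B \<subseteq> P"
proof -
  let ?E = "extended_prime K A Q \<inter> B"
  have E: "ideal ?E (K\<lparr>carrier := B\<rparr>)"
    using prime_contraction[OF A(1) Q B_subring B_sub_localization] by (rule primeideal.axioms)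
  note Em = E[unfolded ideal_sub_iff[OF B_subring]]
  have I: "ideal (?E \<inter> P) (K\<lparr>carrier := B\<rparr>)"
    unfolding ideal_sub_iff[OF B_subring]
  proof (intro conjI ballI)
    show "?E \<inter> P \<subseteq> B" using Pm(1) by (rule le_infI2)
    show "\<zero> \<in> ?E \<inter> P" using Em Pm(2) by simp
    show "a \<oplus> b \<in> ?E \<inter> P" if "a \<in> ?E \<inter> P" "b \<in> ?E \<inter> P" for a b using that Em Pm(3) by simp
    show "r \<otimes> a \<in> ?E \<inter> P" if "r \<in> B" "a \<in> ?E \<inter> P" for r a using that Em Pm(4) by simp
  qed
  let ?H = "{a \<oplus> t | a t. a \<in> A \<and> t \<in> ?E \<inter> P}"
  have H: "subring ?H K" by (rule subring_add_ideal[OF A(1) B_subring B_incl(1) I])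
  note Hm = subring_mem[OF H]
  have AH: "A \<subseteq> ?H"
  proof
    fix a assume "a \<in> A"
    moreover have "a = a \<oplus> \<zero>" using \<open>a \<in> A\<close> Ac(1) by auto
    ultimately show "a \<in> ?H" using Em Pm(2) by blast
  qed
  have IH: "?E \<inter> P \<subseteq> ?H"
  proof
    fix t assume t: "t \<in> ?E \<inter> P"
    then have "t = \<zero> \<oplus> t" using Bc(1) by auto
    then show "t \<in> ?H" using t Ac(2) by blast
  qed
  \<comment> \<open>The generators \<open>y / x k\<close> of \<open>B\<close> have this form because those with \<open>y = x l\<close> do.\<close>
  have "B \<subseteq> ?H"
  proof (rule B_least[OF H AH])
    fix y assume y: "y \<in> M"
    define J where "J = {y \<in> A. y \<otimes> inv (x k) \<in> ?H}"
    have "ideal J (K\<lparr>carrier := A\<rparr>)"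
      unfolding ideal_sub_iff[OF A(1)]
    proof (intro conjI ballI)
      show "J \<subseteq> A" by (auto simp: J_def)
      show "\<zero> \<in> J" unfolding J_def using Hm(2) Ac(2) xk(5) by simp
      show "a \<oplus> b \<in> J" if ab: "a \<in> J" "b \<in> J" for a b
      proof -
        have m: "a \<in> A" "b \<in> A" "a \<otimes> inv (x k) \<in> ?H" "b \<otimes> inv (x k) \<in> ?H" using ab unfolding J_def by blast+
        have "(a \<oplus> b) \<otimes> inv (x k) = a \<otimes> inv (x k) \<oplus> b \<otimes> inv (x k)"
          using m Ac(1) xk(5) by (intro l_distr) auto
        then show ?thesis unfolding J_def using Hm(4)[OF m(3,4)] Ac(4)[OF m(1,2)] by simp
      qed
      show "r \<otimes> a \<in> J" if ra: "r \<in> A" "a \<in> J" for r a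
      proof -
        have m: "a \<in> A" "a \<otimes> inv (x k) \<in> ?H" "r \<in> ?H" using ra AH unfolding J_def by blast+
        have "(r \<otimes> a) \<otimes> inv (x k) = r \<otimes> (a \<otimes> inv (x k))"
          using m(1) ra(1) Ac(1) xk(5) by (intro m_assoc) auto
        then show ?thesis unfolding J_def using Hm(5)[OF m(3,2)] Ac(5)[OF ra(1) m(1)] by simp
      qed
    qed
    moreover have "x l \<in> J" if l: "l \<in> {1..d}" for l
    proof (cases "l = k")
      case True
      then show ?thesis unfolding J_def using xk Hm(3) by simp
    next
      case False
      then have eq: "x' l = x l \<otimes> inv (x k)" using lqt_unfolded(3)[of l] l by simp
      have "x k \<otimes> x' l = x l" 
        using x_eq[of l] False l lqt_unfolded(2) m_comm[OF xk(3) x'_mem(3)[OF l]] by simp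
      then have "x' l \<in> extended_prime K A Q"
        using xQ[of l] False l xkQ xk x'_mem(3)[OF l] by (intro extended_primeI[OF A(1) Q, of _ "x k"]) auto
      then have "x' l \<in> ?E \<inter> P" using x'_P[OF l] Pm(1) by blast
      then show ?thesis unfolding J_def using eq IH x_mem[OF l] by auto
    qed
    ultimately have "M \<subseteq> J" by (rule M_least)
    then show "y \<otimes> inv (x k) \<in> ?H" using y unfolding J_def by blast
  qed
  show ?thesis
  proof
    fix b assume b: "b \<in> ?E"
    then obtain a t where at: "a \<in> A" "t \<in> ?E \<inter> P" "b = a \<oplus> t" using \<open>B \<subseteq> ?H\<close> by blast
    have c: "a \<in> carrier K" "t \<in> carrier K" using at Ac(1) Bc(1) by auto
    have "\<ominus> \<one> \<otimes> t \<in> ?E" using Em at Bc(3,6) by blast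
    then have "b \<oplus> \<ominus> \<one> \<otimes> t \<in> ?E" using Em b by blast
    moreover have "b \<oplus> \<ominus> \<one> \<otimes> t = a" using at c by (simp add: l_minus a_assoc r_neg)
    ultimately have "a \<in> Q" using extended_prime_Int_subring[OF A(1) Q] at by blast
    then have "a \<in> P" using QM M_sub_P by blast
    then show "b \<in> P" using at Pm(3) by blast
  qed
qed

lemma A'_sub_localization: "A' \<subseteq> localization K A Q"
proof
  fix z assume "z \<in> A'"
  then obtain s where s: "s \<in> B - P" "s \<otimes> z \<in> B" "z \<in> carrier K" by (rule A'E)
  have "s \<in> localization K A Q" "s \<otimes> z \<in> localization K A Q" using s(1,2) B_sub_localization by auto
  moreover have "s \<notin> extended_prime K A Q" using s(1) extended_Int_B by blast
  ultimately show "z \<in> localization K A Q" using s(3) inv_mult_in_localization[OF A(1) Q] by metis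
qed

end

text \<open>
  The chain is first moved so that its last prime \<open>Q\<close> before \<open>M\<close> contains all variables except \<open>x k\<close>. There is
  room for this because the primes of the chain already contain the variables outside \<open>L\<close>. Then
  \<open>A'\<close> lies in the localization of \<open>A\<close> at \<open>Q\<close>, the primes up to \<open>Q\<close> extend to it and contract to \<open>A'\<close>, and
  \<open>x k\<close> separates the last of them from \<open>M'\<close>.
\<close>

lemma prime_chain_transform:
  assumes C: "prime_chain (K\<lparr>carrier := A\<rparr>) n C" "C n = M" and L: "L \<subseteq> {1..d}" "k \<in> L" "card L \<le> n"
    and xL: "\<And>l. l \<in> {1..d} - L \<Longrightarrow> x l \<in> C 0"
  shows "A' \<subseteq> localization K A (C 0)"
    and "\<exists>C'. prime_chain (K\<lparr>carrier := A'\<rparr>) n C' \<and> C' n = M' \<and> C' 0 = extended_prime K A (C 0) \<inter> A'"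
    and "x k \<notin> C 0"
proof -
  interpret NA: noetherian_cring "K\<lparr>carrier := A\<rparr>" by (rule noetherian_cring_sub[OF A(1,2)])
  have finL: "finite L" using L finite_subset by blast
  define Y where "Y = x ` (L - {k})"
  have cardY: "card Y \<le> n - 1"
    unfolding Y_def using card_image_le[of "L - {k}" x] finL L by (simp add: card_Diff_singleton)
  have n: "n \<ge> 1" using L finL by (metis card_gt_0_iff empty_iff less_le_trans less_one linorder_not_less)
  have "Y \<subseteq> C n" unfolding C(2) Y_def using L x_mem(1) by auto
  then obtain D where D: "prime_chain (K\<lparr>carrier := A\<rparr>) n D" "D 0 = C 0" "D n = M" "Y \<subseteq> D (card Y)"
  proof -
    have "finite Y" "card Y \<le> n" using cardY finL by (auto simp: Y_def)
    from NA.prime_chain_contains[OF this(1) C(1) \<open>Y \<subseteq> C n\<close> this(2)] show ?thesis using that C(2) by auto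
  qed
  define Q where "Q = D (n - 1)"
  have Dprime: "\<And>i. i \<le> n \<Longrightarrow> primeideal (D i) (K\<lparr>carrier := A\<rparr>)" using D(1) by (simp add: prime_chain_def)
  have Dstep: "\<And>i. i < n \<Longrightarrow> D i \<subset> D (Suc i)" using D(1) by (simp add: prime_chain_def)
  have Q: "primeideal Q (K\<lparr>carrier := A\<rparr>)" unfolding Q_def by (rule Dprime) simp
  have QM: "Q \<subset> M" using Dstep[of "n - 1"] n D(3) by (simp add: Q_def)
  have DQ: "D i \<subseteq> Q" if "i \<le> n - 1" for i unfolding Q_def using prime_chain_mono[OF D(1) that] by simp
  have xQ: "x l \<in> Q" if l: "l \<in> {1..d} - {k}" for l
  proof (cases "l \<in> L")
    case True
    then have "x l \<in> Y" using l by (auto simp: Y_def)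
    then show ?thesis using D(4) DQ[OF cardY] by blast
  next
    case False
    then show ?thesis using xL[of l] l D(2) DQ[of 0] by auto
  qed
  have xkQ: "x k \<notin> Q"
  proof
    assume "x k \<in> Q"
    then have "M \<subseteq> Q" using xQ by (intro M_least primeideal.axioms(1)[OF Q]) (metis DiffI singletonD)
    then show False using QM by blast
  qed
  have locQ: "A' \<subseteq> localization K A Q" using A'_sub_localization[OF Q _ xQ xkQ] QM by blast
  have loc: "A' \<subseteq> localization K A (D i)" if "i \<le> n - 1" for i
  proof -
    have "i \<le> n" using that by simp
    from extended_prime_mono(1)[OF A(1) Dprime[OF this] Q DQ[OF that]] locQ show ?thesis by (rule order_trans[rotated])
  qed
  show "A' \<subseteq> localization K A (C 0)" using loc[of 0] D(2) by simp
  show "x k \<notin> C 0" using xkQ DQ[of 0] D(2) by auto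
  define C' where "C' i = (if i < n then extended_prime K A (D i) \<inter> A' else M')" for i
  have prime: "primeideal (C' i) (K\<lparr>carrier := A'\<rparr>)" if "i \<le> n" for i
  proof (cases "i < n")
    case True
    then show ?thesis using prime_contraction[OF A(1) Dprime A'(1) loc, of i] by (simp add: C'_def)
  qed (use M'_prime in \<open>simp add: C'_def\<close>)
  have "prime_chain (K\<lparr>carrier := A'\<rparr>) n C'"
    unfolding prime_chain_def
  proof (intro conjI allI impI prime)
    fix i assume i: "i < n"
    note ext = extended_prime_Int_subring[OF A(1)]
    show "C' i \<subset> C' (Suc i)"
    proof (cases "Suc i < n")
      case True
      then have le: "i \<le> n" "Suc i \<le> n" "Suc i \<le> n - 1" by auto
      have "C' i \<subseteq> C' (Suc i)"
        using extended_prime_mono(2)[OF A(1) Dprime[OF le(1)] Dprime[OF le(2)]] Dstep[OF i] loc[OF le(3)] True i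
        by (auto simp: C'_def)
      moreover obtain a where a: "a \<in> D (Suc i)" "a \<notin> D i" using Dstep[OF i] by blast
      moreover have "a \<in> A" using a prime_sub_mem(2)[OF A(1) Dprime[OF le(2)]] by blast
      then have "a \<in> C' (Suc i)" "a \<notin> C' i"
        using a ext[OF Dprime[OF le(1)]] ext[OF Dprime[OF le(2)]] True i A_sub_A' by (auto simp: C'_def)
      ultimately show ?thesis by blast
    next
      case False
      then have "i = n - 1" "Suc i = n" using i by auto
      then have iQ: "D i = Q" "Suc i = n" unfolding Q_def by auto
      have C'i: "C' i = extended_prime K A Q \<inter> A'" and C'n: "C' (Suc i) = M'" using i iQ by (auto simp: C'_def)
      have C'm: "primeideal (C' i) (K\<lparr>carrier := A'\<rparr>)" using prime i by simp
      have "C' i \<subseteq> M'"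
      proof
        fix z assume z: "z \<in> C' i"
        then have zA: "z \<in> A'" "z \<in> carrier K" using C'i A'c(1) by auto
        have "inv z \<notin> A'" if "z \<noteq> \<zero>"
        proof
          assume "inv z \<in> A'"
          then have "inv z \<otimes> z \<in> C' i" using prime_sub_mem(6)[OF A'(1) C'm] z by blast
          then show False using prime_sub_mem(4)[OF A'(1) C'm] inv_mem(2)[OF zA(2) that] by simp
        qed
        then show "z \<in> M'" using zA by (auto simp: M'_eq)
      qed
      moreover have "x k \<in> M'" using x'_mem(1)[OF lqt_unfolded(1)] lqt_unfolded(2) by simp
      moreover have "x k \<notin> C' i" using C'i ext[OF Q] xk xkQ by blast
      ultimately show ?thesis unfolding C'n by blast
    qed
  qed
  moreover have "C' n = M'" "C' 0 = extended_prime K A (C 0) \<inter> A'" using n D(2) by (auto simp: C'_def)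
  ultimately show "\<exists>C'. prime_chain (K\<lparr>carrier := A'\<rparr>) n C' \<and> C' n = M' \<and> C' 0 = extended_prime K A (C 0) \<inter> A'"
    by blast
qed

end

lemma (in field) localization_localization:
  assumes A: "subring A R" and P: "primeideal P (R\<lparr>carrier := A\<rparr>)" and B: "subring B R" "B \<subseteq> localization R A P"
  shows "localization R B (extended_prime R A P \<inter> B) \<subseteq> localization R A P"
proof
  note Bc = subring_mem[OF B(1)]
  fix z assume "z \<in> localization R B (extended_prime R A P \<inter> B)"
  then obtain s where s: "s \<in> B - (extended_prime R A P \<inter> B)" "s \<otimes> z \<in> B" "z \<in> carrier R"
    by (rule localizationE[OF B(1) prime_contraction[OF A P B]])
  have "s \<in> localization R A P" "s \<otimes> z \<in> localization R A P" using s(1,2) B(2) by auto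
  moreover have "s \<notin> extended_prime R A P" using s(1) by blast
  ultimately show "z \<in> localization R A P" using s(3) inv_mult_in_localization[OF A P] by metis
qed

section \<open>Replacing one coordinate by the sum of all coordinates\<close>

definition sum_step :: "'i set \<Rightarrow> 'i \<Rightarrow> ('i \<Rightarrow> int) \<Rightarrow> 'i \<Rightarrow> int" where
  "sum_step D k v = v(k := sum v D)"

primrec sum_steps :: "'i set \<Rightarrow> (nat \<Rightarrow> 'i) \<Rightarrow> ('i \<Rightarrow> int) \<Rightarrow> nat \<Rightarrow> 'i \<Rightarrow> int" where
  "sum_steps D k v 0 = v"
| "sum_steps D k v (Suc n) = sum_step D (k n) (sum_steps D k v n)"

lemma sum_step_nonzero:
  assumes D: "finite D" and k: "k \<in> D" and v: "\<exists>l\<in>D. v l \<noteq> 0"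
  shows "\<exists>l\<in>D. sum_step D k v l \<noteq> 0"
proof (rule ccontr)
  assume "\<not> ?thesis"
  then have z: "sum_step D k v l = 0" if "l \<in> D" for l using that by blast
  have l: "v l = 0" if "l \<in> D" "l \<noteq> k" for l using z[OF that(1)] that by (simp add: sum_step_def)
  have "sum v D = 0" using z[OF k] by (simp add: sum_step_def)
  moreover have "sum v D = v k + sum v (D - {k})" using D k by (rule sum.remove)
  moreover have "sum v (D - {k}) = 0" using l by (intro sum.neutral) auto
  ultimately have "v k = 0" by simp
  then show False using l v by blast
qed

lemma sum_steps_nonzero:
  assumes "finite D" "\<And>n. k n \<in> D" "\<exists>l\<in>D. v l \<noteq> 0"
  shows "\<exists>l\<in>D. sum_steps D k v n l \<noteq> 0"
  by (induction n) (use assms sum_step_nonzero[OF assms(1,2)] in auto)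

context
  fixes D :: "'i set" and k :: "nat \<Rightarrow> 'i"
  assumes D: "finite D" and kD: "\<And>n. k n \<in> D" and inf: "\<And>l. l \<in> D \<Longrightarrow> infinite {n. k n = l}"
begin

lemma all_directions_used: "\<exists>N\<ge>n. \<forall>l\<in>D. \<exists>i\<ge>n. i < N \<and> k i = l"
proof -
  have "\<forall>l\<in>D. \<exists>i\<ge>n. k i = l" using inf by (auto simp: infinite_nat_iff_unbounded_le)
  then obtain f where f: "\<And>l. l \<in> D \<Longrightarrow> f l \<ge> n \<and> k (f l) = l" by metis
  have "f l < Suc (n + Max (f ` D))" if "l \<in> D" for l
    using that D by (auto simp: less_Suc_eq_le intro!: trans_le_add2 Max_ge)
  then show ?thesis using f by (intro exI[of _ "Suc (n + Max (f ` D))"]) auto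
qed

lemma sum_steps_uminus: "sum_steps D k (\<lambda>l. - v l) n = (\<lambda>l. - sum_steps D k v n l)"
  by (induction n) (auto simp: sum_step_def sum_negf)

lemma sum_step_nonneg: "k' \<in> D \<Longrightarrow> (\<forall>l\<in>D. v l \<ge> 0) \<Longrightarrow> \<forall>l\<in>D. sum_step D k' v l \<ge> 0"
  using D by (auto simp: sum_step_def sum_nonneg)

lemma sum_step_sum: "k' \<in> D \<Longrightarrow> sum (sum_step D k' v) D = sum v D + (sum v D - v k')"
  using D by (simp add: sum_step_def sum.remove[of D k'])

lemma sum_steps_nonneg: "\<forall>l\<in>D. v l \<ge> 0 \<Longrightarrow> \<forall>l\<in>D. sum_steps D k v n l \<ge> 0"
  by (induction n) (auto simp: sum_step_nonneg kD)

lemma sum_steps_eventually_pos: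
  assumes v: "\<forall>l\<in>D. v l \<ge> 0" "\<exists>l\<in>D. v l \<noteq> 0"
  shows "\<exists>N. \<forall>l\<in>D. sum_steps D k v N l > 0"
proof -
  let ?v = "sum_steps D k v"
  have s: "sum (?v n) D > 0" for n
  proof (induction n)
    case 0
    obtain l where "l \<in> D" "v l > 0" using v by force
    then show ?case using v D by (auto intro!: sum_pos2)
  next
    case (Suc n)
    have "?v n (k n) \<le> sum (?v n) D" 
      by (rule member_le_sum) (use sum_steps_nonneg[OF v(1), of n] D kD in auto)
    then show ?case using Suc by (simp add: sum_step_sum[OF kD])
  qed
  have pos: "?v m l > 0" if "i < m" "k i = l" for i m l
    using that
  proof (induction m)
    case (Suc m)
    show ?case
    proof (cases "k m = l")
      case True
      then show ?thesis using s[of m] by (simp add: sum_step_def)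
    next
      case False
      then have "i < m" using Suc.prems by (metis less_antisym)
      then show ?thesis using False Suc by (simp add: sum_step_def)
    qed
  qed simp
  obtain N where "\<forall>l\<in>D. \<exists>i\<ge>0. i < N \<and> k i = l" using all_directions_used[of 0] by blast
  then have "\<forall>l\<in>D. ?v N l > 0" using pos by metis
  then show ?thesis ..
qed

text \<open>
  The hypothesis says that the complementary sums \<open>y l = \<Sum>v - v l\<close> are nonnegative. A step keeps \<open>y k\<close> and adds
  it to all other \<open>y l\<close>, so they stay nonnegative, and so does the total sum, because
  \<open>\<Sum>y = (card D - 1) \<Sum>v\<close>. Each coordinate is eventually replaced by a total sum.
\<close>

lemma sum_steps_eventually_nonneg_of_complements:
  assumes D2: "card D \<ge> 2"
    and y: "\<forall>l\<in>D. sum_steps D k v n l \<le> sum (sum_steps D k v n) D"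
  shows "\<exists>N. \<forall>l\<in>D. sum_steps D k v N l \<ge> 0"
proof -
  let ?v = "sum_steps D k v" and ?s = "\<lambda>n. sum (sum_steps D k v n) D"
  have y': "\<forall>l\<in>D. ?v m l \<le> ?s m" if "n \<le> m" for m
    using that
  proof (induction m rule: dec_induct)
    case (step m)
    have "?v m (k m) \<le> ?s m" using step kD by blast
    moreover have "?s (Suc m) = ?s m + (?s m - ?v m (k m))" by (simp add: sum_step_sum[OF kD])
    ultimately show ?case using step.IH by (fastforce simp: sum_step_def)
  qed (use y in auto)
  have s: "?s m \<ge> 0" if "n \<le> m" for m
  proof -
    have "?s m \<le> (\<Sum>l\<in>D. ?s m)" by (rule sum_mono) (use y'[OF that] in auto)
    then have "0 \<le> (int (card D) - 1) * ?s m" by (simp add: algebra_simps)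
    then show ?thesis using D2 by (auto simp: zero_le_mult_iff)
  qed
  have nn: "?v m l \<ge> 0" if "n \<le> i" "i < m" "k i = l" for i m l
    using that
  proof (induction m)
    case (Suc m)
    show ?case
    proof (cases "k m = l")
      case True
      then show ?thesis using s[of m] Suc.prems by (simp add: sum_step_def)
    next
      case False
      then have "i < m" using Suc.prems by (metis less_antisym)
      then show ?thesis using False Suc by (simp add: sum_step_def)
    qed
  qed simp
  obtain N where "\<forall>l\<in>D. \<exists>i\<ge>n. i < N \<and> k i = l" using all_directions_used[of n] by blast
  then have "\<forall>l\<in>D. ?v N l \<ge> 0" using nn by metis
  then show ?thesis ..
qed

text \<open>
  Suppose the complementary sums \<open>y\<close> had entries of both signs forever. A step adds \<open>y k\<close> to all entries
  except \<open>y k\<close> itself. As the maximum \<open>M\<close> is positive and the minimum \<open>m\<close> negative, the new entries lie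
  between \<open>m + y k\<close> and \<open>M + y k\<close>, so the difference \<open>M - m\<close> does not grow and is finally constant. From
  then on both bounds are attained, which means that the set \<open>A\<close> of indices of maximal entries loses
  \<open>k\<close> and gains nothing. Once every direction has been used, no maximal entry is left.
\<close>

lemma sum_steps_eventually_signed:
  assumes D2: "card D \<ge> 2"
  shows "\<exists>N. (\<forall>l\<in>D. sum_steps D k v N l \<ge> 0) \<or> (\<forall>l\<in>D. sum_steps D k v N l \<le> 0)"
proof (rule ccontr)
  assume no: "\<not> ?thesis"
  let ?v = "sum_steps D k v"
  define y where "y n l = sum (?v n) D - ?v n l" for n l
  have ne: "D \<noteq> {}" using D2 by auto
  have neg: "\<exists>l\<in>D. y n l < 0" for n
    using sum_steps_eventually_nonneg_of_complements[OF D2, of v n] no by (force simp: y_def)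
  have pos: "\<exists>l\<in>D. y n l > 0" for n
    using sum_steps_eventually_nonneg_of_complements[OF D2, of "\<lambda>l. - v l" n] no
    unfolding sum_steps_uminus by (force simp: y_def sum_negf)
  have step: "y (Suc n) l = (if l = k n then y n l else y n l + y n (k n))" for n l
    using sum_step_sum[OF kD, of n "?v n"] by (auto simp: y_def sum_step_def)
  define M m where "M n = Max (y n ` D)" and "m n = Min (y n ` D)" for n
  define A where "A n = {l \<in> D. y n l = M n}" for n
  have fin: "finite (y n ` D)" "y n ` D \<noteq> {}" for n using D ne by auto
  have bounds: "m n \<le> y n l" "y n l \<le> M n" if "l \<in> D" for n l
    using that fin by (auto simp: M_def m_def)
  have Mm: "0 < M n" "m n < 0" for n
    using pos[of n] neg[of n] bounds[of _ n] by fastforce+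
  \<comment> \<open>The bounds hold for the unshifted entry \<open>y k\<close> as well since \<open>m < 0 < M\<close>.\<close>
  have lower: "m n + y n (k n) \<le> m (Suc n)" for n
    using Min_in[OF fin[of "Suc n"]] bounds[of _ n] Mm(2)[of n] step[of n] unfolding m_def[of "Suc n"]
    by (auto split: if_splits)
  have upper: "M (Suc n) \<le> M n + y n (k n)" for n
    using Max_in[OF fin[of "Suc n"]] bounds[of _ n] Mm(1)[of n] step[of n] unfolding M_def[of "Suc n"]
    by (auto split: if_splits)
  have A_step: "A (Suc n) = A n - {k n}" if "M (Suc n) - m (Suc n) \<ge> M n - m n" for n
  proof -
    have "M (Suc n) = M n + y n (k n)" using that lower[of n] upper[of n] by linarith
    then show ?thesis using Mm(1)[of n] step[of n] by (auto simp: A_def)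
  qed
  define r where "r n = nat (M n - m n)" for n
  define N where "N = (ARG_MIN r n. True)"
  have "r N \<le> r n" for n unfolding N_def by (rule arg_min_nat_le) simp
  moreover have "r (Suc n) \<le> r n" for n unfolding r_def using lower[of n] upper[of n] by auto
  ultimately have r: "r n = r N" if "n \<ge> N" for n
    using that by (metis lift_Suc_antimono_le le_antisym)
  have A: "A n \<subseteq> D - k ` {N..<n}" if "n \<ge> N" for n
    using that
  proof (induction n rule: dec_induct)
    case base
    then show ?case by (auto simp: A_def)
  next
    case (step n)
    have "r (Suc n) = r n" using r[of n] r[of "Suc n"] step by simp
    then have "A (Suc n) = A n - {k n}"
      using A_step[of n] Mm[of n] Mm[of "Suc n"] by (auto simp: r_def)
    then show ?case using step by (simp add: atLeastLessThanSuc) blast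
  qed
  obtain N' where N': "N' \<ge> N" "\<forall>l\<in>D. \<exists>i\<ge>N. i < N' \<and> k i = l" using all_directions_used[of N] by blast
  have "A N' = {}" 
  proof -
    have "D \<subseteq> k ` {N..<N'}" using N'(2) by force
    then show ?thesis using A[OF N'(1)] by blast
  qed
  moreover have "A N' \<noteq> {}" using Max_in[OF fin[of N']] by (auto simp: A_def M_def)
  ultimately show False by simp
qed

end

section \<open>Monomial sequences\<close>

text \<open>
  Laurent monomials: the exponents are integers, and \<open>G\<close> will be the group of units of the field.
\<close>

definition monomial :: "('a, 'b) monoid_scheme \<Rightarrow> 'i set \<Rightarrow> ('i \<Rightarrow> 'a) \<Rightarrow> ('i \<Rightarrow> int) \<Rightarrow> 'a" where
  "monomial G D x v = finprod G (\<lambda>l. x l [^]\<^bsub>G\<^esub> v l) D"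

context comm_group
begin

context
  fixes D :: "'i set" and x :: "'i \<Rightarrow> 'a"
  assumes D: "finite D" and x: "\<And>l. l \<in> D \<Longrightarrow> x l \<in> carrier G"
begin

lemma pow_Pi: "(\<lambda>l. x l [^] (v l :: int)) \<in> D \<rightarrow> carrier G"
  using x by auto

lemma monomial_closed [simp]: "monomial G D x v \<in> carrier G"
  unfolding monomial_def by (rule finprod_closed[OF pow_Pi])

lemma monomial_cong: "(\<And>l. l \<in> D \<Longrightarrow> v l = w l) \<Longrightarrow> monomial G D x v = monomial G D x w"
  unfolding monomial_def by (rule finprod_cong') (use pow_Pi in auto)

lemma monomial_zero: "monomial G D x (\<lambda>_. 0) = \<one>"
  unfolding monomial_def by (rule finprod_one_eqI) simp

lemma monomial_add: "monomial G D x (\<lambda>l. v l + w l) = monomial G D x v \<otimes> monomial G D x w"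
proof -
  have "monomial G D x (\<lambda>l. v l + w l) = finprod G (\<lambda>l. x l [^] v l \<otimes> x l [^] w l) D"
    unfolding monomial_def by (rule finprod_cong') (use x in \<open>auto simp: int_pow_mult\<close>)
  also have "\<dots> = monomial G D x v \<otimes> monomial G D x w"
    unfolding monomial_def by (rule finprod_multf[OF pow_Pi pow_Pi])
  finally show ?thesis .
qed

lemma monomial_single:
  assumes j: "j \<in> D"
  shows "monomial G D x (\<lambda>l. if l = j then c else 0) = x j [^] c"
proof -
  have "monomial G D x (\<lambda>l. if l = j then c else 0) = finprod G (\<lambda>l. if j = l then x l [^] c else \<one>) D"
    unfolding monomial_def by (rule finprod_cong') (use x in auto)
  also have "\<dots> = x j [^] c"
    using finprod_singleton[OF j D, of "\<lambda>l. x l [^] c"] x by auto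
  finally show ?thesis .
qed

end

lemma finprod_int_pow_const:
  assumes "finite D" "a \<in> carrier G"
  shows "finprod G (\<lambda>l. a [^] (w l :: int)) D = a [^] sum w D"
  using assms(1)
proof (induction D)
  case empty
  then show ?case by simp
next
  case (insert l D)
  have "finprod G (\<lambda>l. a [^] w l) (insert l D) = a [^] w l \<otimes> finprod G (\<lambda>l. a [^] w l) D"
    by (rule finprod_insert) (use insert assms(2) in auto)
  then show ?case using insert assms(2) by (simp add: int_pow_mult)
qed

text \<open>
  Substituting \<open>x l = y l y k\<close> for \<open>l \<noteq> k\<close> collects the exponents of all variables at \<open>y k\<close>.
\<close>

lemma monomial_sum_step:
  assumes D: "finite D" and y: "\<And>l. l \<in> D \<Longrightarrow> y l \<in> carrier G" and k: "k \<in> D"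
    and xk: "x k = y k" and xl: "\<And>l. l \<in> D - {k} \<Longrightarrow> x l = y l \<otimes> y k"
  shows "monomial G D x v = monomial G D y (sum_step D k v)"
proof -
  define w where "w l = (if l = k then 0 else v l)" for l
  have yk: "y k \<in> carrier G" by (rule y[OF k])
  have "sum w D = sum v (D - {k})" using D k by (simp add: w_def sum.remove[of D k])
  also have "\<dots> = sum v D - v k" using D k by (simp add: sum.remove[of D k])
  finally have sw: "sum w D = sum v D - v k" .
  have eq: "x l [^] v l = y l [^] v l \<otimes> y k [^] w l" if "l \<in> D" for l
    using that y[OF that] yk xk xl[of l] by (cases "l = k") (auto simp: w_def int_pow_distrib)
  have "monomial G D x v = finprod G (\<lambda>l. y l [^] v l \<otimes> y k [^] w l) D"
    unfolding monomial_def by (rule finprod_cong') (use y yk eq in auto)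
  also have "\<dots> = monomial G D y v \<otimes> y k [^] (sum v D - v k)"
    unfolding monomial_def sw[symmetric] finprod_int_pow_const[OF D yk, symmetric]
    by (rule finprod_multf) (use y yk in auto)
  also have "\<dots> = monomial G D y (\<lambda>l. v l + (if l = k then sum v D - v k else 0))"
    using monomial_add[OF D y] monomial_single[OF D y k] by simp
  also have "(\<lambda>l. v l + (if l = k then sum v D - v k else 0)) = sum_step D k v"
    by (auto simp: sum_step_def)
  finally show ?thesis .
qed

end

locale monomial_sequence = field K for K (structure) +
  fixes d :: nat and R :: "nat \<Rightarrow> 'a set" and x :: "nat \<Rightarrow> nat \<Rightarrow> 'a" and k :: "nat \<Rightarrow> nat"
  assumes d: "d \<ge> 2"
    and sub: "\<And>i. subring (R i) K"
    and noeth: "\<And>i. noetherian_ring (K\<lparr>carrier := R i\<rparr>)" and loc: "\<And>i. local_ring (K\<lparr>carrier := R i\<rparr>)"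
    and x0: "x 0 ` {1..d} \<subseteq> R 0" and x0_nz: "\<And>l. l \<in> {1..d} \<Longrightarrow> x 0 l \<noteq> \<zero>"
    and max0: "max_ideal (K\<lparr>carrier := R 0\<rparr>) = Idl\<^bsub>K\<lparr>carrier := R 0\<rparr>\<^esub> (x 0 ` {1..d})"
    and lqt: "\<And>i. monomial_lqt K d (k i) (R i) (x i) (R (Suc i)) (x (Suc i))"
begin

text \<open>
  The variables of each \<open>R i\<close> are nonzero and generate its maximal ideal; a transform passes these
  properties on.
\<close>

lemma transform: "monomial_transform K (R i) (R (Suc i)) d (k i) (x i) (x (Suc i))"
proof (induction i)
  case 0
  show ?case by (intro monomial_transform.intro monomial_transform_axioms.intro field_axioms) (rule sub noeth loc x0 max0 lqt | erule x0_nz)+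
next
  case (Suc i)
  interpret T: monomial_transform K "R i" "R (Suc i)" d "k i" "x i" "x (Suc i)" by (rule Suc)
  have img: "x (Suc i) ` {1..d} \<subseteq> R (Suc i)" using T.x'_mem(2) by blast
  show ?case
    by (intro monomial_transform.intro monomial_transform_axioms.intro field_axioms) (rule sub noeth loc img T.M'_eq_Idl[unfolded T.M'_def] lqt | erule T.x'_nz)+
qed

definition M where "M i = max_ideal (K\<lparr>carrier := R i\<rparr>)"
definition S where "S = (\<Union>i. R i)"
definition MS where "MS = (\<Union>i. M i)"

lemma M_eq: "M i = {a \<in> R i. a = \<zero> \<or> inv a \<notin> R i}" and M_prime: "primeideal (M i) (K\<lparr>carrier := R i\<rparr>)"
  unfolding M_def using max_ideal_sub[OF sub noeth loc] by auto

lemmas Rm = subring_mem[OF sub] and Mm = prime_sub_mem[OF sub M_prime]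

lemma x_mem: assumes "l \<in> {1..d}"
  shows "x i l \<in> M i" "x i l \<in> R i" "x i l \<in> carrier K" "x i l \<noteq> \<zero>"
proof -
  interpret T: monomial_transform K "R i" "R (Suc i)" d "k i" "x i" "x (Suc i)" by (rule transform)
  show "x i l \<in> M i" "x i l \<in> R i" "x i l \<in> carrier K" "x i l \<noteq> \<zero>"
    using T.x_mem[OF assms] unfolding M_def T.M_def by blast+
qed

lemma k_mem: "k i \<in> {1..d}"
  and x_Suc: "x (Suc i) (k i) = x i (k i)" "l \<in> {1..d} - {k i} \<Longrightarrow> x i l = x (Suc i) l \<otimes> x (Suc i) (k i)"
  and R_Suc: "R i \<subseteq> R (Suc i)" and M_Suc: "M (Suc i) \<inter> R i = M i"
proof -
  interpret T: monomial_transform K "R i" "R (Suc i)" d "k i" "x i" "x (Suc i)" by (rule transform)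
  show "k i \<in> {1..d}" "x (Suc i) (k i) = x i (k i)"
    "l \<in> {1..d} - {k i} \<Longrightarrow> x i l = x (Suc i) l \<otimes> x (Suc i) (k i)" "R i \<subseteq> R (Suc i)" "M (Suc i) \<inter> R i = M i"
    using T.lqt_unfolded(1,2) T.x_eq T.A_sub_A' T.M'_Int_A unfolding M_def T.M_def T.M'_def by blast+
qed

lemma M_least: "ideal I (K\<lparr>carrier := R i\<rparr>) \<Longrightarrow> (\<And>l. l \<in> {1..d} \<Longrightarrow> x i l \<in> I) \<Longrightarrow> M i \<subseteq> I"
proof -
  interpret T: monomial_transform K "R i" "R (Suc i)" d "k i" "x i" "x (Suc i)" by (rule transform)
  show "ideal I (K\<lparr>carrier := R i\<rparr>) \<Longrightarrow> (\<And>l. l \<in> {1..d} \<Longrightarrow> x i l \<in> I) \<Longrightarrow> M i \<subseteq> I"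
    using T.M_least by (simp add: M_def T.M_def)
qed

lemma R_mono: "i \<le> j \<Longrightarrow> R i \<subseteq> R j"
  by (rule lift_Suc_mono_le[of R]) (rule R_Suc)

lemma M_mono: "i \<le> j \<Longrightarrow> M i \<subseteq> M j"
  by (rule lift_Suc_mono_le[of M]) (use M_Suc in blast)

lemma M_Int: "i \<le> j \<Longrightarrow> M j \<inter> R i = M i"
proof (induction j rule: dec_induct)
  case base
  then show ?case using Mm(2) by blast
next
  case (step j)
  then show ?case using M_Suc[of j] R_mono[of i j] by blast
qed

lemma MS_Int: "MS \<inter> R i = M i"
proof
  show "M i \<subseteq> MS \<inter> R i" using Mm(2) by (auto simp: MS_def)
  show "MS \<inter> R i \<subseteq> M i"
  proof
    fix a assume "a \<in> MS \<inter> R i"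
    then obtain j where a: "a \<in> M j" "a \<in> R i" by (auto simp: MS_def)
    have "a \<in> M (max i j)" using a M_mono[of j "max i j"] by auto
    then show "a \<in> M i" using M_Int[of i "max i j"] a by auto
  qed
qed

lemma S_common:
  assumes "a \<in> S" "b \<in> S" obtains i where "a \<in> R i" "b \<in> R i"
proof -
  obtain i j where "a \<in> R i" "b \<in> R j" using assms by (auto simp: S_def)
  then have "a \<in> R (max i j)" "b \<in> R (max i j)" using R_mono[of i "max i j"] R_mono[of j "max i j"] by auto
  then show ?thesis by (rule that)
qed

lemma R_sub_S: "R i \<subseteq> S" by (auto simp: S_def)

lemma S_subring: "subring S K"
proof (rule subringI)
  show "S \<subseteq> carrier K" using Rm(1) by (auto simp: S_def)
  show "\<one> \<in> S" using Rm(3)[of 0] by (auto simp: S_def)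
  show "\<ominus> h \<in> S" if "h \<in> S" for h using that Rm(6) by (auto simp: S_def)
  show "a \<oplus> b \<in> S" if "a \<in> S" "b \<in> S" for a b
    by (rule S_common[OF that]) (use Rm(4) R_sub_S in blast)
  show "a \<otimes> b \<in> S" if "a \<in> S" "b \<in> S" for a b
    by (rule S_common[OF that]) (use Rm(5) R_sub_S in blast)
qed

lemmas Sm = subring_mem[OF S_subring]

lemma MS_sub_S: "MS \<subseteq> S" using Mm(2) by (auto simp: MS_def S_def)

lemma MS_add: assumes "a \<in> MS" "b \<in> MS" shows "a \<oplus> b \<in> MS"
proof -
  obtain i where "a \<in> R i" "b \<in> R i" by (rule S_common[OF subsetD[OF MS_sub_S assms(1)] subsetD[OF MS_sub_S assms(2)]])
  then have "a \<in> M i" "b \<in> M i" using MS_Int[of i] assms by blast+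
  then show ?thesis using Mm(5)[of a i b] unfolding MS_def by blast
qed

lemma MS_mult: assumes "r \<in> S" "a \<in> MS" shows "r \<otimes> a \<in> MS"
proof -
  obtain i where "r \<in> R i" "a \<in> R i" by (rule S_common[OF assms(1) subsetD[OF MS_sub_S assms(2)]])
  then have "r \<in> R i" "a \<in> M i" using MS_Int[of i] assms by blast+
  then show ?thesis using Mm(6)[of r i a] unfolding MS_def by blast
qed

lemma zero_MS: "\<zero> \<in> MS" using Mm(3)[of 0] by (auto simp: MS_def)

lemma one_notin_MS: "\<one> \<notin> MS" using Mm(4) by (auto simp: MS_def)

lemma MS_ideal: "ideal MS (K\<lparr>carrier := S\<rparr>)"
  unfolding ideal_sub_iff[OF S_subring] using MS_sub_S zero_MS MS_add MS_mult by blast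

lemma unit_S: assumes "e \<in> S" "e \<notin> MS" shows "e \<noteq> \<zero>" "inv e \<in> S" "e \<in> carrier K"
proof -
  obtain i where i: "e \<in> R i" using assms(1) by (auto simp: S_def)
  then have "e \<notin> M i" using assms(2) by (auto simp: MS_def)
  then have "e \<noteq> \<zero>" "inv e \<in> R i" using i by (auto simp: M_eq)
  then show "e \<noteq> \<zero>" "inv e \<in> S" using R_sub_S by auto
  show "e \<in> carrier K" using assms(1) Sm(1) by auto
qed

lemma MS_not_inverse: "a \<in> MS \<Longrightarrow> b \<in> S \<Longrightarrow> b \<otimes> a \<noteq> \<one>"
  using MS_mult one_notin_MS by metis

lemma MS_eq: "MS = {a \<in> S. a = \<zero> \<or> inv a \<notin> S}"
proof (rule equalityI; rule subsetI)
  fix a assume a: "a \<in> MS"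
  then have aS: "a \<in> S" "a \<in> carrier K" using MS_sub_S Sm(1) by auto
  have "inv a \<notin> S" if "a \<noteq> \<zero>" using MS_not_inverse[OF a, of "inv a"] inv_mem(2)[OF aS(2) that] by blast
  then show "a \<in> {a \<in> S. a = \<zero> \<or> inv a \<notin> S}" using aS by blast
next
  fix a assume "a \<in> {a \<in> S. a = \<zero> \<or> inv a \<notin> S}"
  then show "a \<in> MS" using unit_S[of a] by blast
qed

section \<open>Monomials\<close>

definition mon :: "nat \<Rightarrow> (nat \<Rightarrow> int) \<Rightarrow> 'a" where
  "mon i v = monomial (units_of K) {1..d} (x i) v"

lemma x_unit: "l \<in> {1..d} \<Longrightarrow> x i l \<in> carrier (units_of K)"
  using x_mem[of l i] by (simp add: units_of_carrier field_Units)

lemma mon_closed: "mon i v \<in> carrier K" "mon i v \<noteq> \<zero>"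
proof -
  interpret U: comm_group "units_of K" by (rule units_comm_group)
  have "mon i v \<in> carrier (units_of K)" unfolding mon_def by (rule U.monomial_closed) (use x_unit in auto)
  then show "mon i v \<in> carrier K" "mon i v \<noteq> \<zero>" by (auto simp: units_of_carrier field_Units)
qed

lemma mon_cong: "(\<And>l. l \<in> {1..d} \<Longrightarrow> v l = w l) \<Longrightarrow> mon i v = mon i w"
proof -
  interpret U: comm_group "units_of K" by (rule units_comm_group)
  show "(\<And>l. l \<in> {1..d} \<Longrightarrow> v l = w l) \<Longrightarrow> mon i v = mon i w"
    unfolding mon_def by (rule U.monomial_cong) (use x_unit in auto)
qed

lemma mon_zero: "mon i (\<lambda>_. 0) = \<one>"
  and mon_add: "mon i (\<lambda>l. v l + w l) = mon i v \<otimes> mon i w"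
  and mon_single: "j \<in> {1..d} \<Longrightarrow> mon i (\<lambda>l. if l = j then int n else 0) = x i j [^] n"
  and mon_step: "mon i v = mon (Suc i) (sum_step {1..d} (k i) v)"
proof -
  interpret U: comm_group "units_of K" by (rule units_comm_group)
  show "mon i (\<lambda>_. 0) = \<one>"
    unfolding mon_def using U.monomial_zero[of "{1..d}" "x i"] x_unit by (simp add: units_of_one)
  show "mon i (\<lambda>l. v l + w l) = mon i v \<otimes> mon i w"
    unfolding mon_def using U.monomial_add[of "{1..d}" "x i"] x_unit by (simp add: units_of_mult)
  show "mon i (\<lambda>l. if l = j then int n else 0) = x i j [^] n" if "j \<in> {1..d}"
    unfolding mon_def using U.monomial_single[of "{1..d}" "x i" j "int n"] x_unit that
    by (simp add: units_of_mult int_pow_int) (simp add: nat_pow_def units_of_def)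
  show "mon i v = mon (Suc i) (sum_step {1..d} (k i) v)"
    unfolding mon_def by (rule U.monomial_sum_step) (use x_unit k_mem x_Suc in \<open>auto simp: units_of_mult\<close>)
qed

lemma mon_uminus: "mon i (\<lambda>l. - v l) = inv (mon i v)"
proof -
  have "mon i (\<lambda>l. - v l) \<otimes> mon i v = \<one>" using mon_add[of i "\<lambda>l. - v l" v] mon_zero by simp
  moreover have "mon i v \<otimes> mon i (\<lambda>l. - v l) = \<one>" using mon_add[of i v "\<lambda>l. - v l"] mon_zero by simp
  ultimately show ?thesis using comm_inv_char mon_closed(1) by metis
qed

lemma mon_diff: "mon i (\<lambda>l. v l - w l) = mon i v \<otimes> inv (mon i w)"
  using mon_add[of i v "\<lambda>l. - w l"] mon_uminus[of i w] by simp

lemma mon_var: "j \<in> {1..d} \<Longrightarrow> mon i (\<lambda>l. if l = j then 1 else 0) = x i j"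
  using mon_single[of j i 1] x_mem[of j i] mon_cong[of "\<lambda>l. if l = j then 1 else 0" "\<lambda>l. if l = j then int 1 else 0" i]
  by simp

lemma mon_pow: "mon i (\<lambda>l. int m * v l) = mon i v [^] m"
proof (induction m)
  case (Suc m)
  have "mon i (\<lambda>l. int (Suc m) * v l) = mon i (\<lambda>l. int m * v l + v l)"
    by (rule mon_cong) (simp add: algebra_simps)
  then show ?case using Suc mon_add[of i "\<lambda>l. int m * v l" v] by simp
qed (simp add: mon_zero)

lemma mon_steps: "mon i v = mon (i + n) (sum_steps {1..d} (\<lambda>j. k (i + j)) v n)"
proof (induction n)
  case 0
  show ?case unfolding sum_steps.simps add_0_right by (rule refl)
next
  case (Suc n)
  have "mon (i + n) (sum_steps {1..d} (\<lambda>j. k (i + j)) v n) =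
      mon (i + Suc n) (sum_steps {1..d} (\<lambda>j. k (i + j)) v (Suc n))"
    unfolding sum_steps.simps add_Suc_right by (rule mon_step)
  with Suc.IH show ?case by (rule trans)
qed

lemma mon_nonneg:
  assumes "\<forall>l\<in>{1..d}. v l \<ge> 0"
  shows "mon i v \<in> R i"
proof -
  interpret U: comm_group "units_of K" by (rule units_comm_group)
  have pow: "x i l [^]\<^bsub>units_of K\<^esub> v l \<in> R i" if l: "l \<in> {1..d}" for l
  proof -
    have "v l = int (nat (v l))" using assms l by simp
    then have "x i l [^]\<^bsub>units_of K\<^esub> v l = x i l [^]\<^bsub>units_of K\<^esub> nat (v l)" by (metis int_pow_int)
    also have "\<dots> = x i l [^] nat (v l)" by (simp add: nat_pow_def units_of_def)
    also have "x i l [^] n \<in> R i" for n :: nat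
    proof (induction n)
      case 0
      show ?case using Rm(3) by simp
    next
      case (Suc n)
      show ?case using Rm(5)[OF Suc.IH x_mem(2)[OF l]] by simp
    qed
    finally show ?thesis .
  qed
  have "finprod (units_of K) (\<lambda>l. x i l [^]\<^bsub>units_of K\<^esub> v l) F \<in> R i" if "finite F" "F \<subseteq> {1..d}" for F
    using that
  proof (induction F)
    case empty
    then show ?case using Rm(3) by (simp add: units_of_one)
  next
    case (insert l F)
    have "finprod (units_of K) (\<lambda>l. x i l [^]\<^bsub>units_of K\<^esub> v l) (insert l F) =
        x i l [^]\<^bsub>units_of K\<^esub> v l \<otimes> finprod (units_of K) (\<lambda>l. x i l [^]\<^bsub>units_of K\<^esub> v l) F"
    proof -
      have "(\<lambda>l. x i l [^]\<^bsub>units_of K\<^esub> v l) \<in> F \<rightarrow> carrier (units_of K)"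
        "x i l [^]\<^bsub>units_of K\<^esub> v l \<in> carrier (units_of K)"
        using insert.prems x_unit by blast+
      then show ?thesis using U.finprod_insert[OF insert.hyps] by (simp only: units_of_mult)
    qed
    moreover have "l \<in> {1..d}" "F \<subseteq> {1..d}" using insert.prems by auto
    ultimately show ?case using Rm(5)[OF pow insert.IH] by simp
  qed
  then show ?thesis by (simp add: mon_def monomial_def)
qed

lemma mon_pos:
  assumes v: "\<forall>l\<in>{1..d}. v l \<ge> 0" and j: "j \<in> {1..d}" "v j > 0"
  shows "mon i v \<in> M i"
proof -
  define w where "w l = v l - (if l = j then 1 else 0)" for l
  have "mon i v = mon i (\<lambda>l. w l + (if l = j then 1 else 0))" by (rule mon_cong) (simp add: w_def)
  also have "\<dots> = mon i w \<otimes> x i j" using mon_add[of i w] mon_var[OF j(1)] by simp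
  also have "\<dots> \<in> M i"
    by (rule Mm(6)[OF mon_nonneg x_mem(1)[OF j(1)]]) (use v j in \<open>auto simp: w_def\<close>)
  finally show ?thesis .
qed

end

section \<open>Elements as units times monomials\<close>

context monomial_sequence
begin

context
  assumes inf: "\<And>l. l \<in> {1..d} \<Longrightarrow> infinite {i. k i = l}"
begin

lemma infinite_shifted: assumes "l \<in> {1..d}" shows "infinite {n. k (i + n) = l}"
proof
  assume fin: "finite {n. k (i + n) = l}"
  have "{m. k m = l} \<subseteq> {..<i} \<union> (\<lambda>n. i + n) ` {n. k (i + n) = l}"
  proof
    fix m assume "m \<in> {m. k m = l}"
    then show "m \<in> {..<i} \<union> (\<lambda>n. i + n) ` {n. k (i + n) = l}"
      by (cases "m < i") (auto intro!: image_eqI[of _ _ "m - i"])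
  qed
  then show False using fin inf[OF assms] finite_subset by blast
qed

lemma mon_total:
  assumes v: "\<exists>l\<in>{1..d}. v l \<noteq> 0"
  shows "mon i v \<in> MS \<or> inv (mon i v) \<in> MS"
proof -
  let ?w = "sum_steps {1..d} (\<lambda>j. k (i + j)) v"
  obtain N where N: "(\<forall>l\<in>{1..d}. ?w N l \<ge> 0) \<or> (\<forall>l\<in>{1..d}. ?w N l \<le> 0)"
    using sum_steps_eventually_signed[of "{1..d}" "\<lambda>j. k (i + j)" v] k_mem infinite_shifted d by auto
  obtain l where l: "l \<in> {1..d}" "?w N l \<noteq> 0"
    using sum_steps_nonzero[of "{1..d}" "\<lambda>j. k (i + j)" v N] k_mem v by auto
  have eq: "mon i v = mon (i + N) (?w N)" by (rule mon_steps)
  from N show ?thesis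
  proof
    assume "\<forall>l\<in>{1..d}. ?w N l \<ge> 0"
    then have "mon (i + N) (?w N) \<in> M (i + N)" using l by (intro mon_pos[of _ l]) (auto simp: less_le)
    then show ?thesis using eq by (auto simp: MS_def)
  next
    assume "\<forall>l\<in>{1..d}. ?w N l \<le> 0"
    then have "mon (i + N) (\<lambda>l. - ?w N l) \<in> M (i + N)" using l by (intro mon_pos[of _ l]) (auto simp: less_le)
    then show ?thesis using eq mon_uminus by (auto simp: MS_def)
  qed
qed

lemma mon_archimedean:
  assumes u: "\<forall>l\<in>{1..d}. u l \<ge> 0" "\<exists>l\<in>{1..d}. u l \<noteq> 0"
  shows "\<exists>m::nat. mon i u [^] m \<otimes> mon i v \<in> S"
proof -
  let ?w = "sum_steps {1..d} (\<lambda>j. k (i + j))"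
  obtain N where N: "\<forall>l\<in>{1..d}. ?w u N l > 0"
    using sum_steps_eventually_pos[of "{1..d}" "\<lambda>j. k (i + j)" u] k_mem infinite_shifted u by auto
  define m where "m = nat (\<Sum>l\<in>{1..d}. \<bar>?w v N l\<bar>)"
  have "mon i u [^] m \<otimes> mon i v = mon (i + N) (\<lambda>l. int m * ?w u N l + ?w v N l)"
    unfolding mon_steps[of i u N] mon_steps[of i v N] mon_add mon_pow ..
  also have "\<dots> \<in> R (i + N)"
  proof (rule mon_nonneg, rule ballI)
    fix l assume l: "l \<in> {1..d}"
    have "\<bar>?w v N l\<bar> \<le> (\<Sum>l\<in>{1..d}. \<bar>?w v N l\<bar>)" using l by (intro member_le_sum) auto
    then have "- ?w v N l \<le> int m" by (simp add: m_def)
    moreover have "?w u N l > 0" using N l by blast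
    then have "int m * 1 \<le> int m * ?w u N l" by (intro mult_left_mono) simp_all
    ultimately show "0 \<le> int m * ?w u N l + ?w v N l" by simp
  qed
  finally show ?thesis using R_sub_S by blast
qed

text \<open>
  The order of the value group, restricted to monomials: \<open>w / u\<close> lies in the maximal ideal of \<open>S\<close>.
\<close>

definition prec :: "'a \<Rightarrow> 'a \<Rightarrow> bool" where
  "prec u w \<longleftrightarrow> w \<otimes> inv u \<in> MS"

definition Mons :: "nat \<Rightarrow> 'a set" where
  "Mons i = {mon i v | v. \<forall>l\<in>{1..d}. v l \<ge> 0}"

lemma Mons_mem: "u \<in> Mons i \<Longrightarrow> u \<in> R i" "u \<in> Mons i \<Longrightarrow> u \<in> carrier K" "u \<in> Mons i \<Longrightarrow> u \<noteq> \<zero>"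
  using mon_nonneg mon_closed by (auto simp: Mons_def)

lemma mult_inv_cancel:
  assumes "u \<in> carrier K" "v \<in> carrier K" "w \<in> carrier K" "v \<noteq> \<zero>"
  shows "(w \<otimes> inv v) \<otimes> (v \<otimes> u) = w \<otimes> u"
proof -
  have "(w \<otimes> inv v) \<otimes> (v \<otimes> u) = w \<otimes> ((inv v \<otimes> v) \<otimes> u)"
    using assms inv_mem(1)[of v] by (simp add: m_assoc)
  then show ?thesis using assms inv_mem(2)[of v] by simp
qed

lemma prec_trans:
  assumes "u \<in> Mons i" "v \<in> Mons i" "w \<in> Mons i" "prec u v" "prec v w"
  shows "prec u w"
proof -
  have "(w \<otimes> inv v) \<otimes> (v \<otimes> inv u) = w \<otimes> inv u"
    using Mons_mem[OF assms(1)] Mons_mem[OF assms(2)] Mons_mem[OF assms(3)] inv_mem(1)[of u]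
    by (intro mult_inv_cancel) auto
  then show ?thesis using assms(4,5) MS_mult MS_sub_S unfolding prec_def by (metis subsetD)
qed

lemma prec_not_le:
  assumes "u \<in> carrier K" "w \<in> carrier K" "u \<noteq> \<zero>" "w \<noteq> \<zero>" "prec u w"
  shows "u \<otimes> inv w \<notin> S"
proof
  assume "u \<otimes> inv w \<in> S"
  moreover have "(u \<otimes> inv w) \<otimes> (w \<otimes> inv u) = u \<otimes> inv u"
    using assms inv_mem(1)[of u] by (intro mult_inv_cancel) auto
  then have "(u \<otimes> inv w) \<otimes> (w \<otimes> inv u) = \<one>" using inv_mem(3)[of u] assms by simp
  ultimately show False using MS_not_inverse assms(5) unfolding prec_def by blast
qed

lemma prec_asym: "u \<in> Mons i \<Longrightarrow> w \<in> Mons i \<Longrightarrow> prec u w \<Longrightarrow> \<not> prec w u"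
  using prec_not_le[of u w] Mons_mem MS_sub_S unfolding prec_def by blast

lemma prec_irrefl: "u \<in> Mons i \<Longrightarrow> \<not> prec u u"
  using prec_asym by blast

lemma prec_total:
  assumes "u \<in> Mons i" "w \<in> Mons i" "u \<noteq> w"
  shows "prec u w \<or> prec w u"
proof -
  obtain \<alpha> \<beta> where u: "u = mon i \<alpha>" and w: "w = mon i \<beta>" using assms by (auto simp: Mons_def)
  have "\<exists>l\<in>{1..d}. \<beta> l \<noteq> \<alpha> l" using assms(3) mon_cong[of \<alpha> \<beta> i] unfolding u w by metis
  then have "\<exists>l\<in>{1..d}. \<beta> l - \<alpha> l \<noteq> 0" by simp
  then have "mon i (\<lambda>l. \<beta> l - \<alpha> l) \<in> MS \<or> inv (mon i (\<lambda>l. \<beta> l - \<alpha> l)) \<in> MS" by (rule mon_total)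
  moreover have "inv (mon i (\<lambda>l. \<beta> l - \<alpha> l)) = mon i (\<lambda>l. \<alpha> l - \<beta> l)"
    using mon_uminus[of i "\<lambda>l. \<beta> l - \<alpha> l"] by simp
  ultimately show ?thesis unfolding prec_def u w mon_diff by simp
qed

text \<open>
  By the Archimedean property a high power of each variable lies above \<open>w\<close>, so the exponents of the
  monomials below \<open>w\<close> are bounded.
\<close>

lemma finite_below:
  assumes "w \<in> Mons i"
  shows "finite {u \<in> Mons i. prec u w}"
proof -
  obtain \<beta> where w: "w = mon i \<beta>" using assms by (auto simp: Mons_def)
  have "\<exists>m::nat. x i l [^] m \<otimes> inv w \<in> S" if l: "l \<in> {1..d}" for l
    using mon_archimedean[of "\<lambda>j. if j = l then 1 else 0" i "\<lambda>l. - \<beta> l"] l mon_var[OF l] mon_uminus w by auto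
  then obtain N :: "nat \<Rightarrow> nat" where N: "\<And>l. l \<in> {1..d} \<Longrightarrow> x i l [^] N l \<otimes> inv w \<in> S" by metis
  have "{u \<in> Mons i. prec u w} \<subseteq> mon i ` (\<Pi>\<^sub>E l\<in>{1..d}. {0..<int (N l)})"
  proof
    fix u assume "u \<in> {u \<in> Mons i. prec u w}"
    then obtain \<alpha> where a: "u = mon i \<alpha>" "\<forall>l\<in>{1..d}. \<alpha> l \<ge> 0" and uw: "u \<in> Mons i" "prec u w"
      by (auto simp: Mons_def)
    have "\<alpha> l < int (N l)" if l: "l \<in> {1..d}" for l
    proof (rule ccontr)
      assume ge: "\<not> \<alpha> l < int (N l)"
      define \<gamma> where "\<gamma> j = \<alpha> j - (if j = l then int (N l) else 0)" for j
      have "u = mon i (\<lambda>j. \<gamma> j + (if j = l then int (N l) else 0))" unfolding a by (rule mon_cong) (simp add: \<gamma>_def)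
      then have "u = mon i \<gamma> \<otimes> x i l [^] N l" using mon_add mon_single[OF l] by simp
      then have "u \<otimes> inv w = mon i \<gamma> \<otimes> (x i l [^] N l \<otimes> inv w)"
        using mon_closed[of i \<gamma>] x_mem(3)[OF l, of i] inv_mem(1)[of w] mon_closed w by (simp add: m_assoc)
      moreover have "\<forall>j\<in>{1..d}. \<gamma> j \<ge> 0" using a(2) ge unfolding \<gamma>_def by auto
      then have "mon i \<gamma> \<in> S" using mon_nonneg[of \<gamma> i] R_sub_S by blast
      ultimately have "u \<otimes> inv w \<in> S" using Sm(5) N[OF l] by simp
      then show False using prec_not_le[of u w] uw(2) Mons_mem(2,3)[OF uw(1)] Mons_mem(2,3)[OF assms] by simp
    qed
    then have box: "restrict \<alpha> {1..d} \<in> (\<Pi>\<^sub>E l\<in>{1..d}. {0..<int (N l)})" using a by auto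
    have "u = mon i (restrict \<alpha> {1..d})" unfolding a(1) by (rule mon_cong) simp
    then show "u \<in> mon i ` (\<Pi>\<^sub>E l\<in>{1..d}. {0..<int (N l)})" using box by (rule image_eqI[where f = "mon i"])
  qed
  then show ?thesis by (rule finite_subset) (auto intro: finite_PiE)
qed

text \<open>
  If \<open>f\<close> is not a unit times a monomial, then for every monomial \<open>w\<close> it lies in the ideal generated by the
  monomials \<open>G w\<close> that are not below \<open>w\<close>. This is shown by induction on the number of monomials below
  \<open>w\<close>. With \<open>v\<close> the predecessor of \<open>w\<close>, write \<open>f = c v + g\<close>, where \<open>g / v\<close> lies in the maximal ideal of \<open>S\<close>. If \<open>c\<close>
  were a unit, \<open>f = (c + g / v) v\<close> would be a unit times \<open>v\<close>. Hence \<open>c\<close> is a combination of the variables, and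
  \<open>c v\<close> is a combination of monomials above \<open>v\<close>. Finally, an ideal \<open>Q\<close> that avoids \<open>f\<close> and contains powers of all variables
  contains \<open>G w\<close>, if \<open>w\<close> is the product of these powers.
\<close>

lemma unit_times_monomial:
  assumes f: "f \<in> R i" "f \<noteq> \<zero>"
  shows "\<exists>v e. (\<forall>l\<in>{1..d}. v l \<ge> 0) \<and> e \<in> S \<and> e \<notin> MS \<and> f = e \<otimes> mon i v"
proof (rule ccontr)
  assume no: "\<not> ?thesis"
  have bad: "f \<noteq> e \<otimes> u" if "u \<in> Mons i" "e \<in> S" "e \<notin> MS" for u e
    using no that unfolding Mons_def by blast
  have fc: "f \<in> carrier K" using f Rm(1) by blast
  define G where "G w = {u \<in> Mons i. u = w \<or> prec w u}" for w
  have GR: "G w \<subseteq> R i" for w using Mons_mem(1) by (auto simp: G_def)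
  define I where "I w = Idl\<^bsub>K\<lparr>carrier := R i\<rparr>\<^esub> (G w)" for w
  note I = Idl_sub[OF sub GR, folded I_def]
  have all: "f \<in> I w" if "w \<in> Mons i" for w
    using that
  proof (induction "card {u \<in> Mons i. prec u w}" arbitrary: w rule: less_induct)
    case less
    have one: "\<one> \<in> Mons i" unfolding Mons_def using mon_zero[of i] by (auto intro!: exI[of _ "\<lambda>_. 0"])
    show ?case
    proof (cases "{u \<in> Mons i. prec u w} = {}")
      case True
      then have "\<one> \<in> G w" using prec_total[OF one less.prems] one by (auto simp: G_def)
      then have "\<one> \<in> I w" using I(2) by blast
      then have "f \<otimes> \<one> \<in> I w" using I(1)[unfolded ideal_sub_iff[OF sub]] f(1) by blast
      then show ?thesis using fc by simp
    next
      case False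
      have fin: "finite {u \<in> Mons i. prec u v}" if "v \<in> Mons i" for v by (rule finite_below[OF that])
      obtain v where v: "v \<in> Mons i" "prec v w"
        and vmax: "\<And>u. u \<in> Mons i \<Longrightarrow> prec u w \<Longrightarrow> card {u' \<in> Mons i. prec u' u} \<le> card {u' \<in> Mons i. prec u' v}"
      proof -
        let ?c = "\<lambda>v. card {u' \<in> Mons i. prec u' v}" and ?B = "{u \<in> Mons i. prec u w}"
        have "Max (?c ` ?B) \<in> ?c ` ?B" using fin[OF less.prems] False by (intro Max_in) auto
        then obtain v where "v \<in> ?B" "?c v = Max (?c ` ?B)" by auto
        moreover have "?c u \<le> Max (?c ` ?B)" if "u \<in> ?B" for u using fin[OF less.prems] that by (intro Max_ge) auto
        ultimately show ?thesis using that by auto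
      qed
      have card_less: "card {u' \<in> Mons i. prec u' a} < card {u' \<in> Mons i. prec u' b}"
        if ab: "a \<in> Mons i" "b \<in> Mons i" "prec a b" for a b
      proof (rule psubset_card_mono[OF fin[OF ab(2)]])
        have "{u' \<in> Mons i. prec u' a} \<subseteq> {u' \<in> Mons i. prec u' b}" using prec_trans ab by blast
        moreover have "a \<in> {u' \<in> Mons i. prec u' b}" "a \<notin> {u' \<in> Mons i. prec u' a}" using ab prec_irrefl by auto
        ultimately show "{u' \<in> Mons i. prec u' a} \<subset> {u' \<in> Mons i. prec u' b}" by blast
      qed
      \<comment> \<open>There is no monomial strictly between \<open>v\<close> and \<open>w\<close>.\<close>
      have gap: "u \<in> G w" if u: "u \<in> Mons i" "prec v u" for u
      proof -
        have "\<not> prec u w" using vmax[OF u(1)] card_less[OF v(1) u] by auto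
        then show ?thesis using prec_total[OF u(1) less.prems] u by (auto simp: G_def)
      qed
      have fv: "f \<in> I v" by (rule less.hyps[OF card_less[OF v(1) less.prems v(2)] v(1)])
      define U where "U = {u \<in> Mons i. prec v u}"
      have UR: "U \<subseteq> R i" using Mons_mem(1) by (auto simp: U_def)
      define J where "J = Idl\<^bsub>K\<lparr>carrier := R i\<rparr>\<^esub> U"
      note J = Idl_sub[OF sub UR, folded J_def]
      note Jm = J(1)[unfolded ideal_sub_iff[OF sub]]
      have JR: "J \<subseteq> R i" using Jm by blast
      have vc: "v \<in> carrier K" "v \<noteq> \<zero>" "v \<in> R i" using Mons_mem[OF v(1)] by auto
      have Rc: "\<And>a. a \<in> R i \<Longrightarrow> a \<in> carrier K" using Rm(1) by blast
      note vi = inv_mem[OF vc(1,2)]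
      define H where "H = {c \<otimes> v \<oplus> g | c g. c \<in> R i \<and> g \<in> J}"
      have HI: "c \<otimes> v \<oplus> g \<in> H" if "c \<in> R i" "g \<in> J" for c g using that by (auto simp: H_def)
      have "ideal H (K\<lparr>carrier := R i\<rparr>)"
        unfolding ideal_sub_iff[OF sub]
      proof (intro conjI ballI)
        show "H \<subseteq> R i" unfolding H_def using JR Rm(4,5) vc(3) by blast
        show "\<zero> \<in> H" using HI[of \<zero> \<zero>] Rm(2) Jm vc by simp
        fix a b assume "a \<in> H" "b \<in> H"
        then obtain c g c' g' where cg: "c \<in> R i" "g \<in> J" "c' \<in> R i" "g' \<in> J" "a = c \<otimes> v \<oplus> g" "b = c' \<otimes> v \<oplus> g'"
          unfolding H_def by blast
        have cc: "c \<in> carrier K" "g \<in> carrier K" "c' \<in> carrier K" "g' \<in> carrier K" using cg Rc JR by auto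
        have "a \<oplus> b = (c \<oplus> c') \<otimes> v \<oplus> (g \<oplus> g')" unfolding cg using cc vc by (simp add: l_distr a_ac)
        moreover have "g \<oplus> g' \<in> J" using Jm cg by blast
        ultimately show "a \<oplus> b \<in> H" using HI[OF Rm(4)[OF cg(1,3)]] by simp
      next
        fix r a assume r: "r \<in> R i" and "a \<in> H"
        then obtain c g where cg: "c \<in> R i" "g \<in> J" "a = c \<otimes> v \<oplus> g" unfolding H_def by blast
        have cc: "c \<in> carrier K" "g \<in> carrier K" "r \<in> carrier K" using cg r Rc JR by auto
        have "r \<otimes> a = (r \<otimes> c) \<otimes> v \<oplus> r \<otimes> g" unfolding cg using cc vc by (simp add: r_distr m_assoc)
        moreover have "r \<otimes> g \<in> J" using Jm cg r by blast
        ultimately show "r \<otimes> a \<in> H" using HI[OF Rm(5)[OF r cg(1)]] by simp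
      qed
      moreover have "G v \<subseteq> H"
      proof
        fix u assume u: "u \<in> G v"
        show "u \<in> H"
        proof (cases "u = v")
          case True
          then show ?thesis using HI[of \<one> \<zero>] Rm(3) Jm vc by simp
        next
          case False
          then have "u \<in> U" using u by (auto simp: G_def U_def)
          then have "u \<in> J" "u \<in> carrier K" using J(2) JR Rc by auto
          then show ?thesis using HI[of \<zero> u] Rm(2) vc by simp
        qed
      qed
      ultimately have "I v \<subseteq> H" by (rule I(3))
      then obtain c g where cg: "c \<in> R i" "g \<in> J" "f = c \<otimes> v \<oplus> g" using fv unfolding H_def by blast
      have cc: "c \<in> carrier K" "g \<in> carrier K" using cg Rc JR by auto
      have "ideal {g \<in> R i. g \<otimes> inv v \<in> MS} (K\<lparr>carrier := R i\<rparr>)"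
        unfolding ideal_sub_iff[OF sub]
      proof (intro conjI ballI)
        show "\<zero> \<in> {g \<in> R i. g \<otimes> inv v \<in> MS}" using Rm(2) zero_MS vi(1) by simp
        show "a \<oplus> b \<in> {g \<in> R i. g \<otimes> inv v \<in> MS}"
          if "a \<in> {g \<in> R i. g \<otimes> inv v \<in> MS}" "b \<in> {g \<in> R i. g \<otimes> inv v \<in> MS}" for a b
          using that Rm(4) MS_add[of "a \<otimes> inv v" "b \<otimes> inv v"] l_distr[of a b "inv v"] vi(1) Rc by simp
        show "r \<otimes> a \<in> {g \<in> R i. g \<otimes> inv v \<in> MS}" if "r \<in> R i" "a \<in> {g \<in> R i. g \<otimes> inv v \<in> MS}" for r a
          using that Rm(5) MS_mult[of r "a \<otimes> inv v"] m_assoc[of r a "inv v"] vi(1) Rc R_sub_S by (auto simp: subset_iff)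
      qed auto
      moreover have "U \<subseteq> {g \<in> R i. g \<otimes> inv v \<in> MS}" using UR unfolding U_def prec_def by blast
      ultimately have "J \<subseteq> {g \<in> R i. g \<otimes> inv v \<in> MS}" by (rule J(3))
      then have g: "g \<otimes> inv v \<in> MS" using cg(2) by blast
      have gc: "g \<otimes> inv v \<in> carrier K" using cc vi(1) by simp
      have feq: "f = (c \<oplus> g \<otimes> inv v) \<otimes> v"
      proof -
        have "g \<otimes> inv v \<otimes> v = g" using cc vc vi by (simp add: m_assoc)
        then show ?thesis using cc vc gc cg(3) by (simp add: l_distr)
      qed
      have "c \<in> M i"
      proof (rule ccontr)
        assume cM: "c \<notin> M i"
        have eS: "c \<oplus> g \<otimes> inv v \<in> S" using cg(1) g MS_sub_S R_sub_S Sm(4) by blast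
        have "c \<oplus> g \<otimes> inv v \<notin> MS"
        proof
          assume "c \<oplus> g \<otimes> inv v \<in> MS"
          moreover have "\<ominus> \<one> \<otimes> (g \<otimes> inv v) \<in> MS" using MS_mult[OF _ g, of "\<ominus> \<one>"] Sm(3,6) by simp
          ultimately have "(c \<oplus> g \<otimes> inv v) \<oplus> \<ominus> \<one> \<otimes> (g \<otimes> inv v) \<in> MS" by (rule MS_add)
          then have "c \<in> MS" using cc gc by (simp add: l_minus a_assoc r_neg)
          then show False using cM MS_Int[of i] cg(1) by blast
        qed
        then show False using bad[OF v(1) eS] feq by blast
      qed
      moreover have "M i \<subseteq> {c \<in> R i. c \<otimes> v \<in> J}"
      proof (rule M_least)
        show "ideal {c \<in> R i. c \<otimes> v \<in> J} (K\<lparr>carrier := R i\<rparr>)"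
          unfolding ideal_sub_iff[OF sub]
        proof (intro conjI ballI)
          show "\<zero> \<in> {c \<in> R i. c \<otimes> v \<in> J}" using Rm(2) Jm vc by simp
          show "a \<oplus> b \<in> {c \<in> R i. c \<otimes> v \<in> J}"
            if "a \<in> {c \<in> R i. c \<otimes> v \<in> J}" "b \<in> {c \<in> R i. c \<otimes> v \<in> J}" for a b
            using that Rm(4) Jm l_distr[of a b v] vc Rc by simp
          show "r \<otimes> a \<in> {c \<in> R i. c \<otimes> v \<in> J}" if "r \<in> R i" "a \<in> {c \<in> R i. c \<otimes> v \<in> J}" for r a
            using that Rm(5) Jm m_assoc[of r a v] vc Rc by simp
        qed auto
        fix l assume l: "l \<in> {1..d}"
        obtain \<alpha> where a: "v = mon i \<alpha>" "\<forall>l\<in>{1..d}. \<alpha> l \<ge> 0" using v(1) by (auto simp: Mons_def)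
        have "x i l \<otimes> v = mon i (\<lambda>j. (if j = l then 1 else 0) + \<alpha> j)" using mon_add mon_var[OF l] a by simp
        then have "x i l \<otimes> v \<in> Mons i" unfolding Mons_def using a(2)
          by (intro CollectI exI[of _ "\<lambda>j. (if j = l then 1 else 0) + \<alpha> j"]) auto
        moreover have "x i l \<otimes> v \<otimes> inv v = x i l" using x_mem[OF l, of i] vc vi by (simp add: m_assoc)
        then have "prec v (x i l \<otimes> v)" unfolding prec_def using x_mem(1)[OF l, of i] by (auto simp: MS_def)
        ultimately have "x i l \<otimes> v \<in> J" using J(2) by (auto simp: U_def)
        then show "x i l \<in> {c \<in> R i. c \<otimes> v \<in> J}" using x_mem(2)[OF l] by simp
      qed
      ultimately have "c \<otimes> v \<in> J" by blast
      then have "f \<in> J" using Jm cg by blast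
      moreover have "J \<subseteq> I w" by (rule J(3)[OF I(1)]) (use gap I(2) in \<open>auto simp: U_def\<close>)
      ultimately show ?thesis by blast
    qed
  qed
  interpret RI: noetherian_cring "K\<lparr>carrier := R i\<rparr>" by (rule noetherian_cring_sub[OF sub noeth])
  obtain Q where Q: "ideal Q (K\<lparr>carrier := R i\<rparr>)" "f \<notin> Q"
    and pw: "\<And>a. a \<in> M i \<Longrightarrow> \<exists>n::nat. a [^]\<^bsub>K\<lparr>carrier := R i\<rparr>\<^esub> n \<in> Q"
    using RI.ex_ideal_avoiding[OF subring_is_domain[OF sub] Mm(1)[of i], of f] Mm(4)[of i] f by auto
  have "\<exists>n::nat. x i l [^] n \<in> Q" if "l \<in> {1..d}" for l
    using pw[OF x_mem(1)[OF that]] by (simp add: nat_pow_def)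
  then obtain N :: "nat \<Rightarrow> nat" where N: "\<And>l. l \<in> {1..d} \<Longrightarrow> x i l [^] N l \<in> Q" by metis
  note Qm = Q(1)[unfolded ideal_sub_iff[OF sub]]
  \<comment> \<open>A monomial in which each exponent of \<open>x i l\<close> is less than \<open>N l\<close> lies below \<open>w\<close>; all others lie in \<open>Q\<close>.\<close>
  define w where "w = mon i (\<lambda>l. int (N l))"
  have wM: "w \<in> Mons i" by (auto simp: w_def Mons_def)
  have "G w \<subseteq> Q"
  proof
    fix u assume u: "u \<in> G w"
    then obtain \<alpha> where a: "u = mon i \<alpha>" "\<forall>l\<in>{1..d}. \<alpha> l \<ge> 0" and uM: "u \<in> Mons i" by (auto simp: G_def Mons_def)
    have "\<exists>l\<in>{1..d}. \<alpha> l \<ge> int (N l)"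
    proof (rule ccontr)
      assume "\<not> ?thesis"
      then have lt: "\<And>l. l \<in> {1..d} \<Longrightarrow> \<alpha> l < int (N l)" by (meson not_le)
      have "mon i (\<lambda>l. int (N l) - \<alpha> l) \<in> M i"
        by (rule mon_pos[of _ 1]) (use lt d in \<open>auto intro: less_imp_le\<close>)
      then have "prec u w" unfolding prec_def w_def a mon_diff by (auto simp: MS_def)
      then show False using u prec_asym[OF uM wM] prec_irrefl[OF wM] by (auto simp: G_def)
    qed
    then obtain l where l: "l \<in> {1..d}" "\<alpha> l \<ge> int (N l)" by blast
    define \<gamma> where "\<gamma> j = \<alpha> j - (if j = l then int (N l) else 0)" for j
    have "u = mon i (\<lambda>j. \<gamma> j + (if j = l then int (N l) else 0))" unfolding a by (rule mon_cong) (simp add: \<gamma>_def)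
    then have "u = mon i \<gamma> \<otimes> x i l [^] N l" using mon_add mon_single[OF l(1)] by simp
    moreover have "mon i \<gamma> \<in> R i" using a l by (intro mon_nonneg) (auto simp: \<gamma>_def)
    ultimately show "u \<in> Q" using Qm N[OF l(1)] by simp
  qed
  then have "I w \<subseteq> Q" by (rule I(3)[OF Q(1)])
  then show False using all[OF wM] Q(2) by blast
qed

end

end

section \<open>Dimension\<close>

lemma prime_chain_truncate: "prime_chain R n p \<Longrightarrow> m \<le> n \<Longrightarrow> prime_chain R m p"
  by (auto simp: prime_chain_def)

lemma le_krull_dim: "prime_chain R n p \<Longrightarrow> enat n \<le> krull_dim R"
  unfolding krull_dim_def by (rule SUP_upper) blast

lemma krull_dim_le: "(\<And>n p. prime_chain R n p \<Longrightarrow> n \<le> m) \<Longrightarrow> krull_dim R \<le> enat m"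
  unfolding krull_dim_def by (rule SUP_least) auto

lemma ex_prime_chain:
  assumes "enat n \<le> krull_dim R" "0 < n"
  shows "\<exists>p. prime_chain R n p"
proof (rule ccontr)
  assume no: "\<not> ?thesis"
  have "krull_dim R \<le> enat (n - 1)"
  proof (rule krull_dim_le)
    fix m p assume "prime_chain R m p"
    then have "\<not> n \<le> m" using prime_chain_truncate no by blast
    then show "m \<le> n - 1" by simp
  qed
  then have "enat n \<le> enat (n - 1)" using assms(1) by (rule order_trans[rotated])
  then show False using assms(2) by simp
qed

lemma krull_dim_eq_one:
  assumes "prime_chain R 1 p" "\<And>q. \<not> prime_chain R 2 q"
  shows "krull_dim R = 1"
proof (rule antisym)
  have "n \<le> 1" if "prime_chain R n q" for n q
  proof (rule ccontr)
    assume "\<not> n \<le> 1"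
    then have "2 \<le> n" by simp
    from prime_chain_truncate[OF that this] assms(2) show False by blast
  qed
  then show "krull_dim R \<le> 1" using krull_dim_le[of R 1] by (simp add: one_enat_def)
  show "1 \<le> krull_dim R" using le_krull_dim[OF assms(1)] by (simp add: one_enat_def)
qed

lemma height_eq_one:
  assumes "prime_chain R 1 p" "p 1 = P" "\<And>n q. prime_chain R n q \<Longrightarrow> q n = P \<Longrightarrow> n \<le> 1"
  shows "height R P = 1"
proof (rule antisym)
  show "height R P \<le> 1"
    unfolding height_def by (rule SUP_least) (use assms(3) in \<open>auto simp: one_enat_def\<close>)
  have "enat 1 \<le> height R P"
    unfolding height_def by (rule SUP_upper) (use assms(1,2) in blast)
  then show "1 \<le> height R P" by (simp add: one_enat_def)
qed

lemma height_zero_prime: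
  assumes "height R P = 1" shows "\<exists>q. primeideal q R \<and> q \<subset> P"
proof (rule ccontr)
  assume no: "\<not> ?thesis"
  have "height R P \<le> enat 0"
    unfolding height_def
  proof (rule SUP_least)
    fix n assume "n \<in> {n. \<exists>p. prime_chain R n p \<and> p n = P}"
    then obtain p where p: "prime_chain R n p" "p n = P" by blast
    have "n = 0"
    proof (rule ccontr)
      assume "n \<noteq> 0"
      then obtain m where m: "n = Suc m" by (cases n) auto
      then have "primeideal (p m) R" "p m \<subset> P" using p by (auto simp: prime_chain_def)
      then show False using no by blast
    qed
    then show "enat n \<le> enat 0" by simp
  qed
  then show False using assms by (simp add: one_enat_def)
qed

context field
begin

lemma divide_unique:
  assumes "a \<in> carrier R" "g \<in> carrier R" "g \<noteq> \<zero>" "a \<otimes> g = f"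
  shows "f \<otimes> inv g = a"
proof -
  have "f \<otimes> inv g = a \<otimes> (g \<otimes> inv g)" using assms inv_mem(1)[OF assms(2,3)] by (simp add: m_assoc flip: assms(4))
  then show ?thesis using assms inv_mem(3)[OF assms(2,3)] by simp
qed

lemma inv_unique_field:
  assumes "a \<in> carrier R" "b \<in> carrier R" "a \<otimes> b = \<one>"
  shows "inv b = a" "b \<noteq> \<zero>"
proof -
  show "b \<noteq> \<zero>" using assms by auto
  from divide_unique[OF assms(1,2) this assms(3)] show "inv b = a"
    using inv_mem(1)[OF assms(2) \<open>b \<noteq> \<zero>\<close>] by simp
qed

lemma max_ideal_of_nonunits:
  assumes A: "subring A R" and I: "ideal {a \<in> A. a = \<zero> \<or> inv a \<notin> A} (R\<lparr>carrier := A\<rparr>)"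
  shows "max_ideal (R\<lparr>carrier := A\<rparr>) = {a \<in> A. a = \<zero> \<or> inv a \<notin> A}"
    "primeideal {a \<in> A. a = \<zero> \<or> inv a \<notin> A} (R\<lparr>carrier := A\<rparr>)"
proof -
  interpret A: domain "R\<lparr>carrier := A\<rparr>" by (rule subring_is_domain[OF A])
  have eq: "carrier (R\<lparr>carrier := A\<rparr>) - Units (R\<lparr>carrier := A\<rparr>) = {a \<in> A. a = \<zero> \<or> inv a \<notin> A}"
    unfolding Units_sub[OF A] by auto
  note m = A.max_ideal_eq_nonunits[unfolded eq, OF I]
  show "max_ideal (R\<lparr>carrier := A\<rparr>) = {a \<in> A. a = \<zero> \<or> inv a \<notin> A}" by (rule m(1))
  show "primeideal {a \<in> A. a = \<zero> \<or> inv a \<notin> A} (R\<lparr>carrier := A\<rparr>)"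
    by (rule A.maximalideal_prime[OF m(2)])
qed

lemma prime_sub_nonunits:
  assumes A: "subring A R" and q: "primeideal q (R\<lparr>carrier := A\<rparr>)"
  shows "q \<subseteq> {a \<in> A. a = \<zero> \<or> inv a \<notin> A}"
proof
  note qm = prime_sub_mem[OF A q]
  fix a assume a: "a \<in> q"
  then have aA: "a \<in> A" "a \<in> carrier R" using qm(2) subring_mem(1)[OF A] by auto
  have "inv a \<notin> A" if "a \<noteq> \<zero>"
  proof
    assume "inv a \<in> A"
    then have "inv a \<otimes> a \<in> q" using qm(6) a by blast
    then show False using inv_mem(2)[OF aA(2) that] qm(4) by simp
  qed
  then show "a \<in> {a \<in> A. a = \<zero> \<or> inv a \<notin> A}" using aA by blast
qed

lemma zero_prime_sub: assumes A: "subring A R" shows "primeideal {\<zero>} (R\<lparr>carrier := A\<rparr>)"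
proof -
  interpret A: domain "R\<lparr>carrier := A\<rparr>" by (rule subring_is_domain[OF A])
  show ?thesis using A.zeroprimeideal by simp
qed

text \<open>
  A valuation domain is local: of two nonzero nonunits one divides the other, so their sum is a
  multiple of a nonunit.
\<close>

lemma valuation_domain_max_ideal:
  assumes V: "valuation_domain R V"
  shows "max_ideal (R\<lparr>carrier := V\<rparr>) = {a \<in> V. a = \<zero> \<or> inv a \<notin> V}"
proof (rule max_ideal_of_nonunits(1))
  show sub: "subring V R" using V by (simp add: valuation_domain_def)
  note Vm = subring_mem[OF sub]
  have Vc: "\<And>a. a \<in> V \<Longrightarrow> a \<in> carrier R" using Vm(1) by blast
  have val: "a \<otimes> inv b \<in> V \<or> inv (a \<otimes> inv b) \<in> V" if ab: "a \<in> V" "b \<in> V" "a \<noteq> \<zero>" "b \<noteq> \<zero>" for a b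
  proof -
    have "a \<otimes> inv b \<in> fraction_field R V" using ab by (auto simp: fraction_field_def localization_def)
    moreover have "a \<otimes> inv b \<noteq> \<zero>" using integral[of a "inv b"] ab Vc inv_mem[of b] by auto
    ultimately show ?thesis using V by (auto simp: valuation_domain_def)
  qed
  let ?N = "{a \<in> V. a = \<zero> \<or> inv a \<notin> V}"
  have key: "a \<oplus> b \<in> ?N" if ab: "a \<in> ?N" "b \<in> ?N" "b \<noteq> \<zero>" "a \<otimes> inv b \<in> V" for a b
  proof (rule ccontr)
    have c: "a \<in> carrier R" "b \<in> carrier R" "inv b \<in> carrier R" using ab Vc inv_mem(1)[of b] by auto
    have abV: "a \<oplus> b \<in> V" using ab Vm(4) by blast
    assume "a \<oplus> b \<notin> ?N"
    then have u: "a \<oplus> b \<noteq> \<zero>" "inv (a \<oplus> b) \<in> V" using abV by auto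
    have ic: "inv (a \<oplus> b) \<in> carrier R" by (rule Vc[OF u(2)])
    have "a \<oplus> b = (a \<otimes> inv b \<oplus> \<one>) \<otimes> b"
      using c inv_mem(2)[OF c(2) ab(3)] by (simp add: l_distr m_assoc)
    then have "inv (a \<oplus> b) \<otimes> (a \<otimes> inv b \<oplus> \<one>) \<otimes> b = inv (a \<oplus> b) \<otimes> (a \<oplus> b)"
      using c ic by (simp add: m_assoc)
    also have "\<dots> = \<one>" using inv_mem(2)[OF _ u(1)] c by simp
    finally have "inv b = inv (a \<oplus> b) \<otimes> (a \<otimes> inv b \<oplus> \<one>)" using c ic by (intro inv_unique_field(1)) auto
    then have "inv b \<in> V" using Vm(5)[OF u(2) Vm(4)[OF ab(4) Vm(3)]] by simp
    then show False using ab(2,3) by simp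
  qed
  show "ideal ?N (R\<lparr>carrier := V\<rparr>)"
    unfolding ideal_sub_iff[OF sub]
  proof (intro conjI ballI)
    show "?N \<subseteq> V" by blast
    show "\<zero> \<in> ?N" using Vm(2) by simp
    fix a b assume ab: "a \<in> ?N" "b \<in> ?N"
    then have c: "a \<in> carrier R" "b \<in> carrier R" using Vc by auto
    consider "a = \<zero>" | "b = \<zero>" | "a \<noteq> \<zero>" "b \<noteq> \<zero>" by blast
    then show "a \<oplus> b \<in> ?N"
    proof cases
      case 3
      then consider "a \<otimes> inv b \<in> V" | "inv (a \<otimes> inv b) \<in> V" using val[of a b] ab by blast
      then show ?thesis
      proof cases
        case 1
        then show ?thesis using key ab 3 by blast
      next
        case 2
        have "b \<otimes> inv a \<otimes> (a \<otimes> inv b) = b \<otimes> (inv a \<otimes> a) \<otimes> inv b"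
          using c 3 inv_mem(1)[of a] inv_mem(1)[of b] by (simp add: m_assoc)
        also have "\<dots> = \<one>" using c 3 inv_mem[of a] inv_mem[of b] by simp
        finally have "inv (a \<otimes> inv b) = b \<otimes> inv a"
          using c 3 inv_mem(1)[of a] inv_mem(1)[of b] by (intro inv_unique_field(1)) auto
        then have "b \<oplus> a \<in> ?N" using key[OF ab(2,1) 3(1)] 2 by simp
        then show ?thesis using c a_comm by simp
      qed
    qed (use ab c in simp_all)
  next
    fix r a assume ra: "r \<in> V" "a \<in> ?N"
    have c: "r \<in> carrier R" "a \<in> carrier R" using ra Vc by auto
    show "r \<otimes> a \<in> ?N"
    proof (rule ccontr)
      assume "r \<otimes> a \<notin> ?N"
      then have u: "r \<otimes> a \<noteq> \<zero>" "inv (r \<otimes> a) \<in> V" using ra Vm(5) by auto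
      have ic: "inv (r \<otimes> a) \<in> carrier R" by (rule Vc[OF u(2)])
      have "inv (r \<otimes> a) \<otimes> r \<otimes> a = \<one>" using inv_mem(2)[OF _ u(1)] c ic by (simp add: m_assoc)
      then have "inv a = inv (r \<otimes> a) \<otimes> r" "a \<noteq> \<zero>" using inv_unique_field[of "inv (r \<otimes> a) \<otimes> r" a] c ic by auto
      then show False using ra u Vm(5) by simp
    qed
  qed
qed

end

context monomial_sequence
begin

lemma S_max_ideal: "max_ideal (K\<lparr>carrier := S\<rparr>) = MS" and MS_prime: "primeideal MS (K\<lparr>carrier := S\<rparr>)"
  using max_ideal_of_nonunits[OF S_subring MS_ideal[unfolded MS_eq]] unfolding MS_eq[symmetric] by auto

section \<open>Infinitely many transforms in every direction\<close>

context
  assumes inf: "\<And>l. l \<in> {1..d} \<Longrightarrow> infinite {i. k i = l}"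
begin

lemmas unit_times_monomial' = unit_times_monomial[OF inf]

lemma S_quotient:
  assumes fg: "f \<in> S" "g \<in> S" "f \<noteq> \<zero>" "g \<noteq> \<zero>"
  shows "f \<otimes> inv g \<in> S \<or> g \<otimes> inv f \<in> S"
proof -
  obtain i where i: "f \<in> R i" "g \<in> R i" by (rule S_common[OF fg(1,2)])
  obtain \<beta> e where f: "e \<in> S" "e \<notin> MS" "f = e \<otimes> mon i \<beta>" using unit_times_monomial'[OF _ i(1) fg(3)] by blast
  obtain \<gamma> e' where g: "e' \<in> S" "e' \<notin> MS" "g = e' \<otimes> mon i \<gamma>" using unit_times_monomial'[OF _ i(2) fg(4)] by blast
  note u = unit_S[OF f(1,2)] and u' = unit_S[OF g(1,2)]
  have c: "f \<in> carrier K" "g \<in> carrier K" using fg Sm(1) by auto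
  have quot: "e1 \<otimes> mon i \<beta>1 \<otimes> inv (e2 \<otimes> mon i \<gamma>1) = e1 \<otimes> inv e2 \<otimes> mon i (\<lambda>l. \<beta>1 l - \<gamma>1 l)"
    if e: "e1 \<in> carrier K" "e2 \<in> carrier K" "e2 \<noteq> \<zero>" for e1 e2 \<beta>1 \<gamma>1
  proof (rule divide_unique)
    note mc = mon_closed[of i \<beta>1] mon_closed[of i \<gamma>1] and ei = inv_mem[OF e(2,3)] and mi = inv_mem[OF mon_closed[of i \<gamma>1]]
    show "e2 \<otimes> mon i \<gamma>1 \<in> carrier K" "e1 \<otimes> inv e2 \<otimes> mon i (\<lambda>l. \<beta>1 l - \<gamma>1 l) \<in> carrier K"
      using e ei(1) mon_closed(1) by auto
    show "e2 \<otimes> mon i \<gamma>1 \<noteq> \<zero>" using integral[OF _ e(2) mon_closed(1)] e(3) mc by blast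
    have "e1 \<otimes> inv e2 \<otimes> mon i (\<lambda>l. \<beta>1 l - \<gamma>1 l) \<otimes> (e2 \<otimes> mon i \<gamma>1)
        = e1 \<otimes> (inv e2 \<otimes> e2) \<otimes> (mon i (\<lambda>l. \<beta>1 l - \<gamma>1 l) \<otimes> mon i \<gamma>1)"
      using e ei(1) mon_closed(1) by (simp add: m_ac)
    also have "\<dots> = e1 \<otimes> mon i \<beta>1"
      using e ei(2) mon_add[of i "\<lambda>l. \<beta>1 l - \<gamma>1 l" \<gamma>1] by simp
    finally show "e1 \<otimes> inv e2 \<otimes> mon i (\<lambda>l. \<beta>1 l - \<gamma>1 l) \<otimes> (e2 \<otimes> mon i \<gamma>1) = e1 \<otimes> mon i \<beta>1" .
  qed
  have "mon i (\<lambda>l. \<beta> l - \<gamma> l) \<in> S \<or> mon i (\<lambda>l. \<gamma> l - \<beta> l) \<in> S"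
  proof (cases "\<exists>l\<in>{1..d}. \<beta> l - \<gamma> l \<noteq> 0")
    case True
    have "inv (mon i (\<lambda>l. \<beta> l - \<gamma> l)) = mon i (\<lambda>l. \<gamma> l - \<beta> l)"
      using mon_uminus[of i "\<lambda>l. \<beta> l - \<gamma> l"] by simp
    then show ?thesis using mon_total[OF inf True, of i] MS_sub_S by auto
  next
    case False
    then have "mon i (\<lambda>l. \<beta> l - \<gamma> l) = \<one>" using mon_cong[of "\<lambda>l. \<beta> l - \<gamma> l" "\<lambda>_. 0" i] mon_zero by auto
    then show ?thesis using Sm(3) by simp
  qed
  then show ?thesis
    using quot[OF u(3) u'(3,1), of \<beta> \<gamma>] quot[OF u'(3) u(3,1), of \<gamma> \<beta>] f g u(2) u'(2) Sm(5) by auto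
qed

text \<open>
  If \<open>z \<in> V\<close> is not in \<open>S\<close>, its inverse is in \<open>S\<close> and is a nonunit there, hence a nonunit of \<open>V\<close> by domination.
\<close>

lemma dominating_eq_S:
  assumes V: "subring V K" "S \<subseteq> V" "V \<subseteq> fraction_field K S" and dom: "{a \<in> V. a = \<zero> \<or> inv a \<notin> V} \<inter> S = MS"
  shows "V = S"
proof
  show "V \<subseteq> S"
  proof
    fix z assume z: "z \<in> V"
    then obtain f g where fg: "f \<in> S" "g \<in> S" "g \<noteq> \<zero>" "z = f \<otimes> inv g"
      using V(3) by (auto simp: fraction_field_def localization_def)
    have c: "f \<in> carrier K" "g \<in> carrier K" "inv g \<in> carrier K" using fg Sm(1) inv_mem(1)[of g] by auto
    show "z \<in> S"
    proof (cases "f = \<zero>")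
      case True
      then show ?thesis using fg c Sm(2) by simp
    next
      case False
      show ?thesis
      proof (rule ccontr)
        assume zS: "z \<notin> S"
        define w where "w = g \<otimes> inv f"
        have wS: "w \<in> S" using S_quotient[OF fg(1,2) False fg(3)] zS fg(4) by (simp add: w_def)
        have wc: "w \<in> carrier K" "z \<in> carrier K" using wS Sm(1) fg(4) c by auto
        have "z \<otimes> w = f \<otimes> (inv g \<otimes> g) \<otimes> inv f"
          unfolding w_def fg(4) using c False inv_mem(1)[of f] by (simp add: m_assoc)
        also have "\<dots> = \<one>" using c False fg(3) inv_mem[of f] inv_mem[of g] by simp
        finally have wi: "inv w = z" "w \<noteq> \<zero>" using inv_unique_field[OF wc(2,1)] by auto
        then have "w \<in> MS" using zS wS unfolding MS_eq by simp
        then have "inv w \<notin> V" using dom wi(2) by blast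
        then show False using wi(1) z by simp
      qed
    qed
  qed
qed (rule V(2))

text \<open>
  A power of any \<open>g\<close> in the maximal ideal is divisible by a given nonzero element of \<open>q\<close>, by the Archimedean
  property of monomials.
\<close>

lemma prime_S:
  assumes q: "primeideal q (K\<lparr>carrier := S\<rparr>)" "q \<noteq> {\<zero>}"
  shows "q = MS"
proof
  note qm = prime_sub_mem[OF S_subring q(1)]
  show "q \<subseteq> MS" using prime_sub_nonunits[OF S_subring q(1)] unfolding MS_eq .
  obtain f where f: "f \<in> q" "f \<noteq> \<zero>" using q(2) qm(3) by blast
  show "MS \<subseteq> q"
  proof
    fix g assume g: "g \<in> MS"
    show "g \<in> q"
    proof (cases "g = \<zero>")
      case True
      then show ?thesis using qm(3) by simp
    next
      case False
      have fgS: "f \<in> S" "g \<in> S" using f(1) g qm(2) MS_sub_S by auto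
      obtain i where i: "f \<in> R i" "g \<in> R i" by (rule S_common[OF fgS])
      obtain \<beta> e where fe: "e \<in> S" "e \<notin> MS" "f = e \<otimes> mon i \<beta>" using unit_times_monomial'[OF _ i(1) f(2)] by blast
      obtain \<gamma> e' where ge: "\<forall>l\<in>{1..d}. \<gamma> l \<ge> 0" "e' \<in> S" "e' \<notin> MS" "g = e' \<otimes> mon i \<gamma>"
        using unit_times_monomial'[OF _ i(2) False] by blast
      note u = unit_S[OF fe(1,2)] and u' = unit_S[OF ge(2,3)]
      note ui = inv_mem[OF u(3,1)]
      have "\<exists>l\<in>{1..d}. \<gamma> l \<noteq> 0"
      proof (rule ccontr)
        assume "\<not> ?thesis"
        then have "mon i \<gamma> = \<one>" using mon_cong[of \<gamma> "\<lambda>_. 0" i] mon_zero by auto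
        then show False using ge g u'(3) by simp
      qed
      then obtain m :: nat where m: "mon i \<gamma> [^] m \<otimes> mon i (\<lambda>l. - \<beta> l) \<in> S" using mon_archimedean[OF inf ge(1)] by blast
      define h where "h = mon i \<gamma> [^] m \<otimes> mon i (\<lambda>l. - \<beta> l)"
      have e'm: "e' [^] m \<in> S"
      proof (induction m)
        case 0
        show ?case using Sm(3) by simp
      next
        case (Suc m)
        show ?case using Sm(5)[OF Suc.IH ge(2)] by simp
      qed
      have cc: "h \<in> carrier K" "e' [^] m \<in> carrier K" "mon i \<gamma> [^] m \<in> carrier K" "mon i \<beta> \<in> carrier K"
        "mon i (\<lambda>l. - \<beta> l) \<in> carrier K"
        using m Sm(1) mon_closed u'(3) by (auto simp: h_def)
      have one: "mon i (\<lambda>l. - \<beta> l) \<otimes> mon i \<beta> = \<one>" using mon_add[of i "\<lambda>l. - \<beta> l" \<beta>] mon_zero by simp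
      have "(e' [^] m \<otimes> h \<otimes> inv e) \<otimes> f = e' [^] m \<otimes> (mon i \<gamma> [^] m \<otimes> (mon i (\<lambda>l. - \<beta> l) \<otimes> mon i \<beta>)) \<otimes> (inv e \<otimes> e)"
        unfolding fe(3) h_def using cc u(3) ui(1) by (simp add: m_ac)
      also have "\<dots> = e' [^] m \<otimes> mon i \<gamma> [^] m" unfolding one ui(2) using cc by simp
      also have "\<dots> = g [^] m" unfolding ge(4) using u'(3) mon_closed(1) by (simp add: nat_pow_distrib)
      finally have "g [^] m = (e' [^] m \<otimes> h \<otimes> inv e) \<otimes> f" ..
      also have "\<dots> \<in> q"
        by (rule qm(6)[OF Sm(5)[OF Sm(5)[OF e'm m[folded h_def]] u(2)] f(1)])
      finally have gm: "g [^] m \<in> q" .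
      show "g \<in> q"
      proof (rule ccontr)
        assume "g \<notin> q"
        then have gq: "g \<in> S - q" using fgS by blast
        have "g [^] n \<in> S - q" for n :: nat
        proof (induction n)
          case 0
          show ?case using qm(4) by simp
        next
          case (Suc n)
          show ?case using qm(7)[OF Suc.IH gq] by simp
        qed
        then show False using gm by blast
      qed
    qed
  qed
qed

lemma krull_dim_S: "krull_dim (K\<lparr>carrier := S\<rparr>) = 1"
proof (rule krull_dim_eq_one)
  have "x 0 1 \<in> MS" "x 0 1 \<noteq> \<zero>" using x_mem[of 1 0] d by (auto simp: MS_def)
  then have lt: "{\<zero>} \<subset> MS" using zero_MS by blast
  define p where "p i = (if i = 0 then {\<zero>} else MS)" for i :: nat
  show "prime_chain (K\<lparr>carrier := S\<rparr>) 1 p"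
    using zero_prime_sub[OF S_subring] MS_prime lt by (auto simp: prime_chain_def p_def)
  fix q show "\<not> prime_chain (K\<lparr>carrier := S\<rparr>) 2 q"
  proof
    assume c: "prime_chain (K\<lparr>carrier := S\<rparr>) 2 q"
    then have pr: "primeideal (q 0) (K\<lparr>carrier := S\<rparr>)" "primeideal (q 1) (K\<lparr>carrier := S\<rparr>)" "primeideal (q 2) (K\<lparr>carrier := S\<rparr>)"
      and lt: "q 0 \<subset> q 1" "q 1 \<subset> q 2" unfolding prime_chain_def by (auto simp: numeral_2_eq_2)
    have "\<zero> \<in> q 0" "\<zero> \<in> q 1" by (rule prime_sub_mem(3)[OF S_subring pr(1)], rule prime_sub_mem(3)[OF S_subring pr(2)])
    then have "q 1 \<noteq> {\<zero>}" "q 2 \<noteq> {\<zero>}" using lt by auto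
    then have "q 1 = MS" "q 2 = MS" using prime_S pr by auto
    then show False using lt by simp
  qed
qed

end

section \<open>Rank one forces strong switching\<close>

text \<open>
  If the transform at \<open>j + n\<close> has direction \<open>k\<close>, then the product \<open>\<pi> n\<close> of the variables of \<open>R (j + n)\<close> is
  \<open>\<pi> (n + 1)\<close> times the nonunit \<open>x k ^ (d - 1)\<close>. In a fixed Noetherian ring such a sequence does not exist.
\<close>

lemma R_not_eventually_constant: "\<exists>n\<ge>j. \<not> R n \<subseteq> R j"
proof (rule ccontr)
  assume "\<not> ?thesis"
  then have Req: "R n = R j" if "n \<ge> j" for n using that R_mono[OF that] by blast
  interpret RJ: noetherian_cring "K\<lparr>carrier := R j\<rparr>" by (rule noetherian_cring_sub[OF sub noeth])
  define \<pi> where "\<pi> n = mon (j + n) (\<lambda>_. 1)" for n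
  have piR: "\<pi> n \<in> R j" for n using mon_nonneg[of "\<lambda>_. 1" "j + n"] Req[of "j + n"] by (simp add: \<pi>_def)
  have pic: "\<pi> n \<in> carrier K" "\<pi> n \<noteq> \<zero>" for n using mon_closed by (auto simp: \<pi>_def)
  have step: "\<exists>y\<in>M (j + Suc n). \<pi> n = y \<otimes> \<pi> (Suc n)" for n
  proof -
    define i where "i = j + n"
    define u where "u l = (if l = k i then int d - 1 else 0)" for l
    have "mon i (\<lambda>_. 1) = mon (Suc i) (sum_step {1..d} (k i) (\<lambda>_. 1))" by (rule mon_step)
    also have "\<dots> = mon (Suc i) (\<lambda>l. u l + 1)" by (rule mon_cong) (simp add: sum_step_def u_def)
    also have "\<dots> = mon (Suc i) u \<otimes> mon (Suc i) (\<lambda>_. 1)" by (rule mon_add)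
    finally have "\<pi> n = mon (Suc i) u \<otimes> \<pi> (Suc n)" by (simp add: \<pi>_def i_def)
    moreover have "mon (Suc i) u \<in> M (Suc i)"
      by (rule mon_pos[OF _ k_mem[of i]]) (use d in \<open>auto simp: u_def\<close>)
    ultimately show ?thesis by (auto simp: i_def)
  qed
  define I where "I n = {r \<otimes> \<pi> n | r. r \<in> R j}" for n
  have "\<exists>n. \<forall>m\<ge>n. I m = I n"
  proof (rule RJ.ascending_ideals_stabilize)
    show "ideal (I n) (K\<lparr>carrier := R j\<rparr>)" for n
      using RJ.cgenideal_ideal[of "\<pi> n"] piR by (simp add: cgenideal_def I_def)
    show "I n \<subseteq> I (Suc n)" for n
    proof
      fix z assume "z \<in> I n"
      then obtain r where r: "r \<in> R j" "z = r \<otimes> \<pi> n" by (auto simp: I_def)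
      obtain y where y: "y \<in> M (j + Suc n)" "\<pi> n = y \<otimes> \<pi> (Suc n)" using step by blast
      have yR: "y \<in> R j" using y(1) Mm(2) Req[of "j + Suc n"] by auto
      have "z = (r \<otimes> y) \<otimes> \<pi> (Suc n)" unfolding r y using r(1) yR pic Rm(1)[of j] by (simp add: m_assoc subset_iff)
      then show "z \<in> I (Suc n)" using Rm(5)[OF r(1) yR] by (auto simp: I_def)
    qed
  qed
  then obtain n where "I (Suc n) = I n" by (metis le_Suc_eq le_refl)
  moreover have "\<pi> (Suc n) \<in> I (Suc n)" unfolding I_def using Rm(3)[of j] pic by (auto intro!: exI[of _ \<one>])
  ultimately obtain r where r: "r \<in> R j" "\<pi> (Suc n) = r \<otimes> \<pi> n" unfolding I_def by blast
  obtain y where y: "y \<in> M (j + Suc n)" "\<pi> n = y \<otimes> \<pi> (Suc n)" using step by blast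
  have yc: "y \<in> carrier K" "r \<in> carrier K" using y(1) r(1) Mm(2) Rm(1) by blast+
  have "(r \<otimes> y) \<otimes> \<pi> (Suc n) = \<one> \<otimes> \<pi> (Suc n)" using r(2) y(2) yc pic by (simp add: m_assoc)
  then have "r \<otimes> y = \<one>" using m_rcancel[of "\<pi> (Suc n)" "r \<otimes> y" \<one>] pic yc by simp
  moreover have "r \<otimes> y \<in> M (j + Suc n)" using Mm(6)[OF _ y(1)] r(1) Req[of "j + Suc n"] by simp
  ultimately show False using Mm(4) by simp
qed

text \<open>
  The contraction \<open>q\<close> to \<open>S\<close> of the maximal ideal of the localization is a nonzero prime, hence the maximal
  ideal of \<open>S\<close>. So \<open>p\<close> is maximal, the localization at \<open>p\<close> is \<open>R j\<close>, and \<open>S \<subseteq> R j\<close>.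
\<close>

lemma switches_if_rank_one:
  assumes dim: "krull_dim (K\<lparr>carrier := S\<rparr>) = 1"
  shows "switches_strongly_infinitely_often K R"
  unfolding switches_strongly_infinitely_often_def
proof
  assume "\<exists>j p. primeideal p (K\<lparr>carrier := R j\<rparr>) \<and> height (K\<lparr>carrier := R j\<rparr>) p = 1 \<and> \<Union> (range R) \<subseteq> localization K (R j) p"
  then obtain j p where p: "primeideal p (K\<lparr>carrier := R j\<rparr>)" "height (K\<lparr>carrier := R j\<rparr>) p = 1"
    and SL: "S \<subseteq> localization K (R j) p" unfolding S_def by blast
  note pm = prime_sub_mem[OF sub p(1)]
  obtain q' where q': "primeideal q' (K\<lparr>carrier := R j\<rparr>)" "q' \<subset> p" using height_zero_prime[OF p(2)] by blast
  then obtain a where a: "a \<in> p" "a \<noteq> \<zero>" using prime_sub_mem(3)[OF sub q'(1)] by blast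
  define q where "q = extended_prime K (R j) p \<inter> S"
  have q: "primeideal q (K\<lparr>carrier := S\<rparr>)" unfolding q_def by (rule prime_contraction[OF sub p(1) S_subring SL])
  have qp: "q \<inter> R j = p" using extended_prime_Int_subring[OF sub p(1)] R_sub_S[of j] unfolding q_def by blast
  have qMS: "q \<subseteq> MS" using prime_sub_nonunits[OF S_subring q] unfolding MS_eq .
  have "q = MS"
  proof (rule ccontr)
    assume "q \<noteq> MS"
    then have lt: "q \<subset> MS" using qMS by blast
    have lt0: "{\<zero>} \<subset> q" using a qp prime_sub_mem(3)[OF S_subring q] by blast
    define c where "c i = (if i = 0 then {\<zero>} else if i = 1 then q else MS)" for i :: nat
    have "prime_chain (K\<lparr>carrier := S\<rparr>) 2 c"
      unfolding prime_chain_def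
    proof (intro conjI allI impI)
      show "primeideal (c i) (K\<lparr>carrier := S\<rparr>)" for i
        using zero_prime_sub[OF S_subring] q MS_prime by (simp add: c_def)
      fix i :: nat assume "i < 2"
      then consider "i = 0" | "i = 1" by linarith
      then show "c i \<subset> c (Suc i)" using lt lt0 by cases (simp_all add: c_def)
    qed
    from le_krull_dim[OF this] show False using dim by (simp add: one_enat_def)
  qed
  then have pM: "p = M j" using qp MS_Int by simp
  have "localization K (R j) p \<subseteq> R j"
  proof
    fix z assume "z \<in> localization K (R j) p"
    then obtain b s where bs: "b \<in> R j" "s \<in> R j" "s \<notin> M j" "z = b \<otimes> inv s"
      unfolding localization_def pM by blast
    then show "z \<in> R j" using Rm(5) by (simp add: M_eq)
  qed
  then show False using R_not_eventually_constant[of j] SL R_sub_S by blast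
qed

section \<open>A direction that is used only finitely often\<close>

text \<open>
  Otherwise the chain could be moved so that its prime of index \<open>d\<close> contains all variables.
\<close>

lemma prime_chain_length_le:
  assumes C: "prime_chain (K\<lparr>carrier := R i\<rparr>) n C" "C n = M i"
  shows "n \<le> d"
proof (rule ccontr)
  assume n: "\<not> n \<le> d"
  interpret RI: noetherian_cring "K\<lparr>carrier := R i\<rparr>" by (rule noetherian_cring_sub[OF sub noeth])
  define Y where "Y = x i ` {1..d}"
  have Y: "finite Y" "card Y \<le> d" "Y \<subseteq> C n"
    unfolding Y_def C(2) using card_image_le[of "{1..d}" "x i"] x_mem(1) by auto
  obtain D where D: "prime_chain (K\<lparr>carrier := R i\<rparr>) n D" "D n = M i" "Y \<subseteq> D (card Y)"
    using RI.prime_chain_contains[OF Y(1) C(1) Y(3)] Y(2) n C(2) by auto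
  have "D (card Y) \<subseteq> D (n - 1)" using prime_chain_mono[OF D(1), of "card Y" "n - 1"] Y(2) n by simp
  moreover have "primeideal (D (n - 1)) (K\<lparr>carrier := R i\<rparr>)" using D(1) by (simp add: prime_chain_def)
  moreover have "\<And>l. l \<in> {1..d} \<Longrightarrow> x i l \<in> D (card Y)" using D(3) unfolding Y_def by blast
  ultimately have "M i \<subseteq> D (n - 1)" by (intro M_least primeideal.axioms(1)) blast+
  moreover have "D (n - 1) \<subset> D (Suc (n - 1))"
  proof -
    have "\<forall>i<n. D i \<subset> D (Suc i)" using D(1) by (simp add: prime_chain_def)
    moreover have "n - 1 < n" using n by simp
    ultimately show ?thesis by blast
  qed
  ultimately show False using D(2) n by simp
qed

lemma transform_prime_chain:
  assumes C: "prime_chain (K\<lparr>carrier := R i\<rparr>) n C" "C n = M i"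
    and L: "L \<subseteq> {1..d}" "k i \<in> L" "card L \<le> n" "\<And>l. l \<in> {1..d} - L \<Longrightarrow> x i l \<in> C 0"
  shows "R (Suc i) \<subseteq> localization K (R i) (C 0)"
    and "\<exists>C'. prime_chain (K\<lparr>carrier := R (Suc i)\<rparr>) n C' \<and> C' n = M (Suc i) \<and>
      C' 0 = extended_prime K (R i) (C 0) \<inter> R (Suc i)"
    and "x i (k i) \<notin> C 0"
proof -
  interpret T: monomial_transform K "R i" "R (Suc i)" d "k i" "x i" "x (Suc i)" by (rule transform)
  have "C n = T.M" using C(2) by (simp add: M_def T.M_def)
  note t = T.prime_chain_transform[OF C(1) this L]
  show "R (Suc i) \<subseteq> localization K (R i) (C 0)" by (rule t(1))
  show "x i (k i) \<notin> C 0" by (rule t(3))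
  show "\<exists>C'. prime_chain (K\<lparr>carrier := R (Suc i)\<rparr>) n C' \<and> C' n = M (Suc i) \<and>
      C' 0 = extended_prime K (R i) (C 0) \<inter> R (Suc i)" using t(2) by (simp add: M_def T.M'_def)
qed

text \<open>
  All rings of the sequence have chains of length \<open>d\<close>. In \<open>R j\<close> the chain is moved so that its second prime
  \<open>p\<close> contains \<open>x j k0\<close>. It has height one, since a longer chain below \<open>p\<close> would give a chain of length more
  than \<open>d\<close>. The part of the chain above \<open>p\<close> has length \<open>d - 1\<close>, and \<open>d - 1\<close> variables remain besides
  that of index \<open>k0\<close>, so \<open>prime_chain_transform\<close> applies to each later step.
\<close>

lemma not_switches_if_finite_direction:
  assumes C0: "prime_chain (K\<lparr>carrier := R 0\<rparr>) d C" "C d = M 0"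
    and k0: "k0 \<in> {1..d}" and fin: "finite {i. k i = k0}"
  shows "\<not> switches_strongly_infinitely_often K R"
proof -
  have chains: "\<exists>C. prime_chain (K\<lparr>carrier := R i\<rparr>) d C \<and> C d = M i" for i
  proof (induction i)
    case 0
    show ?case using C0 by blast
  next
    case (Suc i)
    then obtain C where C: "prime_chain (K\<lparr>carrier := R i\<rparr>) d C" "C d = M i" by blast
    show ?case using transform_prime_chain(2)[OF C subset_refl k_mem] by auto
  qed
  obtain j where j: "\<And>i. i \<ge> j \<Longrightarrow> k i \<noteq> k0"
    using finite_nat_set_iff_bounded[of "{i. k i = k0}"] fin by (auto simp: not_le[symmetric])
  interpret RJ: noetherian_cring "K\<lparr>carrier := R j\<rparr>" by (rule noetherian_cring_sub[OF sub noeth])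
  obtain C where "prime_chain (K\<lparr>carrier := R j\<rparr>) d C" "C d = M j" using chains by blast
  then obtain D where D: "prime_chain (K\<lparr>carrier := R j\<rparr>) d D" "D d = M j" "x j k0 \<in> D 1"
    using RJ.prime_chain_first_contains[of d C "x j k0"] d x_mem(1)[OF k0] by auto
  define p where "p = D 1"
  have p: "primeideal p (K\<lparr>carrier := R j\<rparr>)" using D(1) d by (simp add: p_def prime_chain_def)
  have Dtail: "prime_chain (K\<lparr>carrier := R j\<rparr>) (d - 1) (\<lambda>i. D (Suc i))"
    using D(1) d unfolding prime_chain_def by auto
  have hp: "height (K\<lparr>carrier := R j\<rparr>) p = 1"
  proof (rule height_eq_one)
    show "prime_chain (K\<lparr>carrier := R j\<rparr>) 1 D" using prime_chain_truncate[OF D(1)] d by simp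
    show "D 1 = p" by (simp add: p_def)
    fix n q assume q: "prime_chain (K\<lparr>carrier := R j\<rparr>) n q" "q n = p"
    \<comment> \<open>A chain ending at \<open>p\<close> is continued by the chain from \<open>p\<close> to the maximal ideal.\<close>
    define c where "c i = (if i \<le> n then q i else D (Suc (i - n)))" for i
    have "prime_chain (K\<lparr>carrier := R j\<rparr>) (n + (d - 1)) c"
      unfolding prime_chain_def
    proof (intro conjI allI impI)
      fix i assume i: "i \<le> n + (d - 1)"
      show "primeideal (c i) (K\<lparr>carrier := R j\<rparr>)"
      proof (cases "i \<le> n")
        case True
        then show ?thesis using q(1) by (simp add: c_def prime_chain_def)
      next
        case False
        then have "i - n \<le> d - 1" using i by simp
        then show ?thesis using False Dtail by (simp add: c_def prime_chain_def)
      qed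
    next
      fix i assume i: "i < n + (d - 1)"
      show "c i \<subset> c (Suc i)"
      proof (cases "i < n")
        case True
        then show ?thesis using q(1) by (simp add: c_def prime_chain_def)
      next
        case False
        have ci: "c i = D (Suc (i - n))" using False q(2) p_def by (cases "i = n") (auto simp: c_def)
        have cSi: "c (Suc i) = D (Suc (Suc (i - n)))" using False by (simp add: c_def Suc_diff_le)
        have "i - n < d - 1" using i False by simp
        then show ?thesis unfolding ci cSi using Dtail by (simp add: prime_chain_def)
      qed
    qed
    moreover have "c (n + (d - 1)) = M j" using D(2) d q(2) p_def by (auto simp: c_def)
    ultimately have "n + (d - 1) \<le> d" by (rule prime_chain_length_le)
    then show "n \<le> 1" using d by simp
  qed
  define L where "L = {1..d} - {k0}"
  have L: "L \<subseteq> {1..d}" "card L = d - 1" using k0 by (auto simp: L_def)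
  have inv: "\<exists>C. prime_chain (K\<lparr>carrier := R n\<rparr>) (d - 1) C \<and> C (d - 1) = M n \<and> x n k0 \<in> C 0 \<and>
      localization K (R n) (C 0) \<subseteq> localization K (R j) p" if "n \<ge> j" for n
    using that
  proof (induction n rule: dec_induct)
    case base
    have "D (Suc (d - 1)) = M j" using D(2) d by simp
    then show ?case using Dtail D(3) by (intro exI[of _ "\<lambda>i. D (Suc i)"]) (simp add: p_def)
  next
    case (step n)
    then obtain C where C: "prime_chain (K\<lparr>carrier := R n\<rparr>) (d - 1) C" "C (d - 1) = M n" "x n k0 \<in> C 0"
      "localization K (R n) (C 0) \<subseteq> localization K (R j) p" by blast
    have kL: "k n \<in> L" using j[OF step(1)] k_mem by (simp add: L_def)
    have xL: "\<And>l. l \<in> {1..d} - L \<Longrightarrow> x n l \<in> C 0" using C(3) by (auto simp: L_def)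
    have cL: "card L \<le> d - 1" using L(2) by simp
    note t = transform_prime_chain[OF C(1,2) L(1) kL cL xL]
    obtain C' where C': "prime_chain (K\<lparr>carrier := R (Suc n)\<rparr>) (d - 1) C'" "C' (d - 1) = M (Suc n)"
      "C' 0 = extended_prime K (R n) (C 0) \<inter> R (Suc n)" using t(2) by blast
    have P0: "primeideal (C 0) (K\<lparr>carrier := R n\<rparr>)" using C(1) by (simp add: prime_chain_def)
    have "x n k0 = x (Suc n) k0 \<otimes> x (Suc n) (k n)" using x_Suc(2)[of k0 n] k0 kL by (auto simp: L_def)
    then have "x n (k n) \<otimes> x (Suc n) k0 = x n k0"
      using x_Suc(1) x_mem(3)[OF k0] x_mem(3)[OF k_mem] m_comm by metis
    then have "x (Suc n) k0 \<in> extended_prime K (R n) (C 0)"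
      using C(3) t(3) x_mem(2)[OF k_mem] x_mem(3)[OF k0] by (intro extended_primeI[OF sub P0, of _ "x n (k n)"]) auto
    then have "x (Suc n) k0 \<in> C' 0" using C'(3) x_mem(2)[OF k0] by simp
    moreover have "localization K (R (Suc n)) (C' 0) \<subseteq> localization K (R j) p"
      using localization_localization[OF sub P0 sub t(1)] C(4) unfolding C'(3) by (rule order_trans)
    ultimately show ?case using C' by blast
  qed
  have "R n \<subseteq> localization K (R j) p" for n
  proof -
    obtain C where C: "prime_chain (K\<lparr>carrier := R (max n j)\<rparr>) (d - 1) C"
      "localization K (R (max n j)) (C 0) \<subseteq> localization K (R j) p" using inv[of "max n j"] by auto
    have "primeideal (C 0) (K\<lparr>carrier := R (max n j)\<rparr>)" using C(1) by (simp add: prime_chain_def)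
    then have "R (max n j) \<subseteq> localization K (R j) p" using subset_localization[OF sub] C(2) by blast
    then show ?thesis using R_mono[of n "max n j"] by simp
  qed
  then show ?thesis unfolding switches_strongly_infinitely_often_def using p hp by blast
qed

end

theorem theorem5p4:
  fixes K :: "('a, 'b) ring_scheme"
    and d :: nat
    and R :: "nat \<Rightarrow> 'a set"
    and x :: "nat \<Rightarrow> nat \<Rightarrow> 'a"
    and S V :: "'a set"
  assumes "field K"
    and "d \<ge> 2"
    and "\<forall>i. subring (R i) K"
    and "\<forall>i. regular_local_ring (K\<lparr>carrier := R i\<rparr>)"
    and "fraction_field K (R 0) = carrier K"
    and "krull_dim (K\<lparr>carrier := R 0\<rparr>) = enat d"
    and "x 0 ` {1..d} \<subseteq> R 0"
    and "max_ideal (K\<lparr>carrier := R 0\<rparr>) = Idl\<^bsub>K\<lparr>carrier := R 0\<rparr>\<^esub> (x 0 ` {1..d})"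
    and "\<forall>i. \<exists>k \<in> {1..d}. monomial_lqt K d k (R i) (x i) (R (Suc i)) (x (Suc i))"
    and "S = (\<Union>i. R i)"
    and "valuation_domain K V"
    and "birationally_dominates K V S"
  shows "((\<forall>k \<in> {1..d}. infinite (direction_set K d R x k)) \<longleftrightarrow>
            switches_strongly_infinitely_often K R) \<and>
         (switches_strongly_infinitely_often K R \<longleftrightarrow>
            S = V \<and> krull_dim (K\<lparr>carrier := V\<rparr>) = 1)"
proof -
  interpret field K by (rule assms(1))
  have sub: "subring (R i) K" for i using assms(3) by blast
  have noeth: "noetherian_ring (K\<lparr>carrier := R i\<rparr>)" and loc: "local_ring (K\<lparr>carrier := R i\<rparr>)" for i
    using assms(4) regular_local_ring.axioms(1,2) by blast+
  interpret N0: noetherian_cring "K\<lparr>carrier := R 0\<rparr>" by (rule noetherian_cring_sub[OF sub noeth])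
  define M0 where "M0 = max_ideal (K\<lparr>carrier := R 0\<rparr>)"
  note M0 = max_ideal_sub[OF sub noeth loc, of 0, folded M0_def]
  obtain p where p: "prime_chain (K\<lparr>carrier := R 0\<rparr>) d p" using ex_prime_chain[of d "K\<lparr>carrier := R 0\<rparr>"] assms(2,6) by auto
  \<comment> \<open>A chain that realizes the dimension is made to end at the maximal ideal.\<close>
  define C where "C = p(d := M0)"
  have pM0: "p d \<subseteq> M0"
    using prime_sub_nonunits[OF sub, of "p d" 0] p unfolding M0(1) by (simp add: prime_chain_def)
  have C: "prime_chain (K\<lparr>carrier := R 0\<rparr>) d C" "C d = M0"
  proof -
    show "prime_chain (K\<lparr>carrier := R 0\<rparr>) d C"
      unfolding prime_chain_def
    proof (intro conjI allI impI)
      fix i assume "i \<le> d"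
      then show "primeideal (C i) (K\<lparr>carrier := R 0\<rparr>)" using p M0(2) by (simp add: C_def prime_chain_def)
    next
      fix i assume i: "i < d"
      then have "p i \<subset> p (Suc i)" using p by (simp add: prime_chain_def)
      then show "C i \<subset> C (Suc i)" using i pM0 by (cases "Suc i = d") (auto simp: C_def)
    qed
    show "C d = M0" by (simp add: C_def)
  qed
  \<comment> \<open>A vanishing variable would leave \<open>d - 1\<close> generators, too few for a chain of length \<open>d\<close>.\<close>
  have x0_nz: "x 0 l \<noteq> \<zero>\<^bsub>K\<^esub>" if l: "l \<in> {1..d}" for l
  proof
    assume z: "x 0 l = \<zero>\<^bsub>K\<^esub>"
    define Y where "Y = x 0 ` ({1..d} - {l})"
    note I = Idl_sub[OF sub assms(7), folded assms(8) M0_def]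
    have Y: "finite Y" "card Y \<le> d - 1" "Y \<subseteq> C d"
      unfolding Y_def C(2) using card_image_le[of "{1..d} - {l}" "x 0"] l I(2) by auto
    obtain D where D: "prime_chain (K\<lparr>carrier := R 0\<rparr>) d D" "D d = M0" "Y \<subseteq> D (card Y)"
    proof -
      have "card Y \<le> d" using Y(2) by simp
      from N0.prime_chain_contains[OF Y(1) C(1) Y(3) this] show ?thesis using that C(2) by auto
    qed
    have DY: "D (card Y) \<subseteq> D (d - 1)" using prime_chain_mono[OF D(1) Y(2)] by simp
    have pr: "primeideal (D (d - 1)) (K\<lparr>carrier := R 0\<rparr>)" using D(1) by (simp add: prime_chain_def)
    have "x 0 ` {1..d} \<subseteq> D (d - 1)"
    proof
      fix y assume "y \<in> x 0 ` {1..d}"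
      then have "y \<in> Y \<or> y = \<zero>\<^bsub>K\<^esub>" using z by (auto simp: Y_def)
      then show "y \<in> D (d - 1)" using D(3) DY prime_sub_mem(3)[OF sub pr] by blast
    qed
    then have "M0 \<subseteq> D (d - 1)" by (rule I(3)[OF primeideal.axioms(1)[OF pr]])
    moreover have "D (d - 1) \<subset> D (Suc (d - 1))"
    proof -
      have "\<forall>i<d. D i \<subset> D (Suc i)" using D(1) by (simp add: prime_chain_def)
      moreover have "d - 1 < d" using assms(2) by simp
      ultimately show ?thesis by blast
    qed
    ultimately show False using D(2) assms(2) by simp
  qed
  obtain k where lqt: "\<And>i. monomial_lqt K d (k i) (R i) (x i) (R (Suc i)) (x (Suc i))" using assms(9) by metis
  interpret seq: monomial_sequence K d R x k
    by (intro monomial_sequence.intro monomial_sequence_axioms.intro field_axioms)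
      (rule assms(2) sub noeth loc assms(7) assms(8) lqt | erule x0_nz)+
  have SS: "S = seq.S" unfolding assms(10) seq.S_def ..
  \<comment> \<open>Two directions at one step would make a variable equal to one.\<close>
  have dirs: "direction_set K d R x l = {i. k i = l}" if l: "l \<in> {1..d}" for l
  proof -
    have "k i = l" if li: "monomial_lqt K d l (R i) (x i) (R (Suc i)) (x (Suc i))" for i
    proof (rule ccontr)
      assume ne: "k i \<noteq> l"
      have a: "x (Suc i) l = x i l" using li by (simp add: monomial_lqt_def)
      have "x i l = x (Suc i) l \<otimes>\<^bsub>K\<^esub> x (Suc i) (k i)" using seq.x_Suc(2)[of l i] l ne by auto
      then have "x i l \<otimes>\<^bsub>K\<^esub> x i (k i) = x i l \<otimes>\<^bsub>K\<^esub> \<one>\<^bsub>K\<^esub>" using a seq.x_Suc(1) seq.x_mem(3)[OF l] by simp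
      then have "x i (k i) = \<one>\<^bsub>K\<^esub>"
        using m_lcancel[of "x i l" "x i (k i)" "\<one>\<^bsub>K\<^esub>"] seq.x_mem[OF l, of i] seq.x_mem[OF seq.k_mem, of i i] by simp
      then show False using seq.x_mem(1)[OF seq.k_mem, of i i] seq.Mm(4) by simp
    qed
    then show ?thesis unfolding direction_set_def using lqt by auto
  qed
  have Vsub: "subring V K" using assms(11) by (simp add: valuation_domain_def)
  have dom: "S \<subseteq> V" "V \<subseteq> fraction_field K S" "{a \<in> V. a = \<zero>\<^bsub>K\<^esub> \<or> inv\<^bsub>K\<^esub> a \<notin> V} \<inter> S = seq.MS"
    using assms(12) unfolding birationally_dominates_def valuation_domain_max_ideal[OF assms(11)] SS seq.S_max_ideal
    by auto
  have 13: "S = V \<and> krull_dim (K\<lparr>carrier := V\<rparr>) = 1" if one: "\<forall>k \<in> {1..d}. infinite (direction_set K d R x k)"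
  proof -
    have inf: "\<And>l. l \<in> {1..d} \<Longrightarrow> infinite {i. k i = l}" using one dirs by simp
    have "V = seq.S" by (rule seq.dominating_eq_S[OF inf Vsub dom[unfolded SS]])
    then show ?thesis using seq.krull_dim_S[OF inf] SS by simp
  qed
  have 32: "switches_strongly_infinitely_often K R" if "S = V \<and> krull_dim (K\<lparr>carrier := V\<rparr>) = 1"
    using that seq.switches_if_rank_one SS by simp
  have 21: "\<forall>k \<in> {1..d}. infinite (direction_set K d R x k)" if sw: "switches_strongly_infinitely_often K R"
  proof
    fix l assume l: "l \<in> {1..d}"
    have "C d = seq.M 0" using C(2) by (simp add: seq.M_def M0_def)
    from seq.not_switches_if_finite_direction[OF C(1) this l] show "infinite (direction_set K d R x l)"
      using sw dirs[OF l] by auto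
  qed
  show ?thesis using 13 32 21 by blast
qed

end
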